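(* Let $d\ge1$, $\gamma>1$ and $\alpha\in(0,1]$. Suppose that $\mu$ is a positive Borel measure with $\operatorname{supp}\mu\subset[0,1]$ such that, for some finite $C_0$, $\mu((t-\rho,t+\rho))\le C_0\rho^\alpha$ for all $(t,\rho)\in\mathbb R\times(0,\infty)$. Then, for any $s\ge\alpha(1-\gamma)/2$, there exists a constant $C$ such that for all $f\in H^s(\mathbb R^d)$ $$\|U_t^\gamma f\|_{L^2_t(d\mu;L^2_x(\mathbb B^d))}\le C\|f\|_{H^s}.$$
   Context: For $\gamma>0$, $U_t^\gamma f(x)=e^{it(-\Delta)^{\gamma/2}}f(x)=(2\pi)^{-d}\int_{\mathbb R^d}e^{i(\langle x,\xi\rangle+t|\xi|^\gamma)}\widehat f(\xi)\,d\xi$, with $\widehat f(\xi)=\int e^{-i\langle x,\xi\rangle}f(x)\,dx$. $\mathbb B^d$ is a unit ball in $\mathbb R^d$. $\|f\|_{H^s}^2=\int(1+|\xi|^2)^s|\widehat f(\xi)|^2\,d\xi$. $\|u\|_{L^2_t(d\mu;L^2_x(\mathbb B^d))}$ is the $L^2(\mathbb R,\mu)$ norm of $t\mapsto\|u(\cdot,t)\|_{L^2(\mathbb B^d)}$. *)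

theory Defs
  imports "HOL-Analysis.Analysis"
begin

section \<open>Smooth functions, test functions and Schwartz functions\<close>

fun iterated_partial :: "'a list \<Rightarrow> ('a::euclidean_space \<Rightarrow> complex) \<Rightarrow> 'a \<Rightarrow> complex" where
  "iterated_partial [] f = f"
| "iterated_partial (v # vs) f = (\<lambda>x. frechet_derivative (iterated_partial vs f) (at x) v)"

text \<open>Every iterated partial derivative is (Frechet) differentiable, hence continuous; so this
  is the usual notion of an infinitely differentiable function.\<close>

definition smooth :: "('a::euclidean_space \<Rightarrow> complex) \<Rightarrow> bool" where
  "smooth f \<longleftrightarrow> (\<forall>vs\<in>lists Basis. iterated_partial vs f differentiable_on UNIV)"

definition test_function_on :: "'a::euclidean_space set \<Rightarrow> ('a \<Rightarrow> complex) \<Rightarrow> bool" where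
  "test_function_on S \<phi> \<longleftrightarrow>
     smooth \<phi> \<and> compact (closure {x. \<phi> x \<noteq> 0}) \<and> closure {x. \<phi> x \<noteq> 0} \<subseteq> S"

definition schwartz :: "('a::euclidean_space \<Rightarrow> complex) set" where
  "schwartz = {\<phi>. smooth \<phi> \<and>
     (\<forall>vs\<in>lists Basis. \<forall>k::nat. \<exists>K. \<forall>x. (1 + norm x) ^ k * norm (iterated_partial vs \<phi> x) \<le> K)}"

definition schwartz_seminorm :: "nat \<Rightarrow> ('a::euclidean_space \<Rightarrow> complex) \<Rightarrow> real" where
  "schwartz_seminorm N \<phi> =
     (SUP (vs, x) \<in> {vs \<in> lists Basis. length vs \<le> N} \<times> UNIV.
        (1 + norm x) ^ N * norm (iterated_partial vs \<phi> x))"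


section \<open>Tempered distributions and their Fourier transform\<close>

text \<open>A distribution is a functional on functions of which only the values on Schwartz functions
  matter. A function \<open>h\<close> is identified with \<open>\<lambda>\<phi>. \<integral>x. h x * \<phi> x\<close> (no complex conjugation).\<close>

type_synonym 'a distribution = "('a \<Rightarrow> complex) \<Rightarrow> complex"

definition tempered :: "'a::euclidean_space distribution \<Rightarrow> bool" where
  "tempered T \<longleftrightarrow>
     (\<forall>\<phi>\<in>schwartz. \<forall>\<psi>\<in>schwartz. \<forall>a b.
        T (\<lambda>x. a * \<phi> x + b * \<psi> x) = a * T \<phi> + b * T \<psi>) \<and>
     (\<exists>N K. \<forall>\<phi>\<in>schwartz. norm (T \<phi>) \<le> K * schwartz_seminorm N \<phi>)"

definition fourier :: "('a::euclidean_space \<Rightarrow> complex) \<Rightarrow> 'a \<Rightarrow> complex" where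
  "fourier \<phi> \<xi> = (\<integral>x. cis (- (x \<bullet> \<xi>)) * \<phi> x \<partial>lborel)"

definition inv_fourier :: "('a::euclidean_space \<Rightarrow> complex) \<Rightarrow> 'a \<Rightarrow> complex" where
  "inv_fourier \<phi> x = of_real (1 / (2 * pi) ^ DIM('a)) * (\<integral>\<xi>. cis (x \<bullet> \<xi>) * \<phi> \<xi> \<partial>lborel)"

text \<open>The distributional Fourier transform of \<open>T\<close>, that is \<open>\<phi> \<mapsto> T (fourier \<phi>)\<close>, is the
  function \<open>g\<close>.\<close>

definition has_fourier_function :: "'a::euclidean_space distribution \<Rightarrow> ('a \<Rightarrow> complex) \<Rightarrow> bool" where
  "has_fourier_function T g \<longleftrightarrow> g \<in> borel_measurable borel \<and>
     (\<forall>\<phi>\<in>schwartz. integrable lborel (\<lambda>\<xi>. g \<xi> * \<phi> \<xi>) \<and>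
        T (fourier \<phi>) = (\<integral>\<xi>. g \<xi> * \<phi> \<xi> \<partial>lborel))"

text \<open>Such a function is unique up to null sets, so the choice below is immaterial.\<close>

definition fourier_function :: "'a::euclidean_space distribution \<Rightarrow> 'a \<Rightarrow> complex" where
  "fourier_function T = (SOME g. has_fourier_function T g)"


section \<open>Sobolev spaces and the propagator\<close>

text \<open>For negative \<open>s\<close> the elements of \<open>H\<^sup>s\<close> need not be functions.\<close>

definition sobolev :: "real \<Rightarrow> 'a::euclidean_space distribution set" where
  "sobolev s = {T. tempered T \<and> (\<exists>g. has_fourier_function T g) \<and>
     integrable lborel (\<lambda>\<xi>. (1 + (norm \<xi>)\<^sup>2) powr s * (norm (fourier_function T \<xi>))\<^sup>2)}"

definition sobolev_norm :: "real \<Rightarrow> 'a::euclidean_space distribution \<Rightarrow> real" where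
  "sobolev_norm s T =
     sqrt (\<integral>\<xi>. (1 + (norm \<xi>)\<^sup>2) powr s * (norm (fourier_function T \<xi>))\<^sup>2 \<partial>lborel)"

text \<open>\<open>propagator \<gamma> t T\<close> is the inverse Fourier transform of the function
  \<open>\<xi> \<mapsto> exp (i t |\<xi>|^\<gamma>) * fourier_function T \<xi>\<close>, as a distribution (the inverse Fourier
  transform being moved to the test function).\<close>

definition propagator ::
    "real \<Rightarrow> real \<Rightarrow> 'a::euclidean_space distribution \<Rightarrow> 'a distribution" where
  "propagator \<gamma> t T =
     (\<lambda>\<phi>. \<integral>\<xi>. cis (t * norm \<xi> powr \<gamma>) * fourier_function T \<xi> * inv_fourier \<phi> \<xi> \<partial>lborel)"

text \<open>When the Fourier transform of \<open>T\<close> is integrable, this distribution is the function given by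
  the oscillatory integral
  \<open>(2\<pi>)^(-d) \<integral> exp (i (x \<bullet> \<xi> + t |\<xi>|^\<gamma>)) * fourier_function T \<xi> d\<xi>\<close>.\<close>

lemma propagator_eq_oscillatory_integral:
  fixes T :: "'a::euclidean_space distribution"
  assumes g: "integrable lborel (fourier_function T)" and \<phi>: "integrable lborel \<phi>"
  shows "propagator \<gamma> t T \<phi> =
    (\<integral>x. of_real (1 / (2 * pi) ^ DIM('a)) *
           (\<integral>\<xi>. cis (x \<bullet> \<xi> + t * norm \<xi> powr \<gamma>) * fourier_function T \<xi> \<partial>lborel) * \<phi> x \<partial>lborel)"
proof -
  let ?c = "of_real (1 / (2 * pi) ^ DIM('a)) :: complex"
  let ?g = "fourier_function T"
  let ?F = "\<lambda>x \<xi>. cis (x \<bullet> \<xi> + t * norm \<xi> powr \<gamma>) * ?g \<xi> * \<phi> x"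
  have [measurable]: "?g \<in> borel_measurable borel" "\<phi> \<in> borel_measurable borel"
    using g \<phi> by (auto dest: borel_measurable_integrable)
  have [measurable]: "cis \<in> borel_measurable borel"
    by (intro borel_measurable_continuous_onI continuous_intros)
  have prod: "integrable (lborel \<Otimes>\<^sub>M lborel) (\<lambda>(x, \<xi>). \<phi> x * ?g \<xi>)"
    using lborel_pair.Fubini_integrable[of "\<lambda>(x, \<xi>). \<phi> x * ?g \<xi>"] g \<phi>
    by (simp add: norm_mult)
  have int: "integrable (lborel \<Otimes>\<^sub>M lborel) (\<lambda>(x, \<xi>). ?F x \<xi>)"
    by (rule Bochner_Integration.integrable_bound[OF prod])
       (auto simp: norm_mult norm_cis split_beta)
  have "propagator \<gamma> t T \<phi> = (\<integral>\<xi>. (\<integral>x. ?c * ?F x \<xi> \<partial>lborel) \<partial>lborel)"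
    unfolding propagator_def inv_fourier_def
    by (intro Bochner_Integration.integral_cong refl)
       (simp add: cis_mult[symmetric] inner_commute mult.commute mult.left_commute
             flip: integral_mult_right_zero)
  also have "\<dots> = ?c * (\<integral>\<xi>. (\<integral>x. ?F x \<xi> \<partial>lborel) \<partial>lborel)" by simp
  also have "\<dots> = ?c * (\<integral>x. (\<integral>\<xi>. ?F x \<xi> \<partial>lborel) \<partial>lborel)"
    using lborel_pair.Fubini_integral[OF int] by simp
  also have "\<dots> = (\<integral>x. ?c * (\<integral>\<xi>. cis (x \<bullet> \<xi> + t * norm \<xi> powr \<gamma>) * ?g \<xi> \<partial>lborel) * \<phi> x \<partial>lborel)"
    by (simp add: mult.assoc flip: integral_mult_left_zero integral_mult_right_zero)
  finally show ?thesis .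
qed

text \<open>The restriction of the distribution \<open>T\<close> to the open set \<open>S\<close> is the function \<open>v\<close> in
  \<open>L\<^sup>2(S)\<close>.\<close>

definition restricts_to_L2 ::
    "'a::euclidean_space distribution \<Rightarrow> 'a set \<Rightarrow> ('a \<Rightarrow> complex) \<Rightarrow> bool" where
  "restricts_to_L2 T S v \<longleftrightarrow> v \<in> borel_measurable borel \<and>
     set_integrable lborel S (\<lambda>x. (norm (v x))\<^sup>2) \<and>
     (\<forall>\<phi>. test_function_on S \<phi> \<longrightarrow> T \<phi> = (LINT x:S|lborel. v x * \<phi> x))"


section \<open>Measures and \<open>L\<^sup>2\<close> norms\<close>

definition measure_support :: "'a::topological_space measure \<Rightarrow> 'a set" where
  "measure_support M = {x. \<forall>U. open U \<and> x \<in> U \<longrightarrow> emeasure M U > 0}"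

definition L2_norm :: "'b measure \<Rightarrow> ('b \<Rightarrow> ennreal) \<Rightarrow> ennreal" where
  "L2_norm M f = (let I = \<integral>\<^sup>+x. (f x)\<^sup>2 \<partial>M in if I = \<infinity> then \<infinity> else ennreal (sqrt (enn2real I)))"

text \<open>For a function \<open>u t x\<close> of time and space: the \<open>L\<^sup>2(M)\<close> norm of
  \<open>t \<mapsto> \<parallel>u t\<parallel>\<close>, the inner norm being that of \<open>L\<^sup>2(S)\<close>.\<close>

definition mixed_L2_norm ::
    "real measure \<Rightarrow> 'a::euclidean_space set \<Rightarrow> (real \<Rightarrow> 'a \<Rightarrow> complex) \<Rightarrow> ennreal" where
  "mixed_L2_norm M S u =
     L2_norm M (\<lambda>t. L2_norm (restrict_space lborel S) (\<lambda>x. ennreal (norm (u t x))))"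

end

theory Submission
  imports Defs "HOL-Probability.Characteristic_Functions"
begin

text \<open>On the unit ball the indicator of the unit ball has a Fourier transform bounded away from \<open>0\<close>.
  Hence, up to a constant, the \<open>L\<^sup>2\<close> norm over the ball of a Fourier integral with density \<open>F\<close> is
  at most the \<open>L\<^sup>2\<close> norm in \<open>\<zeta>\<close> of the local masses \<open>\<integral> F\<close> over the balls \<open>ball \<zeta> 1\<close>. So it suffices
  to bound, for each \<open>\<zeta>\<close> with \<open>|\<zeta>| = k\<close>, the operator sending \<open>F\<close> to the function
  \<open>\<integral> cis (t |\<xi>|^\<gamma>) F \<xi> d\<xi>\<close> of \<open>t\<close>, integrated over \<open>ball \<zeta> 1\<close>, from \<open>L\<^sup>2\<close> into \<open>L\<^sup>2(\<mu>)\<close>, by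
  \<open>k^(\<alpha>(1-\<gamma>)/2)\<close>. On this ball \<open>|\<xi>|^\<gamma>\<close> runs through an interval of length
  comparable to \<open>\<Lambda> = k^(\<gamma>-1)\<close>, with density at most comparable to \<open>1/\<Lambda>\<close>. The adjoint operator is
  therefore controlled by \<open>1/\<Lambda>\<close> times the integral of \<open>|(h \<mu>)^|\<^sup>2\<close> over such an interval; bounding the
  indicator of the interval by a Gaussian and applying Schur's test to the resulting Gaussian kernel
  on \<open>L\<^sup>2(\<mu>)\<close> gives \<open>\<Lambda>^(-\<alpha>)\<close>, because \<open>\<mu>\<close> has mass at most a multiple of \<open>\<Lambda>^(-\<alpha>)\<close> at scale \<open>1/\<Lambda>\<close>.\<close>

section \<open>Gaussians\<close>

text \<open>The space norm sees only a unit ball, so frequencies can be told apart down to distance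
  about 1, which fixes the size of the frequency balls. Reassembling them loses only constants: the
  Sobolev weight is comparable at points of distance less than 1, and every \<xi> lies in
  \<open>ball \<zeta> 1\<close> for a set of \<zeta> of fixed volume. Low frequencies have no useful
  oscillation and rest on the finiteness of \<mu> alone. The second obstacle is the meaning of the
  solution. The endpoint exponent \<alpha>(1-\<gamma>)/2 is negative, so the Fourier function is
  square integrable only against a decaying weight and the oscillatory integral need not converge.
  The estimates are therefore proved for integrable densities, and the solution is built as a limit
  of sharp frequency truncations. The exceptional null set of times must be fixed before the test
  function is; this calls for almost everywhere convergence with one dominating function per time,
  and for the decay of transforms of test functions, which makes the limit pairings
  converge.\<close>

lemma borel_measurable_cis [measurable]: "cis \<in> borel_measurable borel"
  by (intro borel_measurable_continuous_onI continuous_intros)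

lemma lborel_prod_Basis:
  fixes f :: "'a::euclidean_space \<Rightarrow> real \<Rightarrow> complex"
  assumes f: "\<And>b. b \<in> Basis \<Longrightarrow> integrable lborel (f b)"
  shows integrable_lborel_prod_Basis: "integrable lborel (\<lambda>x::'a. \<Prod>b\<in>Basis. f b (x \<bullet> b))"
    and integral_lborel_prod_Basis:
      "(\<integral>x. (\<Prod>b\<in>Basis. f b ((x::'a) \<bullet> b)) \<partial>lborel) = (\<Prod>b\<in>Basis. \<integral>x. f b x \<partial>lborel)"
proof -
  interpret product_sigma_finite "\<lambda>_::'a. lborel :: real measure" ..
  let ?P = "\<Pi>\<^sub>M b\<in>(Basis::'a set). (lborel :: real measure)"
  let ?T = "\<lambda>f. \<Sum>b\<in>Basis. f b *\<^sub>R b :: 'a"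
  have [measurable]: "b \<in> Basis \<Longrightarrow> f b \<in> borel_measurable borel" for b
    using borel_measurable_integrable[OF f] by simp
  have T[measurable]: "?T \<in> measurable ?P borel" by measurable
  have m: "(\<lambda>x::'a. \<Prod>b\<in>Basis. f b (x \<bullet> b)) \<in> borel_measurable borel" by measurable
  have eq: "(\<Prod>b\<in>Basis. f b (?T g \<bullet> b)) = (\<Prod>b\<in>Basis. f b (g b))" for g
    by (intro prod.cong refl) simp
  show "integrable lborel (\<lambda>x::'a. \<Prod>b\<in>Basis. f b (x \<bullet> b))"
    by (subst arg_cong[OF lborel_eq, of "\<lambda>M. integrable M _"], unfold integrable_distr_eq[OF T m] eq)
       (rule product_integrable_prod, use f in auto)
  show "(\<integral>x. (\<Prod>b\<in>Basis. f b ((x::'a) \<bullet> b)) \<partial>lborel) = (\<Prod>b\<in>Basis. \<integral>x. f b x \<partial>lborel)"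
    by (subst arg_cong[OF lborel_eq, of "\<lambda>M. integral\<^sup>L M _"], unfold integral_distr[OF T m] eq)
       (rule product_integral_prod, use f in auto)
qed

text \<open>The Gaussian is sqrt (2 * pi) times the standard normal density, so its transform is a
  multiple of the characteristic function of the normal distribution.\<close>

lemma gaussian_cis_real:
  fixes t :: real
  shows "integrable lborel (\<lambda>x. complex_of_real (exp (- x\<^sup>2 / 2)) * cis (x * t))"
    and "(\<integral>x. complex_of_real (exp (- x\<^sup>2 / 2)) * cis (x * t) \<partial>lborel) =
      complex_of_real (sqrt (2 * pi) * exp (- t\<^sup>2 / 2))"
proof -
  have eq: "complex_of_real (exp (- x\<^sup>2 / 2)) * cis (x * t) =
      sqrt (2 * pi) *\<^sub>R (std_normal_density x *\<^sub>R iexp (t * x))" for x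
  proof -
    have "iexp (t * x) = cis (x * t)"
      by (simp only: cis_conv_exp mult.commute[of t])
    moreover have "exp (- x\<^sup>2 / 2) = sqrt (2 * pi) * std_normal_density x"
      unfolding std_normal_density_def by simp
    ultimately show ?thesis
      by (simp only: scaleR_conv_of_real of_real_mult mult.assoc)
  qed
  have n: "integrable lborel std_normal_density"
    using integrable_std_normal_moment[of 0] by simp
  have "integrable lborel (\<lambda>x. std_normal_density x *\<^sub>R iexp (t * x))"
    by (rule Bochner_Integration.integrable_bound[OF n]) auto
  then show "integrable lborel (\<lambda>x. complex_of_real (exp (- x\<^sup>2 / 2)) * cis (x * t))"
    unfolding eq by (rule integrable_scaleR_right)
  have "(\<integral>x. std_normal_density x *\<^sub>R iexp (t * x) \<partial>lborel) = char std_normal_distribution t"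
    unfolding char_def by (subst integral_density) auto
  then show "(\<integral>x. complex_of_real (exp (- x\<^sup>2 / 2)) * cis (x * t) \<partial>lborel) =
      complex_of_real (sqrt (2 * pi) * exp (- t\<^sup>2 / 2))"
    unfolding eq by (simp add: char_std_normal_distribution scaleR_conv_of_real)
qed

text \<open>Gaussian and character both factor over the coordinates, which reduces the transform to
  dimension one.\<close>

lemma gaussian_cis:
  fixes \<xi> :: "'a::euclidean_space"
  shows integrable_gaussian_cis:
      "integrable lborel (\<lambda>x. complex_of_real (exp (- (norm x)\<^sup>2 / 2)) * cis (x \<bullet> \<xi>))"
    and integral_gaussian_cis:
      "(\<integral>x. complex_of_real (exp (- (norm x)\<^sup>2 / 2)) * cis (x \<bullet> \<xi>) \<partial>lborel) =
        complex_of_real (sqrt (2 * pi) ^ DIM('a) * exp (- (norm \<xi>)\<^sup>2 / 2))"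
proof -
  have norm: "- (norm y)\<^sup>2 / 2 = (\<Sum>b\<in>Basis. - (y \<bullet> b)\<^sup>2 / 2)" for y :: 'a
    by (subst power2_norm_eq_inner, subst euclidean_inner)
       (simp add: power2_eq_square sum_negf sum_divide_distrib)
  have cis_sum: "cis (\<Sum>b\<in>A. h b) = (\<Prod>b\<in>A. cis (h b))" if "finite A" for A :: "'a set" and h
    using that
  proof induction
    case (insert x F)
    then show ?case by (simp add: cis_mult insert.IH[symmetric])
  qed simp
  have eq: "complex_of_real (exp (- (norm x)\<^sup>2 / 2)) * cis (x \<bullet> \<xi>) =
      (\<Prod>b\<in>Basis. complex_of_real (exp (- (x \<bullet> b)\<^sup>2 / 2)) * cis ((x \<bullet> b) * (\<xi> \<bullet> b)))" for x
    by (simp only: norm[of x] euclidean_inner[of x \<xi>] exp_sum[OF finite_Basis] cis_sum[OF finite_Basis]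
        prod.distrib of_real_prod)
  show "integrable lborel (\<lambda>x. complex_of_real (exp (- (norm x)\<^sup>2 / 2)) * cis (x \<bullet> \<xi>))"
    unfolding eq by (intro integrable_lborel_prod_Basis gaussian_cis_real)
  have "(\<integral>x. complex_of_real (exp (- (norm x)\<^sup>2 / 2)) * cis (x \<bullet> \<xi>) \<partial>lborel) =
      (\<Prod>b\<in>Basis. \<integral>x. complex_of_real (exp (- x\<^sup>2 / 2)) * cis (x * (\<xi> \<bullet> b)) \<partial>lborel)"
    unfolding eq by (rule integral_lborel_prod_Basis[OF gaussian_cis_real(1)])
  also have "\<dots> = (\<Prod>b\<in>Basis. complex_of_real (sqrt (2 * pi) * exp (- (\<xi> \<bullet> b)\<^sup>2 / 2)))"
    by (intro prod.cong refl gaussian_cis_real(2))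
  also have "\<dots> = complex_of_real (\<Prod>b\<in>Basis. sqrt (2 * pi) * exp (- (\<xi> \<bullet> b)\<^sup>2 / 2))"
    by (simp only: of_real_prod)
  also have "(\<Prod>b\<in>Basis. sqrt (2 * pi) * exp (- (\<xi> \<bullet> b)\<^sup>2 / 2)) = sqrt (2 * pi) ^ DIM('a) * exp (- (norm \<xi>)\<^sup>2 / 2)"
    by (simp only: norm[of \<xi>] exp_sum[OF finite_Basis] prod.distrib prod_constant)
  finally show "(\<integral>x. complex_of_real (exp (- (norm x)\<^sup>2 / 2)) * cis (x \<bullet> \<xi>) \<partial>lborel) =
      complex_of_real (sqrt (2 * pi) ^ DIM('a) * exp (- (norm \<xi>)\<^sup>2 / 2))" .
qed

section \<open>Affine changes of variables and the rescaled Gaussian\<close>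

lemma lborel_affine_change:
  fixes x0 :: "'a::euclidean_space" and f :: "'a \<Rightarrow> 'b::{banach, second_countable_topology}"
    and g :: "'a \<Rightarrow> ennreal"
  assumes c: "c \<noteq> 0"
  shows nn_integral_lborel_affine: "g \<in> borel_measurable borel \<Longrightarrow>
      (\<integral>\<^sup>+x. g x \<partial>lborel) = ennreal (\<bar>c\<bar> ^ DIM('a)) * (\<integral>\<^sup>+x. g (x0 + c *\<^sub>R x) \<partial>lborel)"
    and integrable_lborel_affine: "f \<in> borel_measurable borel \<Longrightarrow>
      integrable lborel f \<longleftrightarrow> integrable lborel (\<lambda>x. f (x0 + c *\<^sub>R x))"
    and integral_lborel_affine: "f \<in> borel_measurable borel \<Longrightarrow>
      (\<integral>x. f x \<partial>lborel) = \<bar>c\<bar> ^ DIM('a) *\<^sub>R (\<integral>x. f (x0 + c *\<^sub>R x) \<partial>lborel)"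
proof -
  note l = lborel_affine[OF c, of x0]
  have [measurable]: "(\<lambda>x. x0 + c *\<^sub>R x) \<in> measurable lborel borel" by measurable
  { assume [measurable]: "g \<in> borel_measurable borel"
    show "(\<integral>\<^sup>+x. g x \<partial>lborel) = ennreal (\<bar>c\<bar> ^ DIM('a)) * (\<integral>\<^sup>+x. g (x0 + c *\<^sub>R x) \<partial>lborel)"
      by (rule trans[OF arg_cong[OF l, of "\<lambda>M. nn_integral M g"]])
        (simp add: nn_integral_density nn_integral_distr nn_integral_cmult ennreal_power) }
  assume [measurable]: "f \<in> borel_measurable borel"
  have *: "integrable lborel (\<lambda>x. k *\<^sub>R f (x0 + c *\<^sub>R x)) \<longleftrightarrow> integrable lborel (\<lambda>x. f (x0 + c *\<^sub>R x))"
    if "k \<noteq> 0" for k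
    using that integrable_scaleR_right[of "inverse k" lborel "\<lambda>x. k *\<^sub>R f (x0 + c *\<^sub>R x)"]
      integrable_scaleR_right[of k lborel "\<lambda>x. f (x0 + c *\<^sub>R x)"] by auto
  show "integrable lborel f \<longleftrightarrow> integrable lborel (\<lambda>x. f (x0 + c *\<^sub>R x))"
    by (rule trans[OF arg_cong[OF l, of "\<lambda>M. integrable M f"]])
      (use c in \<open>simp add: integrable_density integrable_distr_eq *\<close>)
  show "(\<integral>x. f x \<partial>lborel) = \<bar>c\<bar> ^ DIM('a) *\<^sub>R (\<integral>x. f (x0 + c *\<^sub>R x) \<partial>lborel)"
    by (rule trans[OF arg_cong[OF l, of "\<lambda>M. integral\<^sup>L M f"]])
      (use c in \<open>simp add: integral_density integral_distr\<close>)
qed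

text \<open>The centre \<open>x0\<close> contributes only the unimodular factor
  \<open>cis (x0 \<bullet> \<xi>)\<close>, which is why the value is recorded in absolute value; the
  width \<open>r\<close> becomes decay at scale 1/r.\<close>

lemma gaussian_affine_cis:
  fixes \<xi> x0 :: "'a::euclidean_space"
  assumes r: "r > 0"
  shows integrable_gaussian_affine_cis:
      "integrable lborel (\<lambda>x. complex_of_real (exp (- (norm ((x - x0) /\<^sub>R r))\<^sup>2 / 2)) * cis (x \<bullet> \<xi>))"
    and norm_integral_gaussian_affine_cis:
      "norm (\<integral>x. complex_of_real (exp (- (norm ((x - x0) /\<^sub>R r))\<^sup>2 / 2)) * cis (x \<bullet> \<xi>) \<partial>lborel) =
        r ^ DIM('a) * sqrt (2 * pi) ^ DIM('a) * exp (- (norm (r *\<^sub>R \<xi>))\<^sup>2 / 2)"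
proof -
  let ?f = "\<lambda>x. complex_of_real (exp (- (norm ((x - x0) /\<^sub>R r))\<^sup>2 / 2)) * cis (x \<bullet> \<xi>)"
  have eq: "?f (x0 + r *\<^sub>R x) = cis (x0 \<bullet> \<xi>) * (complex_of_real (exp (- (norm x)\<^sup>2 / 2)) * cis (x \<bullet> (r *\<^sub>R \<xi>)))" for x
  proof -
    have "(x0 + r *\<^sub>R x - x0) /\<^sub>R r = x" using r by simp
    moreover have "cis ((x0 + r *\<^sub>R x) \<bullet> \<xi>) = cis (x0 \<bullet> \<xi>) * cis (x \<bullet> (r *\<^sub>R \<xi>))"
      by (simp add: cis_mult inner_add_left)
    ultimately show ?thesis by (simp only: mult.left_commute)
  qed
  have m[measurable]: "?f \<in> borel_measurable borel" by measurable
  have c: "r \<noteq> 0" using r by simp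
  show "integrable lborel ?f"
    unfolding integrable_lborel_affine[OF c m, of x0] eq
    by (intro integrable_mult_right integrable_gaussian_cis)
  have *: "(\<integral>x. ?f x \<partial>lborel) = r ^ DIM('a) *\<^sub>R (cis (x0 \<bullet> \<xi>) * (sqrt (2 * pi) ^ DIM('a) * exp (- (norm (r *\<^sub>R \<xi>))\<^sup>2 / 2)))"
    unfolding integral_lborel_affine[OF c m, of x0] eq integral_mult_right_zero integral_gaussian_cis
    using r by simp
  show "norm (\<integral>x. ?f x \<partial>lborel) = r ^ DIM('a) * sqrt (2 * pi) ^ DIM('a) * exp (- (norm (r *\<^sub>R \<xi>))\<^sup>2 / 2)"
    unfolding * unfolding norm_scaleR[of _ "_ :: complex"] norm_mult norm_power norm_of_real norm_cis using r by simp
qed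

section \<open>Schur's test for weighted Fourier integrals\<close>

lemma borel_measurable_cnj [measurable]: "cnj \<in> borel_measurable borel"
  by (intro borel_measurable_continuous_onI continuous_intros)

lemma (in pair_sigma_finite) integrable_mult_prod:
  fixes f :: "'a \<Rightarrow> 'c::{real_normed_field, banach, second_countable_topology}"
  assumes "integrable M1 f" "integrable M2 g"
  shows "integrable (M1 \<Otimes>\<^sub>M M2) (\<lambda>(x, y). f x * g y)"
proof (rule Fubini_integrable)
  have [measurable]: "f \<in> borel_measurable M1" "g \<in> borel_measurable M2"
    using assms by (auto dest: borel_measurable_integrable)
  show "(\<lambda>(x, y). f x * g y) \<in> borel_measurable (M1 \<Otimes>\<^sub>M M2)" by measurable
qed (use assms in \<open>auto simp: norm_mult\<close>)

text \<open>The left-hand side is a quadratic form in \<open>K\<close> whose kernel is the Fourier transform of \<open>p\<close> at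
  \<open>\<xi> - \<eta>\<close>, and \<open>S\<close> is the bound for it in Schur's test.\<close>

lemma weighted_L2_transform_le:
  fixes N :: "'a::euclidean_space measure" and p q :: "'a \<Rightarrow> real" and K :: "'a \<Rightarrow> complex"
  assumes N: "sigma_finite_measure N" "sets N = sets borel"
    and p: "integrable lborel p" "\<And>x. 0 \<le> p x"
    and K: "integrable N K"
    and q[measurable]: "q \<in> borel_measurable borel" and q_sym: "\<And>\<zeta>. q (- \<zeta>) = q \<zeta>"
    and le_q: "\<And>\<zeta>. norm (\<integral>x. of_real (p x) * cis (x \<bullet> \<zeta>) \<partial>lborel) \<le> q \<zeta>"
    and S: "\<And>\<xi>. (\<integral>\<^sup>+\<eta>. ennreal (q (\<xi> - \<eta>)) \<partial>N) \<le> S"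
  shows "(\<integral>\<^sup>+x. ennreal (p x * (norm (\<integral>\<xi>. cis (x \<bullet> \<xi>) * K \<xi> \<partial>N))\<^sup>2) \<partial>lborel) \<le>
    S * (\<integral>\<^sup>+\<xi>. ennreal ((norm (K \<xi>))\<^sup>2) \<partial>N)"
proof -
  interpret N: sigma_finite_measure N by fact
  interpret NN: pair_sigma_finite N N ..
  interpret L: pair_sigma_finite "lborel :: 'a measure" "N \<Otimes>\<^sub>M N" ..
  have [measurable_cong]: "sets N = sets borel" by fact
  have KN[measurable]: "K \<in> borel_measurable N" and [measurable]: "p \<in> borel_measurable borel"
    using K p by (auto dest: borel_measurable_integrable)
  have KB[measurable]: "K \<in> borel_measurable borel"
    using KN unfolding measurable_cong_sets[OF N(2) refl] .
  have s2: "sets (N \<Otimes>\<^sub>M N) = sets (borel \<Otimes>\<^sub>M borel)"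
    by (intro sets_pair_measure_cong N)
  have s3: "sets (lborel \<Otimes>\<^sub>M (N \<Otimes>\<^sub>M N)) = sets (borel \<Otimes>\<^sub>M (borel \<Otimes>\<^sub>M borel))"
    by (intro sets_pair_measure_cong N sets_lborel)
  have q0: "0 \<le> q \<zeta>" for \<zeta> using le_q[of \<zeta>] norm_ge_zero order_trans by blast
  let ?F = "\<lambda>x. \<integral>\<xi>. cis (x \<bullet> \<xi>) * K \<xi> \<partial>N"
  let ?k = "\<lambda>(\<xi>, \<eta>). K \<xi> * cnj (K \<eta>)"
  let ?f = "\<lambda>(x, (\<xi>, \<eta>)). of_real (p x) * cis (x \<bullet> (\<xi> - \<eta>)) * (K \<xi> * cnj (K \<eta>))"
  let ?G = "\<lambda>(\<xi>, \<eta>). (\<integral>x. of_real (p x) * cis (x \<bullet> (\<xi> - \<eta>)) \<partial>lborel) * (K \<xi> * cnj (K \<eta>))"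
  have k: "integrable (N \<Otimes>\<^sub>M N) ?k"
    using NN.integrable_mult_prod[of K "\<lambda>\<eta>. cnj (K \<eta>)"] K by simp
  have pk: "integrable (lborel \<Otimes>\<^sub>M (N \<Otimes>\<^sub>M N)) (\<lambda>(x, y). complex_of_real (p x) * ?k y)"
    by (rule L.integrable_mult_prod) (use p k in auto)
  have f: "integrable (lborel \<Otimes>\<^sub>M (N \<Otimes>\<^sub>M N)) ?f"
  proof (rule Bochner_Integration.integrable_bound[OF pk])
    show "?f \<in> borel_measurable (lborel \<Otimes>\<^sub>M (N \<Otimes>\<^sub>M N))"
      unfolding measurable_cong_sets[OF s3 refl] by measurable
  qed (auto simp: norm_mult)
  \<comment> \<open>The square is opened into a double integral over
    \<open>N \<Otimes>\<^sub>M N\<close>, so that integrating in \<open>x\<close> first produces the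
    kernel.\<close>
  have F: "of_real ((norm (?F x))\<^sup>2) = (\<integral>(\<xi>, \<eta>). cis (x \<bullet> (\<xi> - \<eta>)) * (K \<xi> * cnj (K \<eta>)) \<partial>(N \<Otimes>\<^sub>M N))" for x
  proof -
    have i: "integrable N (\<lambda>\<xi>. cis (x \<bullet> \<xi>) * K \<xi>)"
      by (rule Bochner_Integration.integrable_bound[OF K]) (auto simp: norm_mult)
    then have j: "integrable (N \<Otimes>\<^sub>M N) (\<lambda>(\<xi>, \<eta>). (cis (x \<bullet> \<xi>) * K \<xi>) * cnj (cis (x \<bullet> \<eta>) * K \<eta>))"
      using NN.integrable_mult_prod[of "\<lambda>\<xi>. cis (x \<bullet> \<xi>) * K \<xi>" "\<lambda>\<eta>. cnj (cis (x \<bullet> \<eta>) * K \<eta>)"]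
        integrable_cnj by blast
    have "of_real ((norm (?F x))\<^sup>2) = ?F x * cnj (?F x)"
      by (rule complex_norm_square)
    also have "\<dots> = (\<integral>\<xi>. (\<integral>\<eta>. (cis (x \<bullet> \<xi>) * K \<xi>) * cnj (cis (x \<bullet> \<eta>) * K \<eta>) \<partial>N) \<partial>N)"
      by (simp only: integral_mult_right_zero integral_mult_left_zero Bochner_Integration.integral_cnj)
    also have "\<dots> = (\<integral>(\<xi>, \<eta>). (cis (x \<bullet> \<xi>) * K \<xi>) * cnj (cis (x \<bullet> \<eta>) * K \<eta>) \<partial>(N \<Otimes>\<^sub>M N))"
      using NN.integral_fst'[OF j] by simp
    also have "\<dots> = (\<integral>(\<xi>, \<eta>). cis (x \<bullet> (\<xi> - \<eta>)) * (K \<xi> * cnj (K \<eta>)) \<partial>(N \<Otimes>\<^sub>M N))"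
    proof -
      have "cis (x \<bullet> (\<xi> - \<eta>)) = cis (x \<bullet> \<xi>) * cnj (cis (x \<bullet> \<eta>))" for \<xi> \<eta>
        by (simp add: inner_diff_right cis_cnj cis_mult)
      then show ?thesis by (simp add: mult_ac)
    qed
    finally show ?thesis .
  qed
  have pF: "(\<integral>y. ?f (x, y) \<partial>(N \<Otimes>\<^sub>M N)) = of_real (p x * (norm (?F x))\<^sup>2)" for x
    unfolding of_real_mult F
    by (simp only: split_beta split_beta' mult.assoc fst_conv snd_conv integral_mult_right_zero)
  have G: "(\<integral>x. ?f (x, y) \<partial>lborel) = ?G y" for y
    by (cases y) simp
  have int1: "integrable lborel (\<lambda>x. complex_of_real (p x * (norm (?F x))\<^sup>2))"
    using L.integrable_fst'[OF f] unfolding pF .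
  have int: "integrable lborel (\<lambda>x. p x * (norm (?F x))\<^sup>2)"
    using integrable_Re[OF int1] by (simp del: of_real_mult)
  have f': "integrable (lborel \<Otimes>\<^sub>M (N \<Otimes>\<^sub>M N)) (\<lambda>(x, y). ?f (x, y))"
    using f by (simp only: case_prod_eta)
  have intG: "integrable (N \<Otimes>\<^sub>M N) ?G"
    using L.integrable_snd[OF f'] unfolding G .
  have "(\<integral>y. ?G y \<partial>(N \<Otimes>\<^sub>M N)) = (\<integral>x. complex_of_real (p x * (norm (?F x))\<^sup>2) \<partial>lborel)"
    using L.Fubini_integral[OF f'] unfolding G pF .
  then have eq: "complex_of_real (\<integral>x. p x * (norm (?F x))\<^sup>2 \<partial>lborel) = (\<integral>y. ?G y \<partial>(N \<Otimes>\<^sub>M N))"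
    by (simp del: of_real_mult)
  let ?K2 = "\<lambda>\<xi>. ennreal ((norm (K \<xi>))\<^sup>2)"
  let ?q = "\<lambda>\<xi> \<eta>. ennreal (q (\<xi> - \<eta>))"
  let ?I = "\<integral>\<^sup>+\<xi>. (\<integral>\<^sup>+\<eta>. ?q \<xi> \<eta> * ?K2 \<xi> \<partial>N) \<partial>N"
  \<comment> \<open>Integrating in \<eta> first leaves \<open>?K2 \<xi>\<close> as a constant
    factor, and the remaining integral of \<open>q\<close> is at most \<open>S\<close>.\<close>
  have I: "?I \<le> S * (\<integral>\<^sup>+\<xi>. ?K2 \<xi> \<partial>N)"
  proof -
    have "?I \<le> (\<integral>\<^sup>+\<xi>. S * ?K2 \<xi> \<partial>N)"
      by (intro nn_integral_mono) (auto simp: nn_integral_multc intro!: mult_right_mono S)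
    then show ?thesis by (simp add: nn_integral_cmult)
  qed
  have "(\<integral>\<^sup>+x. ennreal (p x * (norm (?F x))\<^sup>2) \<partial>lborel) = ennreal (\<integral>x. p x * (norm (?F x))\<^sup>2 \<partial>lborel)"
    using int p by (intro nn_integral_eq_integral) auto
  also have "\<dots> \<le> ennreal (norm (\<integral>y. ?G y \<partial>(N \<Otimes>\<^sub>M N)))"
    unfolding eq[symmetric] by (intro ennreal_leI) simp
  also have "\<dots> \<le> (\<integral>\<^sup>+y. ennreal (norm (?G y)) \<partial>(N \<Otimes>\<^sub>M N))"
    by (rule integral_norm_bound_ennreal[OF intG])
  also have "\<dots> = (\<integral>\<^sup>+\<xi>. (\<integral>\<^sup>+\<eta>. ennreal (norm (?G (\<xi>, \<eta>))) \<partial>N) \<partial>N)"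
    using borel_measurable_integrable[OF intG] by (intro N.nn_integral_fst[symmetric]) measurable
  \<comment> \<open>The inequality ab <= (a^2 + b^2)/2 separates the two copies of
    \<open>K\<close>.\<close>
  also have "\<dots> \<le> (\<integral>\<^sup>+\<xi>. (\<integral>\<^sup>+\<eta>. ennreal (1/2) * (?q \<xi> \<eta> * ?K2 \<xi> + ?q \<xi> \<eta> * ?K2 \<eta>) \<partial>N) \<partial>N)"
  proof (intro nn_integral_mono)
    fix \<xi> \<eta>
    let ?a = "norm (K \<xi>)" and ?b = "norm (K \<eta>)"
    have "?a * ?b \<le> (?a\<^sup>2 + ?b\<^sup>2) / 2" using sum_squares_bound[of ?a ?b] by simp
    then have "norm (\<integral>x. of_real (p x) * cis (x \<bullet> (\<xi> - \<eta>)) \<partial>lborel) * (?a * ?b) \<le> q (\<xi> - \<eta>) * ((?a\<^sup>2 + ?b\<^sup>2) / 2)"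
      by (intro mult_mono le_q q0) simp_all
    then have "norm (?G (\<xi>, \<eta>)) \<le> 1/2 * (q (\<xi> - \<eta>) * ?a\<^sup>2 + q (\<xi> - \<eta>) * ?b\<^sup>2)"
      by (simp add: norm_mult distrib_left)
    then have "ennreal (norm (?G (\<xi>, \<eta>))) \<le> ennreal (1/2 * (q (\<xi> - \<eta>) * ?a\<^sup>2 + q (\<xi> - \<eta>) * ?b\<^sup>2))"
      by (rule ennreal_leI)
    also have "\<dots> = ennreal (1/2) * (?q \<xi> \<eta> * ?K2 \<xi> + ?q \<xi> \<eta> * ?K2 \<eta>)"
      using q0[of "\<xi> - \<eta>"] by (simp only: ennreal_mult'' ennreal_plus ennreal_mult zero_le_power2 mult_nonneg_nonneg
        add_nonneg_nonneg)
    finally show "ennreal (norm (?G (\<xi>, \<eta>))) \<le> \<dots>" .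
  qed
  also have "\<dots> = ennreal (1/2) * (?I + (\<integral>\<^sup>+\<xi>. (\<integral>\<^sup>+\<eta>. ?q \<xi> \<eta> * ?K2 \<eta> \<partial>N) \<partial>N))"
    by (simp add: nn_integral_cmult nn_integral_add del: ennreal_half)
  also have "(\<integral>\<^sup>+\<xi>. (\<integral>\<^sup>+\<eta>. ?q \<xi> \<eta> * ?K2 \<eta> \<partial>N) \<partial>N) = (\<integral>\<^sup>+\<eta>. (\<integral>\<^sup>+\<xi>. ?q \<xi> \<eta> * ?K2 \<eta> \<partial>N) \<partial>N)"
    by (rule NN.Fubini'[symmetric]) measurable
  \<comment> \<open>Evenness of \<open>q\<close> makes the second half equal to the first after
    renaming the variables, so the two halves average to exactly \<open>?I\<close>.\<close>
  also have "\<dots> = ?I"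
    using q_sym by (intro nn_integral_cong) (metis minus_diff_eq)
  also have "ennreal (1/2) * (?I + ?I) = ?I"
  proof -
    have "ennreal (1/2) * 2 = 1" using ennreal_mult[of "1/2" 2] by simp
    then show ?thesis by (simp only: mult_2[symmetric] mult.assoc[symmetric] mult_1_left)
  qed
  also note I
  finally show ?thesis .
qed

text \<open>The transform of a Gaussian of width \<open>r\<close> is again a Gaussian, so Schur's
  bound becomes the Gaussian mass of \<open>N\<close> at scale 1/r. It is applied to Lebesgue
  measure with r = 1, in the space variable, and to \<mu> with r of size \<Lambda>, in the variable
  dual to time.\<close>

lemma gaussian_L2_transform_le:
  fixes N :: "'a::euclidean_space measure" and K :: "'a \<Rightarrow> complex" and x0 :: 'a
  assumes N: "sigma_finite_measure N" "sets N = sets borel" and K: "integrable N K" and r: "r > 0"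
    and S: "\<And>\<xi>. (\<integral>\<^sup>+\<eta>. ennreal (exp (- (norm (r *\<^sub>R (\<xi> - \<eta>)))\<^sup>2 / 2)) \<partial>N) \<le> S"
  shows "(\<integral>\<^sup>+x. ennreal (exp (- (norm ((x - x0) /\<^sub>R r))\<^sup>2 / 2) *
      (norm (\<integral>\<xi>. cis (x \<bullet> \<xi>) * K \<xi> \<partial>N))\<^sup>2) \<partial>lborel) \<le>
    ennreal (r ^ DIM('a) * sqrt (2 * pi) ^ DIM('a)) * S * (\<integral>\<^sup>+\<xi>. ennreal ((norm (K \<xi>))\<^sup>2) \<partial>N)"
proof (rule weighted_L2_transform_le[OF N _ _ K])
  let ?c = "r ^ DIM('a) * sqrt (2 * pi) ^ DIM('a)"
  let ?q = "\<lambda>\<zeta>. ?c * exp (- (norm (r *\<^sub>R \<zeta>))\<^sup>2 / 2)"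
  show "integrable lborel (\<lambda>x. exp (- (norm ((x - x0) /\<^sub>R r))\<^sup>2 / 2))"
    using integrable_norm[OF integrable_gaussian_affine_cis[OF r, of x0 0]] by (simp add: norm_mult)
  show "?q \<in> borel_measurable borel" by measurable
  show "?q (- \<zeta>) = ?q \<zeta>" for \<zeta> by simp
  show "norm (\<integral>x. of_real (exp (- (norm ((x - x0) /\<^sub>R r))\<^sup>2 / 2)) * cis (x \<bullet> \<zeta>) \<partial>lborel) \<le> ?q \<zeta>" for \<zeta>
    by (rule eq_refl[OF norm_integral_gaussian_affine_cis[OF r]])
  have [measurable_cong]: "sets N = sets borel" by fact
  have "(\<integral>\<^sup>+\<eta>. ennreal (?q (\<xi> - \<eta>)) \<partial>N) = ennreal ?c * (\<integral>\<^sup>+\<eta>. ennreal (exp (- (norm (r *\<^sub>R (\<xi> - \<eta>)))\<^sup>2 / 2)) \<partial>N)" for \<xi>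
    using r by (subst nn_integral_cmult[symmetric]) (simp_all add: ennreal_mult)
  then show "(\<integral>\<^sup>+\<eta>. ennreal (?q (\<xi> - \<eta>)) \<partial>N) \<le> ennreal ?c * S" for \<xi>
    using S[of \<xi>] by (simp only: mult_left_mono zero_le)
qed simp

section \<open>Localisation in frequency\<close>

lemma
  fixes f :: "'a::euclidean_space \<Rightarrow> 'b::{banach, second_countable_topology}"
  assumes [measurable]: "f \<in> borel_measurable borel"
  shows integrable_lborel_minus: "integrable lborel (\<lambda>x. f (x - a)) \<longleftrightarrow> integrable lborel f"
    and integral_lborel_minus: "(\<integral>x. f (x - a) \<partial>lborel) = (\<integral>x. f x \<partial>lborel)"
  using integrable_lborel_affine[of 1 "\<lambda>x. f (x - a)" a] integral_lborel_affine[of 1 "\<lambda>x. f (x - a)" a]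
  by simp_all

lemma nn_integral_lborel_minus:
  fixes f :: "'a::euclidean_space \<Rightarrow> ennreal"
  assumes [measurable]: "f \<in> borel_measurable borel"
  shows "(\<integral>\<^sup>+x. f (x - a) \<partial>lborel) = (\<integral>\<^sup>+x. f x \<partial>lborel)"
  using nn_integral_lborel_affine[of 1 "\<lambda>x. f (x - a)" a] by simp

lemma ball_in_sets_borel [measurable]: "ball c r \<in> sets borel" for c :: "'a::metric_space"
  by (intro borel_open open_ball)

lemma integrable_indicator_ball:
  "integrable lborel (\<lambda>y. indicator (ball c r) y :: complex)" for c :: "'a::euclidean_space"
proof -
  have "integrable lborel (\<lambda>y. complex_of_real (indicator (ball c r) y))"
    by (intro integrable_of_real integrable_real_indicator emeasure_lborel_ball_finite) simp
  then show ?thesis by (simp add: of_real_indicator)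
qed

text \<open>The phase \<open>x \<bullet> y\<close> stays in [-1, 1], so the integrand cannot cancel:
  its real part is at least cos 1 on the ball, a positive number because 1 < pi/2.\<close>

lemma norm_transform_indicator_ball_ge:
  fixes x :: "'a::euclidean_space"
  assumes x: "norm x \<le> 1"
  shows "measure lborel (ball (0::'a) 1) * cos 1 \<le>
    norm (\<integral>y. cis (x \<bullet> y) * indicator (ball 0 1) y \<partial>lborel)"
proof -
  have ib: "integrable lborel (\<lambda>y. indicator (ball (0::'a) 1) y :: complex)"
    using integrable_indicator_ball[of 0 1] .
  then have i: "integrable lborel (\<lambda>y. cis (x \<bullet> y) * indicator (ball (0::'a) 1) y)"
  proof (rule Bochner_Integration.integrable_bound)
    show "(\<lambda>y. cis (x \<bullet> y) * indicator (ball (0::'a) 1) y) \<in> borel_measurable lborel" by measurable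
  qed (simp add: norm_mult)
  have "measure lborel (ball (0::'a) 1) * cos 1 = (\<integral>y. indicator (ball (0::'a) 1) y * cos 1 \<partial>lborel)"
    by simp
  also have "\<dots> \<le> (\<integral>y. Re (cis (x \<bullet> y) * indicator (ball 0 1) y) \<partial>lborel)"
  proof (intro integral_mono integrable_Re i)
    show "integrable lborel (\<lambda>y. indicator (ball (0::'a) 1) y * cos (1::real))"
      by (intro integrable_mult_left integrable_real_indicator emeasure_lborel_ball_finite) simp
    fix y :: 'a
    have "cos 1 \<le> cos (x \<bullet> y)" if "norm y < 1"
    proof -
      have "\<bar>x \<bullet> y\<bar> \<le> norm x * norm y" by (rule Cauchy_Schwarz_ineq2)
      also have "\<dots> \<le> 1" using x that mult_mono[of "norm x" 1 "norm y" 1] by simp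
      finally have "cos 1 \<le> cos \<bar>x \<bullet> y\<bar>"
        using pi_gt3 by (intro cos_monotone_0_pi_le) auto
      then show ?thesis by simp
    qed
    then show "indicator (ball (0::'a) 1) y * cos 1 \<le> Re (cis (x \<bullet> y) * indicator (ball 0 1) y)"
      by (auto simp: indicator_def)
  qed
  also have "\<dots> = Re (\<integral>y. cis (x \<bullet> y) * indicator (ball 0 1) y \<partial>lborel)"
    by (rule integral_bounded_linear[OF bounded_linear_Re i])
  also have "\<dots> \<le> norm (\<integral>y. cis (x \<bullet> y) * indicator (ball 0 1) y \<partial>lborel)"
    by (rule complex_Re_le_cmod)
  finally show ?thesis .
qed

text \<open>The convolution of \<open>F\<close> with the indicator of the unit ball, kept in
  convolution form so that its transform factors; \<open>ball_mass_eq\<close> reads it as the mass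
  of \<open>F\<close> on \<open>ball \<zeta> 1\<close>.\<close>

definition ball_mass :: "('a::euclidean_space \<Rightarrow> complex) \<Rightarrow> 'a \<Rightarrow> complex" where
  "ball_mass F \<zeta> = (\<integral>\<xi>. F \<xi> * indicator (ball 0 1) (\<zeta> - \<xi>) \<partial>lborel)"

text \<open>Convolution turns the transform into a product. Both parts rest on joint integrability
  in \<xi> and \<zeta>, which holds since by translation invariance the integral in \<zeta> of the
  indicator does not depend on \<xi>.\<close>

lemma
  fixes F :: "'a::euclidean_space \<Rightarrow> complex"
  assumes F: "integrable lborel F"
  shows integrable_ball_mass: "integrable lborel (ball_mass F)"
    and transform_ball_mass: "(\<integral>\<zeta>. cis (x \<bullet> \<zeta>) * ball_mass F \<zeta> \<partial>lborel) =
      (\<integral>\<xi>. cis (x \<bullet> \<xi>) * F \<xi> \<partial>lborel) * (\<integral>y. cis (x \<bullet> y) * indicator (ball 0 1) y \<partial>lborel)"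
proof -
  have [measurable]: "F \<in> borel_measurable borel" using F by (auto dest: borel_measurable_integrable)
  let ?b = "\<lambda>y::'a. indicator (ball 0 1) y :: complex"
  have ib: "integrable lborel ?b"
    using integrable_indicator_ball[of 0 1] .
  have int: "integrable (lborel \<Otimes>\<^sub>M lborel) (\<lambda>(\<xi>, \<zeta>). F \<xi> * ?b (\<zeta> - \<xi>))"
  proof (rule lborel_pair.Fubini_integrable)
    have m: "(\<lambda>y. norm (?b y)) \<in> borel_measurable borel" by measurable
    have e: "(\<integral>\<zeta>. norm (F \<xi> * ?b (\<zeta> - \<xi>)) \<partial>lborel) = norm (F \<xi>) * (\<integral>y. norm (?b y) \<partial>lborel)" for \<xi>
      unfolding norm_mult integral_mult_right_zero integral_lborel_minus[OF m] ..
    have "integrable lborel (\<lambda>\<xi>. norm (F \<xi>) * (\<integral>y. norm (?b y) \<partial>lborel))"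
      using F by simp
    then show "integrable lborel (\<lambda>\<xi>. \<integral>\<zeta>. norm (case (\<xi>, \<zeta>) of (\<xi>, \<zeta>) \<Rightarrow> F \<xi> * ?b (\<zeta> - \<xi>)) \<partial>lborel)"
      unfolding prod.case e .
    show "AE \<xi> in lborel. integrable lborel (\<lambda>\<zeta>. case (\<xi>, \<zeta>) of (\<xi>, \<zeta>) \<Rightarrow> F \<xi> * ?b (\<zeta> - \<xi>))"
      using ib by (simp add: integrable_lborel_minus[of ?b])
  qed measurable
  have cint: "integrable (lborel \<Otimes>\<^sub>M lborel) (\<lambda>(\<xi>, \<zeta>). cis (x \<bullet> \<zeta>) * (F \<xi> * ?b (\<zeta> - \<xi>)))"
    by (rule Bochner_Integration.integrable_bound[OF int]) (auto simp: norm_mult split_beta)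
  show "integrable lborel (ball_mass F)"
    using lborel_pair.integrable_snd[OF int] unfolding ball_mass_def[abs_def] .
  have "(\<integral>\<zeta>. cis (x \<bullet> \<zeta>) * ball_mass F \<zeta> \<partial>lborel) =
      (\<integral>\<zeta>. (\<integral>\<xi>. cis (x \<bullet> \<zeta>) * (F \<xi> * ?b (\<zeta> - \<xi>)) \<partial>lborel) \<partial>lborel)"
    unfolding ball_mass_def by simp
  also have "\<dots> = (\<integral>\<xi>. (\<integral>\<zeta>. cis (x \<bullet> \<zeta>) * (F \<xi> * ?b (\<zeta> - \<xi>)) \<partial>lborel) \<partial>lborel)"
    by (rule lborel_pair.Fubini_integral[OF cint])
  also have "\<dots> = (\<integral>\<xi>. cis (x \<bullet> \<xi>) * F \<xi> * (\<integral>y. cis (x \<bullet> y) * ?b y \<partial>lborel) \<partial>lborel)"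
  proof (intro Bochner_Integration.integral_cong refl)
    fix \<xi>
    have "(\<integral>\<zeta>. cis (x \<bullet> \<zeta>) * (F \<xi> * ?b (\<zeta> - \<xi>)) \<partial>lborel) =
        (\<integral>\<zeta>. (cis (x \<bullet> \<xi>) * F \<xi>) * (cis (x \<bullet> (\<zeta> - \<xi>)) * ?b (\<zeta> - \<xi>)) \<partial>lborel)"
    proof (intro Bochner_Integration.integral_cong refl)
      fix \<zeta>
      have "cis (x \<bullet> \<zeta>) = cis (x \<bullet> \<xi>) * cis (x \<bullet> (\<zeta> - \<xi>))"
        by (simp add: cis_mult inner_diff_right)
      then show "cis (x \<bullet> \<zeta>) * (F \<xi> * ?b (\<zeta> - \<xi>)) = (cis (x \<bullet> \<xi>) * F \<xi>) * (cis (x \<bullet> (\<zeta> - \<xi>)) * ?b (\<zeta> - \<xi>))"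
        by (simp only: mult_ac)
    qed
    also have "\<dots> = cis (x \<bullet> \<xi>) * F \<xi> * (\<integral>\<zeta>. cis (x \<bullet> (\<zeta> - \<xi>)) * ?b (\<zeta> - \<xi>) \<partial>lborel)"
      by (rule integral_mult_right_zero)
    also have "(\<integral>\<zeta>. cis (x \<bullet> (\<zeta> - \<xi>)) * ?b (\<zeta> - \<xi>) \<partial>lborel) = (\<integral>y. cis (x \<bullet> y) * ?b y \<partial>lborel)"
      by (rule integral_lborel_minus[of "\<lambda>y. cis (x \<bullet> y) * ?b y"]) measurable
    finally show "(\<integral>\<zeta>. cis (x \<bullet> \<zeta>) * (F \<xi> * ?b (\<zeta> - \<xi>)) \<partial>lborel) =
      cis (x \<bullet> \<xi>) * F \<xi> * (\<integral>y. cis (x \<bullet> y) * ?b y \<partial>lborel)" .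
  qed
  also have "\<dots> = (\<integral>\<xi>. cis (x \<bullet> \<xi>) * F \<xi> \<partial>lborel) * (\<integral>y. cis (x \<bullet> y) * ?b y \<partial>lborel)"
    by (rule integral_mult_left_zero)
  finally show "(\<integral>\<zeta>. cis (x \<bullet> \<zeta>) * ball_mass F \<zeta> \<partial>lborel) =
      (\<integral>\<xi>. cis (x \<bullet> \<xi>) * F \<xi> \<partial>lborel) * (\<integral>y. cis (x \<bullet> y) * indicator (ball 0 1) y \<partial>lborel)" .
qed

text \<open>The total mass is the transform of the Gaussian at frequency 0; it is the Schur bound
  for Lebesgue measure at r = 1.\<close>

lemma nn_integral_gaussian:
  "(\<integral>\<^sup>+\<eta>. ennreal (exp (- (norm (\<xi> - \<eta>))\<^sup>2 / 2)) \<partial>lborel) =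
    ennreal (sqrt (2 * pi) ^ DIM('a))" for \<xi> :: "'a::euclidean_space"
proof -
  have i: "integrable lborel (\<lambda>x::'a. exp (- (norm x)\<^sup>2 / 2))"
    using integrable_norm[OF integrable_gaussian_cis[of 0]] by (simp add: norm_mult)
  have "complex_of_real (\<integral>x. exp (- (norm (x::'a))\<^sup>2 / 2) \<partial>lborel) = complex_of_real (sqrt (2 * pi) ^ DIM('a))"
    using integral_gaussian_cis[of "0::'a"]
    by (simp only: integral_complex_of_real[symmetric]) simp
  then have "(\<integral>x. exp (- (norm (x::'a))\<^sup>2 / 2) \<partial>lborel) = sqrt (2 * pi) ^ DIM('a)"
    by (simp only: of_real_eq_iff)
  moreover have "(\<integral>\<^sup>+\<eta>. ennreal (exp (- (norm (\<xi> - \<eta>))\<^sup>2 / 2)) \<partial>lborel) =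
      (\<integral>\<^sup>+\<eta>. ennreal (exp (- (norm (\<eta>::'a))\<^sup>2 / 2)) \<partial>lborel)"
    using nn_integral_lborel_minus[of "\<lambda>\<eta>::'a. ennreal (exp (- (norm \<eta>)\<^sup>2 / 2))" \<xi>]
    by (simp add: norm_minus_commute[of \<xi>])
  ultimately show ?thesis
    using nn_integral_eq_integral[OF i] by simp
qed

text \<open>The Gaussian form of Schur's test does the work of Plancherel's theorem: on the unit
  ball the Gaussian is at least exp (-1/2) and the transform of the indicator at least
  \<open>V\<close> in modulus, so the weighted integral of the transform of
  \<open>ball_mass F\<close> dominates the integral over the ball.\<close>

lemma L2_ball_transform_le:
  "\<exists>C>0. \<forall>F::'a::euclidean_space \<Rightarrow> complex. integrable lborel F \<longrightarrow>
    (\<integral>\<^sup>+x. ennreal ((norm (\<integral>\<xi>. cis (x \<bullet> \<xi>) * F \<xi> \<partial>lborel))\<^sup>2) * indicator (ball 0 1) x \<partial>lborel) \<le>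
    ennreal C * (\<integral>\<^sup>+\<zeta>. ennreal ((norm (ball_mass F \<zeta>))\<^sup>2) \<partial>lborel)"
proof -
  define V where "V = measure lborel (ball (0::'a) 1) * cos 1"
  define D where "D = exp (1/2) / V\<^sup>2"
  \<comment> \<open>\<open>D\<close> makes up for the two losses on the ball. One power of sqrt (2 *
    pi) comes from the transform of the Gaussian, the other is its mass.\<close>
  define C where "C = D * (sqrt (2 * pi) ^ DIM('a) * sqrt (2 * pi) ^ DIM('a))"
  have "0 < measure lborel (ball (0::'a) 1)"
    by (simp add: content_ball_pos)
  moreover have "0 < cos (1::real)"
    using pi_gt3 by (intro cos_gt_zero) auto
  ultimately have V: "V > 0" by (simp add: V_def)
  then have D: "D > 0" by (simp add: D_def)
  have "(\<integral>\<^sup>+x. ennreal ((norm (\<integral>\<xi>. cis (x \<bullet> \<xi>) * F \<xi> \<partial>lborel))\<^sup>2) * indicator (ball 0 1) x \<partial>lborel) \<le>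
    ennreal C * (\<integral>\<^sup>+\<zeta>. ennreal ((norm (ball_mass F \<zeta>))\<^sup>2) \<partial>lborel)"
    if F: "integrable lborel F" for F :: "'a \<Rightarrow> complex"
  proof -
    have [measurable]: "F \<in> borel_measurable borel" "ball_mass F \<in> borel_measurable borel"
      using F integrable_ball_mass[OF F] by (auto dest: borel_measurable_integrable)
    let ?T = "\<lambda>x. \<integral>\<zeta>. cis (x \<bullet> \<zeta>) * ball_mass F \<zeta> \<partial>lborel"
    have "(\<integral>\<^sup>+x. ennreal ((norm (\<integral>\<xi>. cis (x \<bullet> \<xi>) * F \<xi> \<partial>lborel))\<^sup>2) * indicator (ball 0 1) x \<partial>lborel) \<le>
      (\<integral>\<^sup>+x. ennreal D * ennreal (exp (- (norm ((x - 0) /\<^sub>R 1))\<^sup>2 / 2) * (norm (?T x))\<^sup>2) \<partial>lborel)"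
    proof (intro nn_integral_mono)
      fix x :: 'a
      let ?a = "norm (\<integral>\<xi>. cis (x \<bullet> \<xi>) * F \<xi> \<partial>lborel)"
      let ?e = "exp (- (norm x)\<^sup>2 / 2)"
      have "?a\<^sup>2 \<le> D * (?e * (norm (?T x))\<^sup>2)" if "norm x < 1"
      proof -
        have "(norm x)\<^sup>2 \<le> 1" using that by (simp add: power_le_one)
        then have "1 \<le> exp (1/2) * ?e" unfolding exp_add[symmetric] by simp
        moreover have "?a * V \<le> norm (?T x)"
          unfolding transform_ball_mass[OF F] norm_mult V_def using that
          by (intro mult_left_mono norm_transform_indicator_ball_ge) auto
        then have "(?a * V)\<^sup>2 \<le> (norm (?T x))\<^sup>2"
          using V by (intro power_mono) auto
        ultimately have "1 * (?a * V)\<^sup>2 \<le> (exp (1/2) * ?e) * (norm (?T x))\<^sup>2"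
          by (intro mult_mono) auto
        then show ?thesis using V by (simp add: D_def field_simps power_mult_distrib)
      qed
      then show "ennreal (?a\<^sup>2) * indicator (ball 0 1) x \<le>
          ennreal D * ennreal (exp (- (norm ((x - 0) /\<^sub>R 1))\<^sup>2 / 2) * (norm (?T x))\<^sup>2)"
        using D by (auto simp: indicator_def ennreal_mult[symmetric] intro!: ennreal_leI)
    qed
    also have "\<dots> = ennreal D * (\<integral>\<^sup>+x. ennreal (exp (- (norm ((x - 0) /\<^sub>R 1))\<^sup>2 / 2) * (norm (?T x))\<^sup>2) \<partial>lborel)"
      by (rule nn_integral_cmult) measurable
    also have "\<dots> \<le> ennreal D * (ennreal (1 ^ DIM('a) * sqrt (2 * pi) ^ DIM('a)) * ennreal (sqrt (2 * pi) ^ DIM('a)) *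
        (\<integral>\<^sup>+\<zeta>. ennreal ((norm (ball_mass F \<zeta>))\<^sup>2) \<partial>lborel))"
    proof -
      have "(\<integral>\<^sup>+\<eta>. ennreal (exp (- (norm (1 *\<^sub>R (\<xi> - \<eta>)))\<^sup>2 / 2)) \<partial>lborel) \<le> ennreal (sqrt (2 * pi) ^ DIM('a))" for \<xi> :: 'a
        using nn_integral_gaussian[of \<xi>] by simp
      then show ?thesis
        by (intro mult_left_mono gaussian_L2_transform_le sigma_finite_lborel integrable_ball_mass F) simp_all
    qed
    also have "ennreal D * (ennreal (1 ^ DIM('a) * sqrt (2 * pi) ^ DIM('a)) * ennreal (sqrt (2 * pi) ^ DIM('a)) *
        (\<integral>\<^sup>+\<zeta>. ennreal ((norm (ball_mass F \<zeta>))\<^sup>2) \<partial>lborel)) = ennreal C * (\<integral>\<^sup>+\<zeta>. ennreal ((norm (ball_mass F \<zeta>))\<^sup>2) \<partial>lborel)"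
      using D by (simp add: C_def ennreal_mult mult.assoc)
    finally show ?thesis .
  qed
  moreover have "C > 0" using D by (simp add: C_def)
  ultimately show ?thesis by blast
qed

section \<open>The radial change of variables and the measure\<close>

text \<open>The left-hand side is averaged over the dilations by \<open>\<theta> powr (1 / \<gamma>)\<close> with
  \<open>1 \<le> \<theta> \<le> 1 + 1 / norm \<zeta>\<close>: they move \<open>ball \<zeta> 1\<close> inside \<open>ball \<zeta> 3\<close> and turn \<open>norm \<xi> powr \<gamma>\<close> into
  a linear function of \<open>\<theta>\<close>, so no polar coordinates are needed.\<close>

lemma nn_integral_radial_ball_le:
  fixes \<zeta> :: "'a::euclidean_space" and H :: "real \<Rightarrow> ennreal" and \<gamma> :: real
  assumes \<gamma>: "\<gamma> > 1" and k: "norm \<zeta> \<ge> 6" and H[measurable]: "H \<in> borel_measurable borel"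
  shows "(\<integral>\<^sup>+\<xi>. H (norm \<xi> powr \<gamma>) * indicator (ball \<zeta> 1) \<xi> \<partial>lborel) \<le>
    ennreal (2 ^ DIM('a) * 2 powr \<gamma> * measure lborel (ball (0::'a) 3) * norm \<zeta> powr (1 - \<gamma>)) *
    (\<integral>\<^sup>+\<tau>. H \<tau> * indicator {(norm \<zeta> - 1) powr \<gamma>..(norm \<zeta> + 1) powr \<gamma>} \<tau> \<partial>lborel)"
proof -
  define k where "k = norm \<zeta>"
  \<comment> \<open>With the cutoff to the interval inside the integrand, the later integral in
    \<theta> may run over the whole line and still yields only the integral over the
    interval.\<close>
  define HJ where "HJ \<tau> = H \<tau> * indicator {(k - 1) powr \<gamma>..(k + 1) powr \<gamma>} \<tau>" for \<tau>
  define L where "L = (\<integral>\<^sup>+\<xi>. H (norm \<xi> powr \<gamma>) * indicator (ball \<zeta> 1) \<xi> \<partial>lborel)"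
  define I where "I = (\<integral>\<^sup>+\<tau>. HJ \<tau> \<partial>lborel)"
  define R where "R \<theta> = (\<integral>\<^sup>+\<eta>. HJ (\<theta> * norm (\<eta>::'a) powr \<gamma>) * indicator (ball \<zeta> 3) \<eta> \<partial>lborel)" for \<theta>
  have [measurable]: "HJ \<in> borel_measurable borel" unfolding HJ_def by measurable
  have k6: "k \<ge> 6" using k by (simp add: k_def)
  have L_eq: "L = (\<integral>\<^sup>+\<xi>. HJ (norm \<xi> powr \<gamma>) * indicator (ball \<zeta> 1) \<xi> \<partial>lborel)"
    unfolding L_def
  proof (intro nn_integral_cong)
    fix \<xi> :: 'a
    have "(k - 1) powr \<gamma> \<le> norm \<xi> powr \<gamma> \<and> norm \<xi> powr \<gamma> \<le> (k + 1) powr \<gamma>" if "dist \<zeta> \<xi> < 1"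
    proof -
      have "\<bar>norm \<zeta> - norm \<xi>\<bar> < 1"
        using that norm_triangle_ineq3[of \<zeta> \<xi>] by (simp add: dist_norm)
      then show ?thesis using k6 \<gamma> unfolding k_def
        by (intro conjI powr_mono2) auto
    qed
    then show "H (norm \<xi> powr \<gamma>) * indicator (ball \<zeta> 1) \<xi> = HJ (norm \<xi> powr \<gamma>) * indicator (ball \<zeta> 1) \<xi>"
      by (auto simp: HJ_def indicator_def)
  qed
  have L_le: "L \<le> ennreal (2 ^ DIM('a)) * R \<theta>" if \<theta>: "1 \<le> \<theta>" "\<theta> \<le> 1 + 1 / k" for \<theta>
  proof -
    \<comment> \<open>The dilation factor with \<open>l powr \<gamma> = \<theta>\<close>. Since
      1/\<gamma> < 1 it is at most \<theta>, hence l - 1 <= 1/k.\<close>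
    define l where "l = \<theta> powr (1 / \<gamma>)"
    have l1: "1 \<le> l" using \<theta> \<gamma> by (simp add: l_def ge_one_powr_ge_zero)
    have "l \<le> \<theta> powr 1" unfolding l_def using \<theta> \<gamma> by (intro powr_mono) auto
    then have lk: "l \<le> 1 + 1 / k" using \<theta> by simp
    have l2: "l \<le> 2" using lk order_trans[of "1 + 1 / k" "1 + 1" ] k6 by (simp add: order_trans[OF lk])
    have l\<gamma>: "l powr \<gamma> = \<theta>" using \<theta> \<gamma> by (simp add: l_def powr_powr)
    have "L = ennreal (\<bar>l\<bar> ^ DIM('a)) *
        (\<integral>\<^sup>+\<eta>. HJ (norm (0 + l *\<^sub>R \<eta>) powr \<gamma>) * indicator (ball \<zeta> 1) (0 + l *\<^sub>R \<eta>) \<partial>lborel)"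
      unfolding L_eq using l1 by (intro nn_integral_lborel_affine) auto
    also have "\<dots> \<le> ennreal (2 ^ DIM('a)) * R \<theta>"
      unfolding R_def
    proof (rule mult_mono[OF _ nn_integral_mono])
      show "ennreal (\<bar>l\<bar> ^ DIM('a)) \<le> ennreal (2 ^ DIM('a))"
        using l1 l2 by (intro ennreal_leI power_mono) auto
      fix \<eta> :: 'a
      have "norm (0 + l *\<^sub>R \<eta>) powr \<gamma> = \<theta> * norm \<eta> powr \<gamma>"
        using l1 by (simp add: powr_mult l\<gamma>)
      moreover have "dist \<zeta> \<eta> < 3" if d: "dist \<zeta> (l *\<^sub>R \<eta>) < 1"
      proof -
        have "norm (l *\<^sub>R \<eta>) \<le> k + 1"
          using d norm_triangle_ineq2[of "l *\<^sub>R \<eta>" \<zeta>] by (simp add: k_def dist_norm norm_minus_commute)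
        moreover have "1 * norm \<eta> \<le> l * norm \<eta>" using l1 by (intro mult_right_mono) auto
        ultimately have n: "norm \<eta> \<le> k + 1" using l1 by simp
        \<comment> \<open>A point of norm at most k + 1 is moved by at most (k + 1)/k <= 2; with the
          radius 1 of the original ball this gives the radius 3.\<close>
        have "dist (l *\<^sub>R \<eta>) \<eta> = (l - 1) * norm \<eta>"
          using l1 by (metis abs_of_nonneg diff_ge_0_iff_ge dist_norm norm_scaleR scaleR_left_diff_distrib scaleR_one)
        also have "\<dots> \<le> (1 / k) * (k + 1)"
          using l1 lk n k6 by (intro mult_mono) auto
        also have "\<dots> \<le> 2" using k6 by (simp add: field_simps)
        finally show ?thesis using d dist_triangle[of \<zeta> \<eta> "l *\<^sub>R \<eta>"] by simp
      qed
      ultimately show "HJ (norm (0 + l *\<^sub>R \<eta>) powr \<gamma>) * indicator (ball \<zeta> 1) (0 + l *\<^sub>R \<eta>) \<le>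
          HJ (\<theta> * norm \<eta> powr \<gamma>) * indicator (ball \<zeta> 3) \<eta>"
        by (auto simp: indicator_def)
    qed simp_all
    finally show ?thesis .
  qed
  \<comment> \<open>For fixed \<eta> the substitution \<tau> = \<theta> |\<eta>|^\<gamma> is linear
    with slope |\<eta>|^\<gamma>.\<close>
  have inner: "(\<integral>\<^sup>+\<theta>. HJ (\<theta> * norm \<eta> powr \<gamma>) \<partial>lborel) \<le> ennreal ((k / 2) powr (- \<gamma>)) * I"
    if "dist \<zeta> \<eta> < 3" for \<eta>
  proof -
    have "norm \<zeta> - norm \<eta> < 3"
      using that norm_triangle_ineq2[of \<zeta> \<eta>] by (simp add: dist_norm)
    \<comment> \<open>From |\<eta>| > k - 3: the threshold 6 is what makes k - 3 at least
      k/2.\<close>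
    then have h: "k / 2 \<le> norm \<eta>" using k6 by (simp add: k_def)
    let ?c = "norm \<eta> powr \<gamma>"
    have c: "?c > 0" using h k6 by auto
    have "I = ennreal \<bar>?c\<bar> * (\<integral>\<^sup>+\<theta>. HJ (0 + ?c * \<theta>) \<partial>lborel)"
      unfolding I_def using c by (intro nn_integral_real_affine) auto
    then have "ennreal (norm \<eta> powr (- \<gamma>)) * I =
        (ennreal (norm \<eta> powr (- \<gamma>)) * ennreal ?c) * (\<integral>\<^sup>+\<theta>. HJ (\<theta> * ?c) \<partial>lborel)"
      by (simp add: mult.assoc mult.commute[of ?c])
    also have "ennreal (norm \<eta> powr (- \<gamma>)) * ennreal ?c = 1"
      using c by (simp add: ennreal_mult[symmetric] powr_minus)
    finally have "(\<integral>\<^sup>+\<theta>. HJ (\<theta> * ?c) \<partial>lborel) = ennreal (norm \<eta> powr (- \<gamma>)) * I" by simp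
    also have "\<dots> \<le> ennreal ((k / 2) powr (- \<gamma>)) * I"
      using h k6 \<gamma> by (intro mult_right_mono ennreal_leI powr_mono2') auto
    finally show ?thesis .
  qed
  have V: "emeasure lborel (ball \<zeta> 3) = ennreal (measure lborel (ball (0::'a) 3))"
    by (simp add: emeasure_ball content_ball)
  \<comment> \<open>The averaging: the bound for \<open>L\<close> holds for all \<theta> in an
    interval of length 1/k. Multiplying back by k then gives k (k/2)^(-\<gamma>) = 2^\<gamma>
    k^(1-\<gamma>).\<close>
  have "L * ennreal (1 / k) = (\<integral>\<^sup>+\<theta>. L * indicator {1..1 + 1 / k} \<theta> \<partial>lborel)"
    using k6 by (subst nn_integral_cmult_indicator) simp_all
  also have "\<dots> \<le> (\<integral>\<^sup>+\<theta>. ennreal (2 ^ DIM('a)) * R \<theta> \<partial>lborel)"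
    using L_le by (intro nn_integral_mono) (auto simp: indicator_def)
  also have "\<dots> = ennreal (2 ^ DIM('a)) * (\<integral>\<^sup>+\<theta>. R \<theta> \<partial>lborel)"
    unfolding R_def by (rule nn_integral_cmult) measurable
  also have "(\<integral>\<^sup>+\<theta>. R \<theta> \<partial>lborel) =
      (\<integral>\<^sup>+\<eta>. (\<integral>\<^sup>+\<theta>. HJ (\<theta> * norm (\<eta>::'a) powr \<gamma>) * indicator (ball \<zeta> 3) \<eta> \<partial>lborel) \<partial>lborel)"
    unfolding R_def by (rule pair_sigma_finite.Fubini') (auto intro!: pair_sigma_finite.intro sigma_finite_lborel)
  also have "\<dots> \<le> (\<integral>\<^sup>+\<eta>. (ennreal ((k / 2) powr (- \<gamma>)) * I) * indicator (ball \<zeta> 3) (\<eta>::'a) \<partial>lborel)"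
    using inner by (intro nn_integral_mono) (auto simp: indicator_def)
  also have "\<dots> = ennreal ((k / 2) powr (- \<gamma>)) * I * ennreal (measure lborel (ball (0::'a) 3))"
    unfolding V[symmetric] by (rule nn_integral_cmult_indicator) simp
  finally have le: "L * ennreal (1 / k) \<le> ennreal (2 ^ DIM('a)) * (ennreal ((k / 2) powr (- \<gamma>)) * I * ennreal (measure lborel (ball (0::'a) 3)))"
    by (simp add: mult_left_mono)
  have "ennreal k * ennreal (1 / k) = 1"
    using k6 by (simp add: ennreal_mult[symmetric])
  then have "L = ennreal k * (L * ennreal (1 / k))"
    by (simp add: mult.left_commute)
  also have "\<dots> \<le> ennreal k * (ennreal (2 ^ DIM('a)) * (ennreal ((k / 2) powr (- \<gamma>)) * I * ennreal (measure lborel (ball (0::'a) 3))))"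
    by (intro mult_left_mono le) simp
  also have "\<dots> = ennreal (k * 2 ^ DIM('a) * (k / 2) powr (- \<gamma>) * measure lborel (ball (0::'a) 3)) * I"
    using k6 by (simp add: ennreal_mult mult_ac)
  also have "k * 2 ^ DIM('a) * (k / 2) powr (- \<gamma>) * measure lborel (ball (0::'a) 3) =
      2 ^ DIM('a) * 2 powr \<gamma> * measure lborel (ball (0::'a) 3) * k powr (1 - \<gamma>)"
    using k6 by (simp add: powr_divide powr_minus powr_diff field_simps)
  finally show ?thesis unfolding L_def I_def HJ_def k_def .
qed

text \<open>The line is split according to n <= r |t - t'| < n + 1. The n-th piece lies in an
  interval of radius (n + 1)/r, whose mass grows at most linearly in n because \<alpha> <= 1, while
  the Gaussian decays exponentially in n.\<close>

lemma gaussian_mass_le: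
  fixes M :: "real measure" and \<alpha> C0 :: real
  assumes \<alpha>: "0 < \<alpha>" "\<alpha> \<le> 1" and sets: "sets M = sets borel"
    and M: "\<And>t \<rho>. \<rho> > 0 \<Longrightarrow> emeasure M {t - \<rho><..<t + \<rho>} \<le> ennreal (C0 * \<rho> powr \<alpha>)"
  shows "\<exists>C\<ge>0. \<forall>t. \<forall>r>0. (\<integral>\<^sup>+t'. ennreal (exp (- (norm (r *\<^sub>R (t - t')))\<^sup>2 / 2)) \<partial>M) \<le>
    ennreal (C * r powr (- \<alpha>))"
proof -
  have [measurable_cong]: "sets M = sets borel" by fact
  \<comment> \<open>\<open>C0\<close> may be negative, in which case \<open>ennreal\<close> reads
    the bound as 0; \<open>D\<close> preserves the bound and is safe in real arithmetic.\<close>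
  define D where "D = max C0 0"
  have M': "emeasure M {t - \<rho><..<t + \<rho>} \<le> ennreal (D * \<rho> powr \<alpha>)" if "\<rho> > 0" for t \<rho>
    using M[OF that] by (rule order_trans) (intro ennreal_leI mult_right_mono, auto simp: D_def)
  \<comment> \<open>\<open>exp (1/2) * exp (-1) ^ n\<close> bounds the Gaussian on the n-th piece
    and \<open>Suc n\<close> the growth of the mass; the sum is a differentiated geometric
    series.\<close>
  define a where "a n = exp (1/2::real) * (of_nat (Suc n) * exp (-1) ^ n)" for n :: nat
  have a: "summable a"
  proof -
    have "(\<lambda>n. of_nat (Suc n) * exp (- 1 :: real) ^ n) sums (1 / (1 - exp (- 1))\<^sup>2)"
      by (rule geometric_deriv_sums) simp
    from summable_mult[OF sums_summable[OF this]] show ?thesis unfolding a_def .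
  qed
  have a0: "0 \<le> a n" for n by (simp add: a_def)
  have "(\<integral>\<^sup>+t'. ennreal (exp (- (norm (r *\<^sub>R (t - t')))\<^sup>2 / 2)) \<partial>M) \<le> ennreal (D * (\<Sum>n. a n) * r powr (- \<alpha>))"
    if r: "r > 0" for t r
  proof -
    let ?e = "\<lambda>n::nat. ennreal (exp (1/2) * exp (-1) ^ n)"
    let ?A = "\<lambda>n::nat. {t - Suc n / r<..<t + Suc n / r}"
    have "(\<integral>\<^sup>+t'. ennreal (exp (- (norm (r *\<^sub>R (t - t')))\<^sup>2 / 2)) \<partial>M) \<le> (\<integral>\<^sup>+t'. (\<Sum>n. ?e n * indicator (?A n) t') \<partial>M)"
    proof (intro nn_integral_mono)
      fix t'
      define x where "x = r * \<bar>t - t'\<bar>"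
      define n where "n = nat \<lfloor>x\<rfloor>"
      have x0: "0 \<le> x" using r by (simp add: x_def)
      have n: "real n \<le> x" "x < Suc n" using x0 unfolding n_def by linarith+
      have "\<bar>t - t'\<bar> < Suc n / r" using n(2) r by (simp add: x_def field_simps)
      then have "t' \<in> ?A n" by (auto simp: abs_less_iff)
      \<comment> \<open>Completing the square replaces the Gaussian by an exponential, which
        compares with a geometric sequence.\<close>
      have "0 \<le> (x - 1)\<^sup>2" by simp
      then have "- x\<^sup>2 / 2 \<le> 1/2 - x" by (simp add: power2_eq_square algebra_simps)
      then have "exp (- x\<^sup>2 / 2) \<le> exp (1/2 - real n)" using n(1) by simp
      also have "\<dots> = exp (1/2) * exp (-1) ^ n"
        unfolding exp_of_nat_mult[symmetric] exp_add[symmetric] by simp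
      finally have "ennreal (exp (- (norm (r *\<^sub>R (t - t')))\<^sup>2 / 2)) \<le> ?e n"
        using r by (intro ennreal_leI) (simp add: x_def abs_mult)
      also have "\<dots> = ?e n * indicator (?A n) t'" using \<open>t' \<in> ?A n\<close> by simp
      also have "\<dots> \<le> (\<Sum>n. ?e n * indicator (?A n) t')"
      proof -
        define f where "f n = ?e n * indicator (?A n) t'" for n
        have "sum f {n} \<le> suminf f" by (intro sum_le_suminf summableI) auto
        then have "f n \<le> suminf f" by simp
        then show ?thesis by (simp only: f_def[abs_def])
      qed
      finally show "ennreal (exp (- (norm (r *\<^sub>R (t - t')))\<^sup>2 / 2)) \<le> (\<Sum>n. ?e n * indicator (?A n) t')" .
    qed
    also have "\<dots> = (\<Sum>n. \<integral>\<^sup>+t'. ?e n * indicator (?A n) t' \<partial>M)"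
      by (rule nn_integral_suminf) measurable
    also have "\<dots> \<le> (\<Sum>n. ennreal (D * a n * r powr (- \<alpha>)))"
    proof (intro suminf_le summableI)
      fix n
      have "(\<integral>\<^sup>+t'. ?e n * indicator (?A n) t' \<partial>M) = ?e n * emeasure M (?A n)"
        by (rule nn_integral_cmult_indicator) (simp add: sets)
      also have "\<dots> \<le> ?e n * ennreal (D * (Suc n / r) powr \<alpha>)"
        using r by (intro mult_left_mono M') auto
      also have "\<dots> = ennreal (exp (1/2) * exp (-1) ^ n * (D * (Suc n / r) powr \<alpha>))"
        by (simp add: ennreal_mult D_def)
      also have "\<dots> \<le> ennreal (D * a n * r powr (- \<alpha>))"
      proof (intro ennreal_leI)
        have "real (Suc n) powr \<alpha> \<le> real (Suc n) powr 1" using \<alpha> by (intro powr_mono) auto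
        then have "(Suc n / r) powr \<alpha> \<le> Suc n * r powr (- \<alpha>)"
          using r by (simp add: powr_divide powr_minus field_simps)
        then have "exp (1/2) * exp (-1) ^ n * (D * (Suc n / r) powr \<alpha>) \<le>
            exp (1/2) * exp (-1) ^ n * (D * (Suc n * r powr (- \<alpha>)))"
          by (intro mult_left_mono) (auto simp: D_def)
        then show "exp (1/2) * exp (-1) ^ n * (D * (Suc n / r) powr \<alpha>) \<le> D * a n * r powr (- \<alpha>)"
          by (simp only: a_def mult_ac)
      qed
      finally show "(\<integral>\<^sup>+t'. ?e n * indicator (?A n) t' \<partial>M) \<le> ennreal (D * a n * r powr (- \<alpha>))" .
    qed
    also have "\<dots> = ennreal (\<Sum>n. D * a n * r powr (- \<alpha>))"
      using a a0 by (intro suminf_ennreal2 summable_mult2 summable_mult) (auto simp: D_def)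
    also have "(\<Sum>n. D * a n * r powr (- \<alpha>)) = D * (\<Sum>n. a n) * r powr (- \<alpha>)"
      using a by (simp add: suminf_mult suminf_mult2[symmetric] summable_mult)
    finally show ?thesis .
  qed
  moreover have "0 \<le> D * (\<Sum>n. a n)"
    using a a0 by (intro mult_nonneg_nonneg suminf_nonneg) (auto simp: D_def)
  ultimately show ?thesis by blast
qed

text \<open>Each point off the support has an open null neighbourhood, but these are uncountably
  many; the Lindelof property reduces their union to a countable one, which is null. The rest of the
  line lies in (-2, 2), whose mass is bounded.\<close>

lemma finite_measure_of_support:
  fixes M :: "real measure" and b :: real
  assumes sets: "sets M = sets borel" and supp: "measure_support M \<subseteq> {0..1}"
    and M: "emeasure M {-2<..<2} \<le> ennreal b"
  shows "finite_measure M"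
proof (rule finite_measureI)
  define F where "F = {U::real set. open U \<and> emeasure M U = 0}"
  obtain F' where F': "F' \<subseteq> F" "countable F'" "\<Union>F' = \<Union>F"
    by (rule Lindelof[of F]) (auto simp: F_def)
  have "(\<Union>U\<in>F'. U) \<in> null_sets M"
    using F' sets by (intro null_sets_UN') (auto simp: F_def null_sets_def)
  then have null: "\<Union>F \<in> null_sets M" using F' by simp
  have "UNIV \<subseteq> {-2<..<2} \<union> \<Union>F"
  proof
    fix x :: real
    show "x \<in> {-2<..<2} \<union> \<Union>F"
    proof (cases "x \<in> {0..1}")
      case False
      then have "x \<notin> measure_support M" using supp by auto
      then show ?thesis by (auto simp: measure_support_def F_def)
    qed auto
  qed
  then have "space M = {-2<..<2} \<union> \<Union>F" using sets_eq_imp_space_eq[OF sets] by auto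
  then have "emeasure M (space M) \<le> emeasure M {-2<..<2} + emeasure M (\<Union>F)"
    using null sets emeasure_subadditive[of "{-2<..<2}" M "\<Union>F"] by auto
  also have "\<dots> \<le> ennreal b" using M null by (simp add: null_sets_def)
  finally show "emeasure M (space M) \<noteq> \<infinity>" by (auto simp: top_unique)
qed

section \<open>The local estimate\<close>

lemma powr_diff_le:
  fixes a b \<gamma> :: real
  assumes "0 < a" "a \<le> b" "\<gamma> > 1"
  shows "b powr \<gamma> - a powr \<gamma> \<le> \<gamma> * b powr (\<gamma> - 1) * (b - a)"
proof (cases "a = b")
  case False
  then have "a < b" using assms by simp
  moreover have "((\<lambda>x. x powr \<gamma>) has_real_derivative \<gamma> * x powr (\<gamma> - 1)) (at x)" if "a \<le> x" for x
    using that assms by (intro has_real_derivative_powr) simp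
  ultimately obtain z where z: "a < z" "z < b" "b powr \<gamma> - a powr \<gamma> = (b - a) * (\<gamma> * z powr (\<gamma> - 1))"
    using MVT2[of a b "\<lambda>x. x powr \<gamma>" "\<lambda>x. \<gamma> * x powr (\<gamma> - 1)"] by blast
  have "z powr (\<gamma> - 1) \<le> b powr (\<gamma> - 1)" using z assms by (intro powr_mono2) auto
  then have "(b - a) * (\<gamma> * z powr (\<gamma> - 1)) \<le> (b - a) * (\<gamma> * b powr (\<gamma> - 1))"
    using assms by (intro mult_left_mono) auto
  then show ?thesis unfolding z(3) by (simp add: mult_ac)
qed simp

lemma ennreal_mult_assoc3:
  assumes "0 \<le> a" "0 \<le> b" "0 \<le> c"
  shows "ennreal a * (ennreal b * ennreal c * X) = ennreal (a * (b * c)) * X"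
  using assms by (simp add: ennreal_mult mult.assoc)

text \<open>The adjoint bound. The change of variables contributes k^(1-\<gamma>), the Gaussian of
  width r of size k^(\<gamma>-1) contributes r, and the mass of \<mu> at scale 1/r contributes
  r^(-\<alpha>). The exponents of k add up to (1-\<gamma>) + (\<gamma>-1)(1-\<alpha>) =
  \<alpha>(1-\<gamma>).\<close>

lemma nn_integral_ball_measure_transform_le:
  fixes M :: "real measure" and \<alpha> \<gamma> C1 :: real
  assumes \<gamma>: "\<gamma> > 1" and fin: "finite_measure M" and sets: "sets M = sets borel" and C1: "0 \<le> C1"
    and mass: "\<And>t r. r > 0 \<Longrightarrow> (\<integral>\<^sup>+t'. ennreal (exp (- (norm (r *\<^sub>R (t - t')))\<^sup>2 / 2)) \<partial>M) \<le>
      ennreal (C1 * r powr (- \<alpha>))"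
  shows "\<exists>A\<ge>0. \<forall>\<zeta>::'a::euclidean_space. norm \<zeta> \<ge> 6 \<longrightarrow> (\<forall>h. integrable M h \<longrightarrow>
    (\<integral>\<^sup>+\<xi>. ennreal ((norm (\<integral>t. cis (t * norm \<xi> powr \<gamma>) * h t \<partial>M))\<^sup>2) * indicator (ball \<zeta> 1) \<xi> \<partial>lborel) \<le>
    ennreal (A * norm \<zeta> powr (\<alpha> * (1 - \<gamma>))) * (\<integral>\<^sup>+t. ennreal ((norm (h t))\<^sup>2) \<partial>M))"
proof -
  interpret finite_measure M by fact
  have [measurable_cong]: "sets M = sets borel" by fact
  define B where "B = 2 ^ DIM('a) * 2 powr \<gamma> * measure lborel (ball (0::'a) 3)"
  \<comment> \<open>Chosen so that r = L k^(\<gamma>-1) equals \<gamma> (2k)^(\<gamma>-1), an upper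
    bound for the derivative of x^\<gamma> on [k - 1, k + 1]; the interval \<open>?J\<close> then
    lies within distance r of k^\<gamma>, where the Gaussian is at least exp (-1/2).\<close>
  define L where "L = \<gamma> * 2 powr (\<gamma> - 1)"
  define A where "A = B * (exp (1/2) * (L powr (1 - \<alpha>) * sqrt (2 * pi) * C1))"
  have B: "0 \<le> B" by (simp add: B_def)
  have L: "0 < L" using \<gamma> by (simp add: L_def)
  have A: "0 \<le> A" using B C1 by (simp add: A_def)
  have "(\<integral>\<^sup>+\<xi>. ennreal ((norm (\<integral>t. cis (t * norm \<xi> powr \<gamma>) * h t \<partial>M))\<^sup>2) * indicator (ball \<zeta> 1) \<xi> \<partial>lborel) \<le>
    ennreal (A * norm \<zeta> powr (\<alpha> * (1 - \<gamma>))) * (\<integral>\<^sup>+t. ennreal ((norm (h t))\<^sup>2) \<partial>M)"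
    if \<zeta>: "norm \<zeta> \<ge> 6" and h: "integrable M h" for \<zeta> :: 'a and h :: "real \<Rightarrow> complex"
  proof -
    define k where "k = norm \<zeta>"
    define r where "r = L * k powr (\<gamma> - 1)"
    let ?X = "\<integral>\<^sup>+t. ennreal ((norm (h t))\<^sup>2) \<partial>M"
    let ?H = "\<lambda>\<tau>. ennreal ((norm (\<integral>t. cis (t * \<tau>) * h t \<partial>M))\<^sup>2)"
    let ?J = "{(k - 1) powr \<gamma>..(k + 1) powr \<gamma>}"
    let ?g = "\<lambda>\<tau>. exp (- (norm ((\<tau> - k powr \<gamma>) /\<^sub>R r))\<^sup>2 / 2)"
    have k: "k \<ge> 6" using \<zeta> by (simp add: k_def)
    have r: "r > 0" using L k by (simp add: r_def)
    have [measurable]: "h \<in> borel_measurable M" using h by auto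
    have Hm[measurable]: "?H \<in> borel_measurable borel" by measurable
    have g: "1 \<le> exp (1/2) * ?g \<tau>" if \<tau>: "\<tau> \<in> ?J" for \<tau>
    proof -
      have r2: "r = \<gamma> * (2 * k) powr (\<gamma> - 1)" using k by (simp add: r_def L_def powr_mult)
      have le: "\<gamma> * x powr (\<gamma> - 1) \<le> r" if "0 \<le> x" "x \<le> 2 * k" for x
        unfolding r2 using that \<gamma> by (intro mult_left_mono powr_mono2) auto
      have "\<tau> - k powr \<gamma> \<le> r"
        using powr_diff_le[of k "k + 1" \<gamma>] le[of "k + 1"] \<tau> k \<gamma> by simp
      moreover have "k powr \<gamma> - \<tau> \<le> r"
        using powr_diff_le[of "k - 1" k \<gamma>] le[of k] \<tau> k \<gamma> by simp
      ultimately have "\<bar>(\<tau> - k powr \<gamma>) / r\<bar> \<le> 1"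
        using r by (simp add: abs_le_iff field_simps)
      then have "((\<tau> - k powr \<gamma>) / r)\<^sup>2 \<le> 1" by (simp add: abs_square_le_1)
      moreover have "(norm ((\<tau> - k powr \<gamma>) /\<^sub>R r))\<^sup>2 = ((\<tau> - k powr \<gamma>) / r)\<^sup>2"
        by (simp add: divide_inverse mult.commute)
      ultimately show ?thesis unfolding exp_add[symmetric] by simp
    qed
    have "(\<integral>\<^sup>+\<tau>. ?H \<tau> * indicator ?J \<tau> \<partial>lborel) \<le>
      (\<integral>\<^sup>+\<tau>. ennreal (exp (1/2)) * ennreal (?g \<tau> * (norm (\<integral>t. cis (\<tau> \<bullet> t) * h t \<partial>M))\<^sup>2) \<partial>lborel)"
    proof (intro nn_integral_mono)
      fix \<tau>
      let ?n = "(norm (\<integral>t. cis (\<tau> \<bullet> t) * h t \<partial>M))\<^sup>2"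
      have "?n \<le> exp (1/2) * ?g \<tau> * ?n" if "\<tau> \<in> ?J"
        using mult_right_mono[OF g[OF that], of ?n] by simp
      then have "ennreal ?n * indicator ?J \<tau> \<le> ennreal (exp (1/2) * (?g \<tau> * ?n))"
        by (auto simp: indicator_def mult.assoc intro!: ennreal_leI)
      then show "?H \<tau> * indicator ?J \<tau> \<le> ennreal (exp (1/2)) * ennreal (?g \<tau> * ?n)"
        by (simp add: ennreal_mult mult.commute)
    qed
    also have "\<dots> = ennreal (exp (1/2)) * (\<integral>\<^sup>+\<tau>. ennreal (?g \<tau> * (norm (\<integral>t. cis (\<tau> \<bullet> t) * h t \<partial>M))\<^sup>2) \<partial>lborel)"
      by (rule nn_integral_cmult) measurable
    also have "\<dots> \<le> ennreal (exp (1/2)) * (ennreal (r ^ DIM(real) * sqrt (2 * pi) ^ DIM(real)) * ennreal (C1 * r powr (- \<alpha>)) * ?X)"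
      by (intro mult_left_mono gaussian_L2_transform_le sigma_finite_measure_axioms sets h r mass) simp
    also have "\<dots> = ennreal (exp (1/2) * ((r ^ DIM(real) * sqrt (2 * pi) ^ DIM(real)) * (C1 * r powr (- \<alpha>)))) * ?X"
      using r C1 by (intro ennreal_mult_assoc3) auto
    also have "exp (1/2) * ((r ^ DIM(real) * sqrt (2 * pi) ^ DIM(real)) * (C1 * r powr (- \<alpha>))) =
        exp (1/2) * ((r * r powr (- \<alpha>)) * sqrt (2 * pi) * C1)"
      by (simp only: DIM_real power_one_right mult_ac)
    also have "r * r powr (- \<alpha>) = r powr (1 - \<alpha>)"
      using r powr_mult_base[of r "- \<alpha>"] by simp
    finally have J: "(\<integral>\<^sup>+\<tau>. ?H \<tau> * indicator ?J \<tau> \<partial>lborel) \<le>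
        ennreal (exp (1/2) * (r powr (1 - \<alpha>) * sqrt (2 * pi) * C1)) * ?X" .
    have "(\<integral>\<^sup>+\<xi>. ?H (norm \<xi> powr \<gamma>) * indicator (ball \<zeta> 1) \<xi> \<partial>lborel) \<le>
      ennreal (B * k powr (1 - \<gamma>)) * (\<integral>\<^sup>+\<tau>. ?H \<tau> * indicator ?J \<tau> \<partial>lborel)"
      unfolding B_def k_def by (rule nn_integral_radial_ball_le[OF \<gamma> \<zeta> Hm])
    also have "\<dots> \<le> ennreal (B * k powr (1 - \<gamma>)) * (ennreal (exp (1/2) * (r powr (1 - \<alpha>) * sqrt (2 * pi) * C1)) * ?X)"
      by (intro mult_left_mono J) simp
    also have "\<dots> = ennreal (B * k powr (1 - \<gamma>) * (exp (1/2) * (r powr (1 - \<alpha>) * sqrt (2 * pi) * C1))) * ?X"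
      using B C1 by (simp only: ennreal_mult mult_nonneg_nonneg powr_ge_zero exp_ge_zero real_sqrt_ge_zero
        pi_ge_zero zero_le_numeral mult.assoc)
    also have "B * k powr (1 - \<gamma>) * (exp (1/2) * (r powr (1 - \<alpha>) * sqrt (2 * pi) * C1)) =
      A * (k powr (1 - \<gamma>) * k powr ((\<gamma> - 1) * (1 - \<alpha>)))"
    proof -
      have "r powr (1 - \<alpha>) = L powr (1 - \<alpha>) * k powr ((\<gamma> - 1) * (1 - \<alpha>))"
        using L k by (simp add: r_def powr_mult powr_powr)
      then show ?thesis by (simp only: A_def mult_ac)
    qed
    also have "k powr (1 - \<gamma>) * k powr ((\<gamma> - 1) * (1 - \<alpha>)) = k powr (\<alpha> * (1 - \<gamma>))"
      by (simp add: powr_add[symmetric] algebra_simps)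
    finally show ?thesis by (simp add: k_def)
  qed
  with A show ?thesis by blast
qed

text \<open>The function \<Phi> of \<open>t\<close> is paired with its own conjugate. Fubini moves
  the kernel onto the conjugate, Cauchy-Schwarz on \<open>S\<close> brings in the adjoint bound, and
  one factor of the squared norm of \<Phi> is cancelled.\<close>

lemma L2_duality:
  fixes M :: "'b measure" and N :: "'c measure" and e :: "'b \<Rightarrow> 'c \<Rightarrow> complex" and F :: "'c \<Rightarrow> complex"
  assumes M: "finite_measure M" and N: "sigma_finite_measure N"
    and e[measurable]: "case_prod e \<in> borel_measurable (M \<Otimes>\<^sub>M N)" and e1: "\<And>t \<xi>. norm (e t \<xi>) \<le> 1"
    and F: "integrable N F" and S[measurable]: "S \<in> sets N"
    and dual: "\<And>h. integrable M h \<Longrightarrow>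
      (\<integral>\<^sup>+\<xi>. ennreal ((norm (\<integral>t. e t \<xi> * h t \<partial>M))\<^sup>2) * indicator S \<xi> \<partial>N) \<le>
      ennreal B * (\<integral>\<^sup>+t. ennreal ((norm (h t))\<^sup>2) \<partial>M)"
  shows "(\<integral>\<^sup>+t. ennreal ((norm (\<integral>\<xi>. e t \<xi> * (F \<xi> * indicator S \<xi>) \<partial>N))\<^sup>2) \<partial>M) \<le>
    ennreal B * (\<integral>\<^sup>+\<xi>. ennreal ((norm (F \<xi>))\<^sup>2) * indicator S \<xi> \<partial>N)"
proof -
  interpret M: finite_measure M by fact
  interpret N: sigma_finite_measure N by fact
  interpret P: pair_sigma_finite M N ..
  have [measurable]: "F \<in> borel_measurable N" using F by auto
  define \<Phi> where "\<Phi> t = (\<integral>\<xi>. e t \<xi> * (F \<xi> * indicator S \<xi>) \<partial>N)" for t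
  have [measurable]: "\<Phi> \<in> borel_measurable M" unfolding \<Phi>_def by measurable
  have FS: "integrable N (\<lambda>\<xi>. F \<xi> * indicator S \<xi>)"
  proof (rule Bochner_Integration.integrable_bound[OF F])
    show "AE \<xi> in N. norm (F \<xi> * indicator S \<xi>) \<le> norm (F \<xi>)"
      by (auto simp: indicator_def)
  qed measurable
  define b where "b = (\<integral>\<xi>. norm (F \<xi> * indicator S \<xi>) \<partial>N)"
  have \<Phi>b: "norm (\<Phi> t) \<le> b" for t
  proof (cases "integrable N (\<lambda>\<xi>. e t \<xi> * (F \<xi> * indicator S \<xi>))")
    case True
    have "norm (\<Phi> t) \<le> (\<integral>\<xi>. norm (e t \<xi> * (F \<xi> * indicator S \<xi>)) \<partial>N)"
      unfolding \<Phi>_def by (rule integral_norm_bound)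
    also have "\<dots> \<le> b"
      unfolding b_def
    proof (intro integral_mono)
      fix \<xi>
      have "norm (e t \<xi>) * norm (F \<xi> * indicator S \<xi>) \<le> 1 * norm (F \<xi> * indicator S \<xi>)"
        by (intro mult_right_mono e1) simp
      then show "norm (e t \<xi> * (F \<xi> * indicator S \<xi>)) \<le> norm (F \<xi> * indicator S \<xi>)"
        by (simp add: norm_mult)
    qed (use True FS in \<open>auto intro: integrable_norm\<close>)
    finally show ?thesis .
  next
    \<comment> \<open>A nonintegrable integrand has integral 0 by convention, so the bound holds for
      every \<open>t\<close>.\<close>
    case False
    then show ?thesis by (simp add: \<Phi>_def b_def not_integrable_integral_eq)
  qed
  define h where "h t = cnj (\<Phi> t)" for t
  have hm[measurable]: "h \<in> borel_measurable M" unfolding h_def[abs_def] by measurable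
  have h: "integrable M h"
    by (rule M.integrable_const_bound[of _ b]) (use \<Phi>b in \<open>auto simp: h_def\<close>)
  have int: "integrable (M \<Otimes>\<^sub>M N) (\<lambda>(t, \<xi>). h t * (e t \<xi> * (F \<xi> * indicator S \<xi>)))"
  proof (rule Bochner_Integration.integrable_bound[OF P.integrable_mult_prod[OF h FS]])
    show "(\<lambda>(t, \<xi>). h t * (e t \<xi> * (F \<xi> * indicator S \<xi>))) \<in> borel_measurable (M \<Otimes>\<^sub>M N)"
      unfolding h_def by measurable
    show "AE p in M \<Otimes>\<^sub>M N. norm (case p of (t, \<xi>) \<Rightarrow> h t * (e t \<xi> * (F \<xi> * indicator S \<xi>))) \<le>
        norm (case p of (t, \<xi>) \<Rightarrow> h t * (F \<xi> * indicator S \<xi>))"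
    proof (rule AE_I2, clarify)
      fix t \<xi>
      have "norm (e t \<xi>) * norm (h t * (F \<xi> * indicator S \<xi>)) \<le> 1 * norm (h t * (F \<xi> * indicator S \<xi>))"
        by (intro mult_right_mono e1) simp
      then show "norm (h t * (e t \<xi> * (F \<xi> * indicator S \<xi>))) \<le> norm (h t * (F \<xi> * indicator S \<xi>))"
        by (simp only: norm_mult mult_ac mult_1_left)
    qed
  qed
  have \<Phi>2: "integrable M (\<lambda>t. (norm (\<Phi> t))\<^sup>2)"
    by (rule M.integrable_const_bound[of _ "b\<^sup>2"]) (use \<Phi>b in \<open>auto intro!: power_mono\<close>)
  let ?X = "\<integral>\<^sup>+t. ennreal ((norm (\<Phi> t))\<^sup>2) \<partial>M"
  let ?Y = "\<integral>\<^sup>+\<xi>. ennreal ((norm (F \<xi>))\<^sup>2) * indicator S \<xi> \<partial>N"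
  let ?T = "\<lambda>\<xi>. \<integral>t. e t \<xi> * h t \<partial>M"
  have X: "?X = ennreal (\<integral>t. (norm (\<Phi> t))\<^sup>2 \<partial>M)"
    using \<Phi>2 by (intro nn_integral_eq_integral) auto
  have "complex_of_real (\<integral>t. (norm (\<Phi> t))\<^sup>2 \<partial>M) = (\<integral>t. h t * \<Phi> t \<partial>M)"
    unfolding h_def integral_complex_of_real[symmetric] complex_norm_square by (simp only: mult.commute)
  also have "\<dots> = (\<integral>t. (\<integral>\<xi>. h t * (e t \<xi> * (F \<xi> * indicator S \<xi>)) \<partial>N) \<partial>M)"
    unfolding \<Phi>_def by simp
  also have "\<dots> = (\<integral>\<xi>. (\<integral>t. h t * (e t \<xi> * (F \<xi> * indicator S \<xi>)) \<partial>M) \<partial>N)"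
    by (rule P.Fubini_integral[OF int, symmetric])
  also have "\<dots> = (\<integral>\<xi>. (F \<xi> * indicator S \<xi>) * ?T \<xi> \<partial>N)"
    by (intro Bochner_Integration.integral_cong refl)
       (simp only: integral_mult_right_zero[symmetric] mult_ac)
  finally have eq: "complex_of_real (\<integral>t. (norm (\<Phi> t))\<^sup>2 \<partial>M) = (\<integral>\<xi>. (F \<xi> * indicator S \<xi>) * ?T \<xi> \<partial>N)" .
  have intN: "integrable N (\<lambda>\<xi>. (F \<xi> * indicator S \<xi>) * ?T \<xi>)"
  proof -
    have "(\<lambda>\<xi>. \<integral>t. h t * (e t \<xi> * (F \<xi> * indicator S \<xi>)) \<partial>M) = (\<lambda>\<xi>. (F \<xi> * indicator S \<xi>) * ?T \<xi>)"
      by (intro ext) (simp only: integral_mult_right_zero[symmetric] mult_ac)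
    with P.integrable_snd[OF int] show ?thesis by simp
  qed
  have Tm[measurable]: "?T \<in> borel_measurable N" by measurable
  have "?X = ennreal (norm (complex_of_real (\<integral>t. (norm (\<Phi> t))\<^sup>2 \<partial>M)))"
    unfolding X by simp
  also have "\<dots> \<le> (\<integral>\<^sup>+\<xi>. ennreal (norm ((F \<xi> * indicator S \<xi>) * ?T \<xi>)) \<partial>N)"
    unfolding eq by (rule integral_norm_bound_ennreal[OF intN])
  also have "\<dots> = (\<integral>\<^sup>+\<xi>. (ennreal (norm (F \<xi>)) * indicator S \<xi>) * (ennreal (norm (?T \<xi>)) * indicator S \<xi>) \<partial>N)"
    by (intro nn_integral_cong) (auto simp: indicator_def norm_mult ennreal_mult)
  finally have "?X\<^sup>2 \<le> (\<integral>\<^sup>+\<xi>. (ennreal (norm (F \<xi>)) * indicator S \<xi>) * (ennreal (norm (?T \<xi>)) * indicator S \<xi>) \<partial>N)\<^sup>2"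
    by (intro power_mono) simp_all
  also have "\<dots> \<le> (\<integral>\<^sup>+\<xi>. (ennreal (norm (F \<xi>)) * indicator S \<xi>)\<^sup>2 \<partial>N) * (\<integral>\<^sup>+\<xi>. (ennreal (norm (?T \<xi>)) * indicator S \<xi>)\<^sup>2 \<partial>N)"
    by (rule Cauchy_Schwarz_nn_integral) measurable
  also have "(\<integral>\<^sup>+\<xi>. (ennreal (norm (F \<xi>)) * indicator S \<xi>)\<^sup>2 \<partial>N) = ?Y"
    by (intro nn_integral_cong) (auto simp: indicator_def ennreal_power)
  also have "(\<integral>\<^sup>+\<xi>. (ennreal (norm (?T \<xi>)) * indicator S \<xi>)\<^sup>2 \<partial>N) =
      (\<integral>\<^sup>+\<xi>. ennreal ((norm (?T \<xi>))\<^sup>2) * indicator S \<xi> \<partial>N)"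
    by (intro nn_integral_cong) (auto simp: indicator_def ennreal_power)
  also have "?Y * \<dots> \<le> ?Y * (ennreal B * ?X)"
    using dual[OF h] by (intro mult_left_mono) (simp_all add: h_def)
  finally have "?X * ?X \<le> ?X * (ennreal B * ?Y)"
    by (simp add: power2_eq_square mult_ac)
  \<comment> \<open>The cancellation needs a finite value; it is available because \<Phi> is bounded
    by the integral of |F| over \<open>S\<close> and \<open>M\<close> is finite.\<close>
  moreover have "?X \<noteq> \<infinity>" unfolding X by simp
  ultimately have "?X \<le> ennreal B * ?Y"
    by (cases "?X = 0") (auto simp: ennreal_mult_le_mult_iff)
  then show ?thesis by (simp add: \<Phi>_def)
qed

lemma indicator_ball_diff:
  "indicator (ball (0::'a::real_normed_vector) r) (\<zeta> - \<xi>) = (indicator (ball \<zeta> r) \<xi> :: 'b::zero_neq_one)"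
  by (auto simp: indicator_def dist_norm norm_minus_commute[of \<xi>])

lemma ball_mass_eq: "ball_mass F \<zeta> = (\<integral>\<xi>. F \<xi> * indicator (ball \<zeta> 1) \<xi> \<partial>lborel)"
  unfolding ball_mass_def indicator_ball_diff ..

text \<open>Cauchy-Schwarz against the indicator of the ball. With \<open>F'\<close> the modulated
  density the bound is uniform in time, which suffices at low frequencies.\<close>

lemma norm_ball_mass_square_le:
  fixes F :: "'a::euclidean_space \<Rightarrow> complex"
  assumes F: "integrable lborel F" and le: "\<And>\<xi>. norm (F' \<xi>) \<le> norm (F \<xi>)"
    and [measurable]: "F' \<in> borel_measurable borel"
  shows "ennreal ((norm (ball_mass F' \<zeta>))\<^sup>2) \<le>
    ennreal (measure lborel (ball (0::'a) 1)) * (\<integral>\<^sup>+\<xi>. ennreal ((norm (F \<xi>))\<^sup>2) * indicator (ball \<zeta> 1) \<xi> \<partial>lborel)"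
proof -
  have [measurable]: "F \<in> borel_measurable borel" using F by auto
  have int: "integrable lborel (\<lambda>\<xi>. F' \<xi> * indicator (ball \<zeta> 1) \<xi>)"
  proof (rule Bochner_Integration.integrable_bound[OF F])
    show "AE \<xi> in lborel. norm (F' \<xi> * indicator (ball \<zeta> 1) \<xi>) \<le> norm (F \<xi>)"
      using le by (auto simp: indicator_def)
  qed measurable
  let ?i = "\<lambda>\<xi>. indicator (ball \<zeta> 1) \<xi> :: ennreal"
  have "ennreal (norm (ball_mass F' \<zeta>)) \<le> (\<integral>\<^sup>+\<xi>. ennreal (norm (F' \<xi> * indicator (ball \<zeta> 1) \<xi>)) \<partial>lborel)"
    unfolding ball_mass_eq by (rule integral_norm_bound_ennreal[OF int])
  also have "\<dots> \<le> (\<integral>\<^sup>+\<xi>. (ennreal (norm (F \<xi>)) * ?i \<xi>) * ?i \<xi> \<partial>lborel)"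
    using le by (intro nn_integral_mono) (auto simp: indicator_def intro: ennreal_leI)
  finally have "(ennreal (norm (ball_mass F' \<zeta>)))\<^sup>2 \<le> (\<integral>\<^sup>+\<xi>. (ennreal (norm (F \<xi>)) * ?i \<xi>) * ?i \<xi> \<partial>lborel)\<^sup>2"
    by (intro power_mono) simp_all
  also have "\<dots> \<le> (\<integral>\<^sup>+\<xi>. (ennreal (norm (F \<xi>)) * ?i \<xi>)\<^sup>2 \<partial>lborel) * (\<integral>\<^sup>+\<xi>. (?i \<xi>)\<^sup>2 \<partial>lborel)"
    by (rule Cauchy_Schwarz_nn_integral) measurable
  also have "(\<integral>\<^sup>+\<xi>. (ennreal (norm (F \<xi>)) * ?i \<xi>)\<^sup>2 \<partial>lborel) =
      (\<integral>\<^sup>+\<xi>. ennreal ((norm (F \<xi>))\<^sup>2) * ?i \<xi> \<partial>lborel)"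
    by (intro nn_integral_cong) (auto simp: indicator_def ennreal_power)
  also have "(\<integral>\<^sup>+\<xi>. (?i \<xi>)\<^sup>2 \<partial>lborel) = (\<integral>\<^sup>+\<xi>. ?i \<xi> \<partial>lborel)"
    by (intro nn_integral_cong) (auto simp: indicator_def)
  also have "(\<integral>\<^sup>+\<xi>. ?i \<xi> \<partial>lborel) = ennreal (measure lborel (ball (0::'a) 1))"
    by (simp add: emeasure_ball content_ball)
  finally show ?thesis by (simp add: ennreal_power mult.commute)
qed

text \<open>For |\<zeta>| >= 6 this is the dual of the adjoint bound, with the power of |\<zeta>|
  rewritten as a Sobolev weight; for smaller \<zeta> the weight is bounded below and the total mass
  of \<open>M\<close> is enough.\<close>

lemma nn_integral_ball_mass_modulated_le:
  fixes M :: "real measure" and \<alpha> \<gamma> C1 :: real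
  assumes \<gamma>: "\<gamma> > 1" and \<alpha>: "\<alpha> > 0" and fin: "finite_measure M" and sets: "sets M = sets borel" and C1: "0 \<le> C1"
    and mass: "\<And>t r. r > 0 \<Longrightarrow> (\<integral>\<^sup>+t'. ennreal (exp (- (norm (r *\<^sub>R (t - t')))\<^sup>2 / 2)) \<partial>M) \<le>
      ennreal (C1 * r powr (- \<alpha>))"
  shows "\<exists>A\<ge>0. \<forall>\<zeta>::'a::euclidean_space. \<forall>F. integrable lborel F \<longrightarrow>
    (\<integral>\<^sup>+t. ennreal ((norm (ball_mass (\<lambda>\<xi>. cis (t * norm \<xi> powr \<gamma>) * F \<xi>) \<zeta>))\<^sup>2) \<partial>M) \<le>
    ennreal (A * (1 + (norm \<zeta>)\<^sup>2) powr (\<alpha> * (1 - \<gamma>) / 2)) *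
      (\<integral>\<^sup>+\<xi>. ennreal ((norm (F \<xi>))\<^sup>2) * indicator (ball \<zeta> 1) \<xi> \<partial>lborel)"
proof -
  interpret M: finite_measure M by fact
  have [measurable_cong]: "sets M = sets borel" by fact
  define s where "s = \<alpha> * (1 - \<gamma>) / 2"
  have s: "s \<le> 0" using \<alpha> \<gamma> by (simp add: s_def mult_nonneg_nonpos)
  obtain A where A: "0 \<le> A" and dual: "\<And>\<zeta>::'a. \<And>h. norm \<zeta> \<ge> 6 \<Longrightarrow> integrable M h \<Longrightarrow>
    (\<integral>\<^sup>+\<xi>. ennreal ((norm (\<integral>t. cis (t * norm \<xi> powr \<gamma>) * h t \<partial>M))\<^sup>2) * indicator (ball \<zeta> 1) \<xi> \<partial>lborel) \<le>
    ennreal (A * norm \<zeta> powr (\<alpha> * (1 - \<gamma>))) * (\<integral>\<^sup>+t. ennreal ((norm (h t))\<^sup>2) \<partial>M)"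
    using nn_integral_ball_measure_transform_le[OF \<gamma> fin sets C1 mass] by blast
  define V where "V = measure lborel (ball (0::'a) 1)"
  define m where "m = measure M (space M)"
  \<comment> \<open>The exponent \<open>s\<close> is at most 0 here, so upper bounds for 1 +
    |\<zeta>|^2 become lower bounds for the weight: 2|\<zeta>|^2 at high frequency, and 37 = 1 + 6^2
    at low frequency.\<close>
  define A' where "A' = A * 2 powr (- s) + V * m * 37 powr (- s)"
  have V: "0 \<le> V" and m: "0 \<le> m" by (simp_all add: V_def m_def)
  have A': "0 \<le> A'" using A V m by (simp add: A'_def)
  have "(\<integral>\<^sup>+t. ennreal ((norm (ball_mass (\<lambda>\<xi>. cis (t * norm \<xi> powr \<gamma>) * F \<xi>) \<zeta>))\<^sup>2) \<partial>M) \<le>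
    ennreal (A' * (1 + (norm \<zeta>)\<^sup>2) powr s) *
      (\<integral>\<^sup>+\<xi>. ennreal ((norm (F \<xi>))\<^sup>2) * indicator (ball \<zeta> 1) \<xi> \<partial>lborel)" (is "?L \<le> _ * ?Y")
    if F: "integrable lborel F" for \<zeta> :: 'a and F
  proof (cases "norm \<zeta> \<ge> 6")
    case True
    define k where "k = norm \<zeta>"
    have k: "k \<ge> 6" using True by (simp add: k_def)
    have "1 \<le> k\<^sup>2" using k by (simp add: one_le_power)
    then have "(2 * k\<^sup>2) powr s \<le> (1 + k\<^sup>2) powr s"
      using s by (intro powr_mono2') (auto simp: add_pos_nonneg)
    moreover have "(2 * k\<^sup>2) powr s = 2 powr s * k powr (\<alpha> * (1 - \<gamma>))"
    proof -
      have "k\<^sup>2 = k powr 2" using k by simp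
      then have "(k\<^sup>2) powr s = k powr (2 * s)" by (simp add: powr_powr)
      then show ?thesis using k by (simp add: powr_mult s_def)
    qed
    ultimately have "2 powr (- s) * (2 powr s * k powr (\<alpha> * (1 - \<gamma>))) \<le> 2 powr (- s) * (1 + k\<^sup>2) powr s"
      by (intro mult_left_mono) auto
    moreover have "2 powr (- s) * (2 powr s * k powr (\<alpha> * (1 - \<gamma>))) = k powr (\<alpha> * (1 - \<gamma>))"
      by (simp add: powr_minus)
    ultimately have "k powr (\<alpha> * (1 - \<gamma>)) \<le> 2 powr (- s) * (1 + k\<^sup>2) powr s" by simp
    then have "A * k powr (\<alpha> * (1 - \<gamma>)) \<le> A * (2 powr (- s) * (1 + k\<^sup>2) powr s)"
      using A by (rule mult_left_mono)
    also have "\<dots> \<le> A' * (1 + k\<^sup>2) powr s"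
      unfolding mult.assoc[symmetric] using V m by (intro mult_right_mono) (auto simp: A'_def)
    finally have kk: "A * norm \<zeta> powr (\<alpha> * (1 - \<gamma>)) \<le> A' * (1 + (norm \<zeta>)\<^sup>2) powr s" by (simp add: k_def)
    have "?L = (\<integral>\<^sup>+t. ennreal ((norm (\<integral>\<xi>. cis (t * norm \<xi> powr \<gamma>) * (F \<xi> * indicator (ball \<zeta> 1) \<xi>) \<partial>lborel))\<^sup>2) \<partial>M)"
      unfolding ball_mass_eq mult.assoc ..
    also have "\<dots> \<le> ennreal (A * norm \<zeta> powr (\<alpha> * (1 - \<gamma>))) * ?Y"
    proof (rule L2_duality[OF fin sigma_finite_lborel _ _ F _ dual[OF True]])
      show "(\<lambda>(t, \<xi>). cis (t * norm \<xi> powr \<gamma>)) \<in> borel_measurable (M \<Otimes>\<^sub>M lborel)" by measurable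
    qed auto
    also have "\<dots> \<le> ennreal (A' * (1 + (norm \<zeta>)\<^sup>2) powr s) * ?Y"
      by (intro mult_right_mono ennreal_leI kk) simp
    finally show ?thesis .
  next
    case False
    have [measurable]: "F \<in> borel_measurable borel" using F by auto
    have "(norm \<zeta>)\<^sup>2 \<le> 6\<^sup>2" using False by (intro power_mono) auto
    then have "37 powr s \<le> (1 + (norm \<zeta>)\<^sup>2) powr s"
      using s by (intro powr_mono2') (auto simp: add_pos_nonneg)
    then have "37 powr (- s) * 37 powr s \<le> 37 powr (- s) * (1 + (norm \<zeta>)\<^sup>2) powr s"
      by (intro mult_left_mono) auto
    then have "1 \<le> 37 powr (- s) * (1 + (norm \<zeta>)\<^sup>2) powr s"
      by (simp add: powr_minus)
    then have "V * m * 1 \<le> V * m * (37 powr (- s) * (1 + (norm \<zeta>)\<^sup>2) powr s)"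
      using V m by (intro mult_left_mono) auto
    also have "\<dots> \<le> A' * (1 + (norm \<zeta>)\<^sup>2) powr s"
      unfolding mult.assoc[symmetric] using A by (intro mult_right_mono) (auto simp: A'_def)
    finally have Vm: "V * m \<le> A' * (1 + (norm \<zeta>)\<^sup>2) powr s" by simp
    have "?L \<le> (\<integral>\<^sup>+t. ennreal V * ?Y \<partial>M)"
      unfolding V_def by (intro nn_integral_mono norm_ball_mass_square_le[OF F]) (simp_all add: norm_mult)
    also have "\<dots> = ennreal (V * m) * ?Y"
      using V m by (simp add: m_def M.emeasure_eq_measure ennreal_mult mult_ac)
    also have "\<dots> \<le> ennreal (A' * (1 + (norm \<zeta>)\<^sup>2) powr s) * ?Y"
      by (intro mult_right_mono ennreal_leI Vm) simp
    finally show ?thesis .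
  qed
  with A' show ?thesis unfolding s_def by blast
qed

text \<open>The local estimates are integrated in \<zeta>. Moving the weight from \<zeta> to \<xi>
  costs a constant, and after exchanging the integrals the indicator integrates in \<zeta> to the
  volume \<open>V\<close> of the unit ball.\<close>

lemma nn_integral_oscillatory_unit_ball_le:
  fixes M :: "real measure" and \<alpha> \<gamma> C1 :: real
  assumes \<gamma>: "\<gamma> > 1" and \<alpha>: "\<alpha> > 0" and fin: "finite_measure M" and sets: "sets M = sets borel" and C1: "0 \<le> C1"
    and mass: "\<And>t r. r > 0 \<Longrightarrow> (\<integral>\<^sup>+t'. ennreal (exp (- (norm (r *\<^sub>R (t - t')))\<^sup>2 / 2)) \<partial>M) \<le>
      ennreal (C1 * r powr (- \<alpha>))"
  shows "\<exists>C\<ge>0. \<forall>F::'a::euclidean_space \<Rightarrow> complex. integrable lborel F \<longrightarrow>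
    (\<integral>\<^sup>+t. (\<integral>\<^sup>+x. ennreal ((norm (\<integral>\<xi>. cis (x \<bullet> \<xi>) * (cis (t * norm \<xi> powr \<gamma>) * F \<xi>) \<partial>lborel))\<^sup>2) *
      indicator (ball 0 1) x \<partial>lborel) \<partial>M) \<le>
    ennreal C * (\<integral>\<^sup>+\<xi>. ennreal ((1 + (norm \<xi>)\<^sup>2) powr (\<alpha> * (1 - \<gamma>) / 2) * (norm (F \<xi>))\<^sup>2) \<partial>lborel)"
proof -
  interpret M: finite_measure M by fact
  interpret P: pair_sigma_finite "lborel :: 'a measure" M ..
  have [measurable_cong]: "sets M = sets borel" by fact
  define s where "s = \<alpha> * (1 - \<gamma>) / 2"
  have s: "s \<le> 0" using \<alpha> \<gamma> by (simp add: s_def mult_nonneg_nonpos)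
  obtain B where B: "0 < B" and ball: "\<And>F::'a \<Rightarrow> complex. integrable lborel F \<Longrightarrow>
    (\<integral>\<^sup>+x. ennreal ((norm (\<integral>\<xi>. cis (x \<bullet> \<xi>) * F \<xi> \<partial>lborel))\<^sup>2) * indicator (ball 0 1) x \<partial>lborel) \<le>
    ennreal B * (\<integral>\<^sup>+\<zeta>. ennreal ((norm (ball_mass F \<zeta>))\<^sup>2) \<partial>lborel)"
    using L2_ball_transform_le by blast
  obtain A where A: "0 \<le> A" and local: "\<And>\<zeta>::'a. \<And>F. integrable lborel F \<Longrightarrow>
    (\<integral>\<^sup>+t. ennreal ((norm (ball_mass (\<lambda>\<xi>. cis (t * norm \<xi> powr \<gamma>) * F \<xi>) \<zeta>))\<^sup>2) \<partial>M) \<le>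
    ennreal (A * (1 + (norm \<zeta>)\<^sup>2) powr s) *
      (\<integral>\<^sup>+\<xi>. ennreal ((norm (F \<xi>))\<^sup>2) * indicator (ball \<zeta> 1) \<xi> \<partial>lborel)"
    using nn_integral_ball_mass_modulated_le[OF \<gamma> \<alpha> fin sets C1 mass] unfolding s_def by blast
  define V where "V = measure lborel (ball (0::'a) 1)"
  have V: "0 \<le> V" by (simp add: V_def)
  define C where "C = B * (A * 3 powr (- s) * V)"
  have C: "0 \<le> C" using A B V by (simp add: C_def)
  have "(\<integral>\<^sup>+t. (\<integral>\<^sup>+x. ennreal ((norm (\<integral>\<xi>. cis (x \<bullet> \<xi>) * (cis (t * norm \<xi> powr \<gamma>) * F \<xi>) \<partial>lborel))\<^sup>2) *
      indicator (ball 0 1) x \<partial>lborel) \<partial>M) \<le>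
    ennreal C * (\<integral>\<^sup>+\<xi>. ennreal ((1 + (norm \<xi>)\<^sup>2) powr s * (norm (F \<xi>))\<^sup>2) \<partial>lborel)"
    (is "?L \<le> _ * ?R")
    if F: "integrable lborel F" for F :: "'a \<Rightarrow> complex"
  proof -
    have [measurable]: "F \<in> borel_measurable borel" using F by auto
    let ?b = "\<lambda>t \<zeta>. ball_mass (\<lambda>\<xi>. cis (t * norm \<xi> powr \<gamma>) * F \<xi>) \<zeta>"
    have bm[measurable]: "(\<lambda>(\<zeta>, t). ?b t \<zeta>) \<in> borel_measurable (lborel \<Otimes>\<^sub>M M)"
      unfolding ball_mass_def by measurable
    have bm'[measurable]: "(\<lambda>(t, \<zeta>). ?b t \<zeta>) \<in> borel_measurable (M \<Otimes>\<^sub>M lborel)"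
      unfolding ball_mass_def by measurable
    have "?L \<le> (\<integral>\<^sup>+t. ennreal B * (\<integral>\<^sup>+\<zeta>. ennreal ((norm (?b t \<zeta>))\<^sup>2) \<partial>lborel) \<partial>M)"
    proof (intro nn_integral_mono ball)
      show "integrable lborel (\<lambda>\<xi>. cis (t * norm \<xi> powr \<gamma>) * F \<xi>)" for t
        by (rule Bochner_Integration.integrable_bound[OF F]) (auto simp: norm_mult)
    qed
    also have "\<dots> = ennreal B * (\<integral>\<^sup>+t. (\<integral>\<^sup>+\<zeta>. ennreal ((norm (?b t \<zeta>))\<^sup>2) \<partial>lborel) \<partial>M)"
      by (rule nn_integral_cmult) measurable
    also have "(\<integral>\<^sup>+t. (\<integral>\<^sup>+\<zeta>. ennreal ((norm (?b t \<zeta>))\<^sup>2) \<partial>lborel) \<partial>M) =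
        (\<integral>\<^sup>+\<zeta>. (\<integral>\<^sup>+t. ennreal ((norm (?b t \<zeta>))\<^sup>2) \<partial>M) \<partial>lborel)"
      by (rule P.Fubini') measurable
    also have "\<dots> \<le> (\<integral>\<^sup>+\<zeta>. ennreal (A * (1 + (norm \<zeta>)\<^sup>2) powr s) *
      (\<integral>\<^sup>+\<xi>. ennreal ((norm (F \<xi>))\<^sup>2) * indicator (ball \<zeta> 1) \<xi> \<partial>lborel) \<partial>lborel)"
      by (intro nn_integral_mono local F)
    also have "\<dots> = (\<integral>\<^sup>+\<zeta>. (\<integral>\<^sup>+\<xi>. ennreal (A * (1 + (norm \<zeta>)\<^sup>2) powr s) *
      (ennreal ((norm (F \<xi>))\<^sup>2) * indicator (ball \<zeta> 1) \<xi>) \<partial>lborel) \<partial>lborel)"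
      by (intro nn_integral_cong nn_integral_cmult[symmetric]) measurable
    also have "\<dots> \<le> (\<integral>\<^sup>+\<zeta>. (\<integral>\<^sup>+\<xi>. ennreal (A * 3 powr (- s) * ((1 + (norm \<xi>)\<^sup>2) powr s * (norm (F \<xi>))\<^sup>2)) *
       indicator (ball 0 1) (\<zeta> - \<xi>) \<partial>lborel) \<partial>lborel)"
    proof (intro nn_integral_mono)
      fix \<zeta> \<xi> :: 'a
      have "A * (1 + (norm \<zeta>)\<^sup>2) powr s * (norm (F \<xi>))\<^sup>2 \<le> A * 3 powr (- s) * ((1 + (norm \<xi>)\<^sup>2) powr s * (norm (F \<xi>))\<^sup>2)"
        if d: "dist \<zeta> \<xi> < 1"
      proof -
        have "norm \<xi> \<le> norm \<zeta> + 1"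
          using d norm_triangle_ineq2[of \<xi> \<zeta>] by (simp add: dist_norm norm_minus_commute)
        then have "(norm \<xi>)\<^sup>2 \<le> (norm \<zeta> + 1)\<^sup>2" by (intro power_mono) auto
        also have "\<dots> \<le> 2 * (norm \<zeta>)\<^sup>2 + 2"
          using sum_squares_bound[of "norm \<zeta>" 1] by (simp add: power2_sum)
        finally have nn: "(norm \<xi>)\<^sup>2 \<le> 2 * (norm \<zeta>)\<^sup>2 + 2" .
        \<comment> \<open>The 3 comes from 1 + |\<xi>|^2 <= 3 + 2|\<zeta>|^2; the nonpositive
          exponent reverses the inequality.\<close>
        have "(1 + (norm \<xi>)\<^sup>2) / 3 \<le> 1 + (norm \<zeta>)\<^sup>2"
        proof -
          have "(1 + a) / 3 \<le> 1 + b" if "a \<le> 2 * b + 2" "0 \<le> b" for a b :: real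
            using that by simp
          from this[OF nn] show ?thesis by simp
        qed
        moreover have "0 < (1 + (norm \<xi>)\<^sup>2) / 3" by (simp add: add_pos_nonneg)
        ultimately have "(1 + (norm \<zeta>)\<^sup>2) powr s \<le> ((1 + (norm \<xi>)\<^sup>2) / 3) powr s"
          using powr_mono2'[OF s] by blast
        also have "\<dots> = 3 powr (- s) * (1 + (norm \<xi>)\<^sup>2) powr s"
          unfolding powr_divide powr_minus by (simp only: divide_inverse mult.commute)
        finally have "A * (1 + (norm \<zeta>)\<^sup>2) powr s * (norm (F \<xi>))\<^sup>2 \<le>
            A * (3 powr (- s) * (1 + (norm \<xi>)\<^sup>2) powr s) * (norm (F \<xi>))\<^sup>2"
          using A by (intro mult_right_mono mult_left_mono) auto
        then show ?thesis by (simp only: mult.assoc)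
      qed
      then show "ennreal (A * (1 + (norm \<zeta>)\<^sup>2) powr s) * (ennreal ((norm (F \<xi>))\<^sup>2) * indicator (ball \<zeta> 1) \<xi>) \<le>
        ennreal (A * 3 powr (- s) * ((1 + (norm \<xi>)\<^sup>2) powr s * (norm (F \<xi>))\<^sup>2)) * indicator (ball 0 1) (\<zeta> - \<xi>)"
        unfolding indicator_ball_diff
        using A by (auto simp: indicator_def ennreal_mult[symmetric] intro!: ennreal_leI)
    qed
    also have "\<dots> = (\<integral>\<^sup>+\<xi>. (\<integral>\<^sup>+\<zeta>. ennreal (A * 3 powr (- s) * ((1 + (norm \<xi>)\<^sup>2) powr s * (norm (F \<xi>))\<^sup>2)) *
       indicator (ball 0 1) (\<zeta> - \<xi>) \<partial>lborel) \<partial>lborel)"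
      by (rule lborel_pair.Fubini') measurable
    also have "\<dots> = (\<integral>\<^sup>+\<xi>. ennreal (A * 3 powr (- s) * V) * ennreal ((1 + (norm \<xi>)\<^sup>2) powr s * (norm (F \<xi>))\<^sup>2) \<partial>lborel)"
    proof (intro nn_integral_cong)
      fix \<xi> :: 'a
      have "(\<integral>\<^sup>+\<zeta>. indicator (ball 0 1) (\<zeta> - \<xi>) \<partial>lborel) = ennreal V"
        by (subst nn_integral_lborel_minus[of "indicator (ball (0::'a) 1)"])
          (simp_all add: emeasure_ball content_ball V_def)
      then have "(\<integral>\<^sup>+\<zeta>. ennreal (A * 3 powr (- s) * ((1 + (norm \<xi>)\<^sup>2) powr s * (norm (F \<xi>))\<^sup>2)) *
         indicator (ball 0 1) (\<zeta> - \<xi>) \<partial>lborel) =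
        ennreal (A * 3 powr (- s) * ((1 + (norm \<xi>)\<^sup>2) powr s * (norm (F \<xi>))\<^sup>2)) * ennreal V"
        by (subst nn_integral_cmult) simp_all
      also have "\<dots> = ennreal (A * 3 powr (- s) * V) * ennreal ((1 + (norm \<xi>)\<^sup>2) powr s * (norm (F \<xi>))\<^sup>2)"
        using A V by (simp add: ennreal_mult mult_ac)
      finally show "(\<integral>\<^sup>+\<zeta>. ennreal (A * 3 powr (- s) * ((1 + (norm \<xi>)\<^sup>2) powr s * (norm (F \<xi>))\<^sup>2)) *
         indicator (ball 0 1) (\<zeta> - \<xi>) \<partial>lborel) =
        ennreal (A * 3 powr (- s) * V) * ennreal ((1 + (norm \<xi>)\<^sup>2) powr s * (norm (F \<xi>))\<^sup>2)" .
    qed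
    also have "\<dots> = ennreal (A * 3 powr (- s) * V) * ?R"
      by (rule nn_integral_cmult) measurable
    also have "ennreal B * \<dots> = ennreal C * ?R"
      using A B V by (simp add: C_def ennreal_mult mult.assoc)
    finally show ?thesis by (simp add: mult_left_mono)
  qed
  with C show ?thesis unfolding s_def by blast
qed

section \<open>Decay of the Fourier transform of a test function\<close>

lemma integrable_continuous_compact_support:
  fixes f :: "'a::euclidean_space \<Rightarrow> complex"
  assumes f: "continuous_on UNIV f" and K: "compact K" "\<And>x. x \<notin> K \<Longrightarrow> f x = 0"
  shows "integrable lborel f"
proof -
  have "integrable lborel (\<lambda>x. indicator K x *\<^sub>R f x)"
    using K(1) f by (intro borel_integrable_compact) (auto intro: continuous_on_subset)
  also have "(\<lambda>x. indicator K x *\<^sub>R f x) = f"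
    using K(2) by (auto simp: indicator_def)
  finally show ?thesis .
qed

text \<open>The integral of \<open>F (x + v) - F x = \<integral>\<^sub>0\<^sup>1 D (x + h v) dh\<close> over \<open>x\<close> vanishes by translation
  invariance, and by Fubini it equals the integral of \<open>D\<close>.\<close>

lemma integral_directional_derivative_zero:
  fixes F D :: "'a::euclidean_space \<Rightarrow> complex" and v :: 'a
  assumes deriv: "\<And>x. (F has_derivative F' x) (at x)" and D: "\<And>x. F' x v = D x"
    and F: "integrable lborel F" and DD: "integrable lborel D" "continuous_on UNIV D"
  shows "(\<integral>x. D x \<partial>lborel) = 0"
proof -
  have [measurable]: "D \<in> borel_measurable borel" "F \<in> borel_measurable borel" using F DD by auto
  have ftc: "(\<integral>h. indicator {0..1} h *\<^sub>R D (x + h *\<^sub>R v) \<partial>lborel) = F (x + v) - F x" for x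
  proof -
    have "(\<integral>h. indicator {0..1} h *\<^sub>R D (x + h *\<^sub>R v) \<partial>lborel) = F (x + 1 *\<^sub>R v) - F (x + 0 *\<^sub>R v)"
    proof (rule integral_FTC_atLeastAtMost)
      fix h :: real
      have "((\<lambda>h. F (x + h *\<^sub>R v)) has_derivative (\<lambda>k. F' (x + h *\<^sub>R v) (k *\<^sub>R v))) (at h)"
        by (rule has_derivative_compose[of "\<lambda>h. x + h *\<^sub>R v" _ _ _ F, OF _ deriv])
           (auto intro!: derivative_eq_intros)
      moreover have "F' (x + h *\<^sub>R v) (k *\<^sub>R v) = k *\<^sub>R D (x + h *\<^sub>R v)" for k
        using linear_scale[OF has_derivative_linear[OF deriv]] by (simp add: D)
      ultimately show "((\<lambda>h. F (x + h *\<^sub>R v)) has_vector_derivative D (x + h *\<^sub>R v)) (at h within {0..1})"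
        by (simp add: has_vector_derivative_def has_derivative_at_withinI)
    next
      show "continuous_on {0..1} (\<lambda>h. D (x + h *\<^sub>R v))"
        by (intro continuous_on_compose2[OF DD(2)] continuous_intros) auto
    qed simp
    then show ?thesis by simp
  qed
  have shift: "integrable lborel (\<lambda>x. f (x + a))" "(\<integral>x. f (x + a) \<partial>lborel) = (\<integral>x. f x \<partial>lborel)"
    if "integrable lborel f" for f :: "'a \<Rightarrow> complex" and a
    using that integrable_lborel_minus[of f "- a"] integral_lborel_minus[of f "- a"] by auto
  have shiftn: "(\<integral>x. norm (f (x + a)) \<partial>lborel) = (\<integral>x. norm (f x) \<partial>lborel)"
    if [measurable]: "f \<in> borel_measurable borel" for f :: "'a \<Rightarrow> complex" and a
    using integral_lborel_minus[of "\<lambda>x. norm (f x)" "- a"] by simp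
  have int: "integrable (lborel \<Otimes>\<^sub>M lborel) (\<lambda>(h, x). indicator {0..1::real} h *\<^sub>R D (x + h *\<^sub>R v))"
  proof (rule lborel_pair.Fubini_integrable)
    have "integrable lborel (\<lambda>h::real. indicator {0..1} h * (\<integral>x. norm (D x) \<partial>lborel))"
      by (intro integrable_mult_left integrable_real_indicator) auto
    then show "integrable lborel (\<lambda>h. \<integral>x. norm (case (h, x) of (h, x) \<Rightarrow> indicator {0..1::real} h *\<^sub>R D (x + h *\<^sub>R v)) \<partial>lborel)"
      by (simp add: shiftn)
    show "AE h in lborel. integrable lborel (\<lambda>x. case (h, x) of (h, x) \<Rightarrow> indicator {0..1::real} h *\<^sub>R D (x + h *\<^sub>R v))"
      using shift(1)[OF DD(1)] by simp
  qed measurable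
  have "0 = (\<integral>x. F (x + v) - F x \<partial>lborel)"
    using shift[OF F, of v] F by (simp add: Bochner_Integration.integral_diff)
  also have "\<dots> = (\<integral>x. (\<integral>h. indicator {0..1} h *\<^sub>R D (x + h *\<^sub>R v) \<partial>lborel) \<partial>lborel)"
    unfolding ftc ..
  also have "\<dots> = (\<integral>h. (\<integral>x. indicator {0..1::real} h *\<^sub>R D (x + h *\<^sub>R v) \<partial>lborel) \<partial>lborel)"
    by (rule lborel_pair.Fubini_integral[OF int])
  also have "\<dots> = (\<integral>h. indicator {0..1::real} h *\<^sub>R (\<integral>x. D x \<partial>lborel) \<partial>lborel)"
    using shift(2)[OF DD(1)] by simp
  also have "\<dots> = (\<integral>x. D x \<partial>lborel)"
    by simp
  finally show ?thesis by simp
qed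

section \<open>Integration by parts for test functions\<close>

lemma smooth_iterated_partial:
  assumes \<phi>: "smooth \<phi>" and vs: "vs \<in> lists Basis"
  shows smooth_has_derivative: "(iterated_partial vs \<phi> has_derivative frechet_derivative (iterated_partial vs \<phi>) (at x)) (at x)"
    and smooth_continuous: "continuous_on UNIV (iterated_partial vs \<phi>)"
proof -
  have d: "iterated_partial vs \<phi> differentiable_on UNIV" using \<phi> vs unfolding smooth_def by blast
  then show "(iterated_partial vs \<phi> has_derivative frechet_derivative (iterated_partial vs \<phi>) (at x)) (at x)"
    unfolding differentiable_on_def frechet_derivative_works[symmetric] by simp
  show "continuous_on UNIV (iterated_partial vs \<phi>)"
    by (rule differentiable_imp_continuous_on[OF d])
qed

text \<open>The complement of the closed support is open, so near each of its points the function
  vanishes identically and so do its derivatives.\<close>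

lemma iterated_partial_support:
  assumes \<phi>: "smooth \<phi>" and vs: "vs \<in> lists Basis" and x: "x \<notin> closure {x. \<phi> x \<noteq> 0}"
  shows "iterated_partial vs \<phi> x = 0"
  using vs x
proof (induction vs arbitrary: x rule: list.induct)
  case Nil
  then have "x \<notin> {x. \<phi> x \<noteq> 0}" using closure_subset[of "{x. \<phi> x \<noteq> 0}"] by auto
  then show ?case by simp
next
  case (Cons v vs)
  have vs: "vs \<in> lists Basis" using Cons by auto
  have "frechet_derivative (iterated_partial vs \<phi>) (at x) = frechet_derivative (\<lambda>_. 0) (at x)"
  proof (rule frechet_derivative_transform_within_open)
    show "iterated_partial vs \<phi> differentiable at x"
      using smooth_has_derivative[OF \<phi> vs] by (rule differentiableI)
    show "open (- closure {x. \<phi> x \<noteq> 0})" by (intro open_Compl closed_closure)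
  qed (use Cons vs in auto)
  then show ?case by simp
qed

lemma transform_partial:
  fixes \<phi> :: "'a::euclidean_space \<Rightarrow> complex"
  assumes \<phi>: "smooth \<phi>" "compact (closure {x. \<phi> x \<noteq> 0})" and vs: "v # vs \<in> lists Basis"
  shows "(\<integral>x. cis (\<xi> \<bullet> x) * iterated_partial (v # vs) \<phi> x \<partial>lborel) =
    - (\<i> * of_real (\<xi> \<bullet> v)) * (\<integral>x. cis (\<xi> \<bullet> x) * iterated_partial vs \<phi> x \<partial>lborel)"
proof -
  let ?f = "iterated_partial vs \<phi>" and ?g = "iterated_partial (v # vs) \<phi>"
  let ?K = "closure {x. \<phi> x \<noteq> 0}"
  have vs': "vs \<in> lists Basis" using vs by auto
  have cont: "continuous_on UNIV (\<lambda>x. cis (\<xi> \<bullet> x) * iterated_partial us \<phi> x)" if "us \<in> lists Basis" for us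
    by (intro continuous_intros smooth_continuous[OF \<phi>(1) that])
  have int: "integrable lborel (\<lambda>x. cis (\<xi> \<bullet> x) * iterated_partial us \<phi> x)" if "us \<in> lists Basis" for us
    by (rule integrable_continuous_compact_support[OF cont[OF that] \<phi>(2)])
       (simp add: iterated_partial_support[OF \<phi>(1) that])
  \<comment> \<open>The derivative of \<open>cis (\<xi> \<bullet> x) * ?f x\<close> in direction
    \<open>v\<close>; that its integral vanishes is integration by parts without boundary
    term.\<close>
  let ?D = "\<lambda>x. \<i> * of_real (\<xi> \<bullet> v) * (cis (\<xi> \<bullet> x) * ?f x) + cis (\<xi> \<bullet> x) * ?g x"
  have "(\<integral>x. ?D x \<partial>lborel) = 0"
  proof (rule integral_directional_derivative_zero)
    fix x
    show "((\<lambda>x. cis (\<xi> \<bullet> x) * ?f x) has_derivative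
      (\<lambda>h. cis (\<xi> \<bullet> x) * frechet_derivative ?f (at x) h + ((\<xi> \<bullet> h) *\<^sub>R (\<i> * cis (\<xi> \<bullet> x))) * ?f x)) (at x)"
      by (rule has_derivative_mult[OF has_derivative_cis smooth_has_derivative[OF \<phi>(1) vs']])
         (auto intro!: derivative_eq_intros)
    show "cis (\<xi> \<bullet> x) * frechet_derivative ?f (at x) v + ((\<xi> \<bullet> v) *\<^sub>R (\<i> * cis (\<xi> \<bullet> x))) * ?f x = ?D x"
      by (simp add: scaleR_conv_of_real mult_ac)
    show "integrable lborel (\<lambda>x. cis (\<xi> \<bullet> x) * ?f x)" by (rule int[OF vs'])
    show "integrable lborel ?D"
      by (intro Bochner_Integration.integrable_add integrable_mult_right int vs vs')
    show "continuous_on UNIV ?D"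
      by (intro continuous_on_add continuous_on_mult_left cont vs vs')
  qed
  also have "(\<integral>x. ?D x \<partial>lborel) = \<i> * of_real (\<xi> \<bullet> v) * (\<integral>x. cis (\<xi> \<bullet> x) * ?f x \<partial>lborel) + (\<integral>x. cis (\<xi> \<bullet> x) * ?g x \<partial>lborel)"
    using int[OF vs] int[OF vs'] by (subst Bochner_Integration.integral_add) (simp_all del: iterated_partial.simps)
  finally show ?thesis by (simp add: eq_neg_iff_add_eq_0 add.commute del: iterated_partial.simps)
qed

lemma transform_decay_direction:
  fixes \<phi> :: "'a::euclidean_space \<Rightarrow> complex"
  assumes \<phi>: "smooth \<phi>" "compact (closure {x. \<phi> x \<noteq> 0})" and v: "v \<in> Basis"
  shows "\<bar>\<xi> \<bullet> v\<bar> ^ n * norm (\<integral>x. cis (\<xi> \<bullet> x) * \<phi> x \<partial>lborel) \<le>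
    (\<integral>x. norm (iterated_partial (replicate n v) \<phi> x) \<partial>lborel)"
proof -
  have vs: "replicate n v \<in> lists Basis" for n using v by auto
  have "norm (\<integral>x. cis (\<xi> \<bullet> x) * iterated_partial (replicate n v) \<phi> x \<partial>lborel) =
    \<bar>\<xi> \<bullet> v\<bar> ^ n * norm (\<integral>x. cis (\<xi> \<bullet> x) * \<phi> x \<partial>lborel)"
  proof (induction n)
    case (Suc n)
    show ?case
      unfolding replicate_Suc transform_partial[OF \<phi> vs[of "Suc n", unfolded replicate_Suc]]
        norm_mult Suc.IH
      by (simp add: norm_mult)
  qed simp
  moreover have "norm (\<integral>x. cis (\<xi> \<bullet> x) * iterated_partial (replicate n v) \<phi> x \<partial>lborel) \<le>
      (\<integral>x. norm (cis (\<xi> \<bullet> x) * iterated_partial (replicate n v) \<phi> x) \<partial>lborel)"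
    by (rule integral_norm_bound)
  ultimately show ?thesis by (simp add: norm_mult)
qed

text \<open>Some coordinate of \<xi> has modulus at least |\<xi>|/d, because |\<xi>| is at most the
  sum of these moduli. Repeated derivatives in that single direction give the decay, and summing
  over the basis makes the constant independent of \<xi>.\<close>

lemma transform_decay:
  fixes \<phi> :: "'a::euclidean_space \<Rightarrow> complex"
  assumes \<phi>: "smooth \<phi>" "compact (closure {x. \<phi> x \<noteq> 0})"
  shows "\<exists>C\<ge>0. \<forall>\<xi>. (1 + norm \<xi>) ^ n * norm (\<integral>x. cis (\<xi> \<bullet> x) * \<phi> x \<partial>lborel) \<le> C"
proof -
  let ?T = "\<lambda>\<xi>. norm (\<integral>x. cis (\<xi> \<bullet> x) * \<phi> x \<partial>lborel)"
  define I where "I m v = (\<integral>x. norm (iterated_partial (replicate m v) \<phi> x) \<partial>lborel)" for m and v :: 'a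
  have I0: "0 \<le> I m v" for m v by (simp add: I_def)
  define S where "S m = (\<Sum>v\<in>Basis. I m v)" for m
  have IS: "I m v \<le> S m" if "v \<in> Basis" for m v
    unfolding S_def using that I0 by (intro member_le_sum) auto
  have S0: "0 \<le> S m" for m unfolding S_def by (intro sum_nonneg I0)
  have "(1 + norm \<xi>) ^ n * ?T \<xi> \<le> 2 ^ n * (S 0 + real DIM('a) ^ n * S n)" for \<xi>
  proof -
    obtain v where v: "v \<in> Basis" "norm \<xi> \<le> real DIM('a) * \<bar>\<xi> \<bullet> v\<bar>"
    proof -
      have "\<exists>v\<in>Basis. norm \<xi> \<le> real DIM('a) * \<bar>\<xi> \<bullet> v\<bar>"
      proof (rule ccontr)
        assume "\<not> ?thesis"
        then have "\<bar>\<xi> \<bullet> v\<bar> < norm \<xi> / real DIM('a)" if "v \<in> Basis" for v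
          using that by (simp add: not_le field_simps)
        then have "(\<Sum>v\<in>Basis. \<bar>\<xi> \<bullet> v\<bar>) < (\<Sum>v\<in>(Basis::'a set). norm \<xi> / real DIM('a))"
          by (intro sum_strict_mono) auto
        then show False using norm_le_l1[of \<xi>] by simp
      qed
      then show thesis using that by blast
    qed
    have "norm \<xi> ^ n * ?T \<xi> \<le> (real DIM('a) * \<bar>\<xi> \<bullet> v\<bar>) ^ n * ?T \<xi>"
      using v by (intro mult_right_mono power_mono) auto
    also have "\<dots> = real DIM('a) ^ n * (\<bar>\<xi> \<bullet> v\<bar> ^ n * ?T \<xi>)"
      by (simp add: power_mult_distrib)
    also have "\<dots> \<le> real DIM('a) ^ n * S n"
      using transform_decay_direction[OF \<phi> v(1), of \<xi> n] IS[OF v(1), of n]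
      by (intro mult_left_mono) (auto simp: I_def)
    finally have n: "norm \<xi> ^ n * ?T \<xi> \<le> real DIM('a) ^ n * S n" .
    have z: "?T \<xi> \<le> S 0"
      using transform_decay_direction[OF \<phi> v(1), of \<xi> 0] IS[OF v(1), of 0] by (simp add: I_def)
    \<comment> \<open>Only the powers 0 and n are controlled; passing through the maximum avoids the
      mixed terms of the binomial expansion.\<close>
    have "(1 + norm \<xi>) ^ n \<le> (2 * max 1 (norm \<xi>)) ^ n" by (intro power_mono) auto
    also have "\<dots> = 2 ^ n * max 1 (norm \<xi>) ^ n" by (rule power_mult_distrib)
    also have "max 1 (norm \<xi>) ^ n \<le> 1 + norm \<xi> ^ n" by (simp add: max_def)
    finally have "(1 + norm \<xi>) ^ n \<le> 2 ^ n * (1 + norm \<xi> ^ n)" by simp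
    then have "(1 + norm \<xi>) ^ n * ?T \<xi> \<le> 2 ^ n * (1 + norm \<xi> ^ n) * ?T \<xi>"
      by (rule mult_right_mono) simp
    also have "\<dots> = 2 ^ n * (?T \<xi> + norm \<xi> ^ n * ?T \<xi>)" by (simp add: algebra_simps)
    also have "\<dots> \<le> 2 ^ n * (S 0 + real DIM('a) ^ n * S n)"
      by (intro mult_left_mono add_mono n z) simp
    finally show ?thesis .
  qed
  moreover have "0 \<le> 2 ^ n * (S 0 + real DIM('a) ^ n * S n)" using S0 by simp
  ultimately show ?thesis by blast
qed

text \<open>The integrand is dominated by a sum over balls of integer radius, each of volume c (n +
  1)^d, so the exponent d + 2 leaves the convergent series of inverse squares.\<close>

lemma nn_integral_inverse_power_finite:
  "(\<integral>\<^sup>+\<xi>. ennreal (1 / (1 + norm (\<xi>::'a::euclidean_space)) ^ (DIM('a) + 2)) \<partial>lborel) < \<infinity>"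
proof -
  let ?d = "DIM('a)"
  define c where "c = unit_ball_vol (real ?d)"
  have c: "0 \<le> c" by (simp add: c_def)
  let ?B = "\<lambda>n::nat. ball (0::'a) (Suc n)"
  let ?a = "\<lambda>n::nat. 1 / real (Suc n) ^ (?d + 2)"
  have "(\<integral>\<^sup>+\<xi>. ennreal (1 / (1 + norm (\<xi>::'a)) ^ (?d + 2)) \<partial>lborel) \<le>
    (\<integral>\<^sup>+\<xi>. (\<Sum>n. ennreal (?a n) * indicator (?B n) \<xi>) \<partial>lborel)"
  proof (intro nn_integral_mono)
    fix \<xi> :: 'a
    define n where "n = nat \<lfloor>norm \<xi>\<rfloor>"
    have n: "real n \<le> norm \<xi>" "norm \<xi> < Suc n" unfolding n_def by (simp_all, linarith+)
    define f where "f n = ennreal (?a n) * indicator (?B n) \<xi>" for n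
    have "1 / (1 + norm \<xi>) ^ (?d + 2) \<le> ?a n"
      using n(1) by (intro divide_left_mono power_mono mult_pos_pos zero_less_power) auto
    then have "ennreal (1 / (1 + norm \<xi>) ^ (?d + 2)) \<le> f n"
      using n(2) by (auto simp: f_def dist_norm intro!: ennreal_leI)
    also have "sum f {n} \<le> suminf f" by (intro sum_le_suminf summableI) auto
    then have "f n \<le> suminf f" by simp
    finally show "ennreal (1 / (1 + norm \<xi>) ^ (?d + 2)) \<le> (\<Sum>n. ennreal (?a n) * indicator (?B n) \<xi>)"
      by (simp only: f_def[abs_def])
  qed
  also have "\<dots> = (\<Sum>n. \<integral>\<^sup>+\<xi>. ennreal (?a n) * indicator (?B n) \<xi> \<partial>lborel)"
    by (rule nn_integral_suminf) measurable
  also have "\<dots> = (\<Sum>n. ennreal (c * (1 / real (Suc n) ^ 2)))"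
  proof (intro suminf_cong)
    fix n
    have "(\<integral>\<^sup>+\<xi>. ennreal (?a n) * indicator (?B n) \<xi> \<partial>lborel) = ennreal (?a n) * ennreal (c * real (Suc n) ^ ?d)"
      unfolding c_def by (subst nn_integral_cmult_indicator) (simp_all add: emeasure_ball)
    also have "\<dots> = ennreal (?a n * (c * real (Suc n) ^ ?d))"
      using c by (intro ennreal_mult[symmetric]) auto
    also have "?a n * (c * real (Suc n) ^ ?d) = c * (1 / real (Suc n) ^ 2)"
      by (simp add: power_add power2_eq_square del: of_nat_Suc)
    finally show "(\<integral>\<^sup>+\<xi>. ennreal (?a n) * indicator (?B n) \<xi> \<partial>lborel) = ennreal (c * (1 / real (Suc n) ^ 2))" .
  qed
  also have "\<dots> = ennreal (\<Sum>n. c * (1 / real (Suc n) ^ 2))"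
  proof (intro suminf_ennreal2 summable_mult)
    have "(\<lambda>n. 1 / (real n + 1)\<^sup>2) sums (pi\<^sup>2 / 6)" using inverse_squares_sums by (simp add: add.commute)
    then show "summable (\<lambda>n. 1 / (real (Suc n))\<^sup>2)"
      by (auto simp: add.commute dest: sums_summable)
  qed (use c in simp)
  finally show ?thesis by (rule order_le_less_trans) simp
qed

text \<open>Splitting the weight between the factors, ab <= a^2 + b^2 bounds the product by the
  weighted square of \<open>g\<close> plus the square of the transform over the weight. Polynomial
  growth of the inverse weight is absorbed by the decay of the transform.\<close>

lemma integrable_mult_inv_fourier:
  fixes \<phi> g :: "'a::euclidean_space \<Rightarrow> complex"
  assumes \<phi>: "smooth \<phi>" "compact (closure {x. \<phi> x \<noteq> 0})"
    and g[measurable]: "g \<in> borel_measurable borel" and \<sigma>: "\<sigma> \<le> 0"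
    and int: "integrable lborel (\<lambda>\<xi>. (1 + (norm \<xi>)\<^sup>2) powr \<sigma> * (norm (g \<xi>))\<^sup>2)"
  shows "integrable lborel (\<lambda>\<xi>. g \<xi> * inv_fourier \<phi> \<xi>)"
proof -
  let ?T = "\<lambda>\<xi>. \<integral>x. cis (\<xi> \<bullet> x) * \<phi> x \<partial>lborel"
  \<comment> \<open>\<open>m\<close> bounds the growth of the inverse weight, and \<open>n\<close>
    adds the d + 2 powers that an integrable tail requires.\<close>
  define m where "m = nat \<lceil>- 2 * \<sigma>\<rceil>"
  define n where "n = m + (DIM('a) + 2)"
  obtain K where K: "0 \<le> K" "\<And>\<xi>. (1 + norm \<xi>) ^ n * norm (?T \<xi>) \<le> K"
    using transform_decay[OF \<phi>, of n] by blast
  have "continuous_on UNIV \<phi>" using smooth_continuous[OF \<phi>(1), of "[]"] by simp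
  then have [measurable]: "\<phi> \<in> borel_measurable borel" by (rule borel_measurable_continuous_onI)
  have [measurable]: "?T \<in> borel_measurable borel" by measurable
  let ?w = "\<lambda>\<xi>::'a. (1 + (norm \<xi>)\<^sup>2) powr \<sigma>"
  let ?p = "\<lambda>\<xi>::'a. 1 / (1 + norm \<xi>) ^ (DIM('a) + 2)"
  have p: "integrable lborel ?p"
  proof (rule integrableI_bounded)
    have "(\<integral>\<^sup>+\<xi>. ennreal (norm (?p \<xi>)) \<partial>lborel) = (\<integral>\<^sup>+\<xi>. ennreal (?p \<xi>) \<partial>lborel)"
      by (intro nn_integral_cong) simp
    then show "(\<integral>\<^sup>+\<xi>. ennreal (norm (?p \<xi>)) \<partial>lborel) < \<infinity>"
      using nn_integral_inverse_power_finite by simp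
  qed measurable
  have bound: "norm (g \<xi> * ?T \<xi>) \<le> ?w \<xi> * (norm (g \<xi>))\<^sup>2 + K\<^sup>2 * ?p \<xi>" for \<xi>
  proof -
    define a where "a = 1 + norm \<xi>"
    have a: "1 \<le> a" by (simp add: a_def)
    define q where "q = (1 + (norm \<xi>)\<^sup>2) powr (\<sigma> / 2)"
    have "1 + (norm \<xi>)\<^sup>2 \<noteq> 0"
      by (rule less_imp_neq[THEN not_sym], rule add_pos_nonneg) auto
    then have q: "0 < q" by (simp add: q_def)
    have qq: "q\<^sup>2 = ?w \<xi>"
      unfolding q_def power2_eq_square powr_add[symmetric] field_sum_of_halves ..
    have "1 + (norm \<xi>)\<^sup>2 \<le> a\<^sup>2" by (simp add: a_def power2_sum)
    then have "(1 + (norm \<xi>)\<^sup>2) powr (- \<sigma>) \<le> (a\<^sup>2) powr (- \<sigma>)"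
      using \<sigma> by (intro powr_mono2) auto
    also have "a\<^sup>2 = a powr 2" using a by simp
    also have "(a powr 2) powr (- \<sigma>) = a powr (- 2 * \<sigma>)" by (simp add: powr_powr)
    also have "\<dots> \<le> a powr real m" using a unfolding m_def by (intro powr_mono) linarith+
    also have "\<dots> = a ^ m" using a by (simp add: powr_realpow)
    finally have inv: "1 / q\<^sup>2 \<le> a ^ m" unfolding qq powr_minus divide_inverse mult_1_left .
    have an: "0 < a ^ n" using a by simp
    have "a ^ n * norm (?T \<xi>) \<le> K" using K(2)[of \<xi>] unfolding a_def .
    then have T: "norm (?T \<xi>) \<le> K / a ^ n"
      by (subst pos_le_divide_eq[OF an], subst mult.commute)
    have cancel: "x * y = (q * x) * (y / q)" for x y :: real using q by simp
    have xy: "x * y \<le> x\<^sup>2 + y\<^sup>2" if "0 \<le> x * y" for x y :: real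
    proof -
      have "x * y + x * y \<le> x\<^sup>2 + y\<^sup>2" using sum_squares_bound[of x y] by simp
      then show ?thesis by (rule order_trans[rotated]) (use that in simp)
    qed
    have "norm (g \<xi> * ?T \<xi>) = (q * norm (g \<xi>)) * (norm (?T \<xi>) / q)"
      unfolding norm_mult by (rule cancel)
    also have "\<dots> \<le> (q * norm (g \<xi>))\<^sup>2 + (norm (?T \<xi>) / q)\<^sup>2"
      by (rule xy) (intro mult_nonneg_nonneg divide_nonneg_pos q less_imp_le[OF q] norm_ge_zero)
    also have "(q * norm (g \<xi>))\<^sup>2 = ?w \<xi> * (norm (g \<xi>))\<^sup>2" by (simp add: power_mult_distrib qq)
    also have "(norm (?T \<xi>) / q)\<^sup>2 = (norm (?T \<xi>))\<^sup>2 * (1 / q\<^sup>2)" by (simp add: power_divide)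
    also have "\<dots> \<le> (K / a ^ n)\<^sup>2 * a ^ m"
      by (intro mult_mono power_mono T inv norm_ge_zero zero_le_power2) simp
    also have "\<dots> = K\<^sup>2 * (a ^ m / a ^ (n + n))"
      by (simp only: power_divide power2_eq_square[of "a ^ n"] power_add times_divide_eq_left times_divide_eq_right)
    also have "\<dots> \<le> K\<^sup>2 * (1 / a ^ (DIM('a) + 2))"
    proof (intro mult_left_mono)
      have "a ^ (m + (DIM('a) + 2)) \<le> a ^ (n + n)" using a by (intro power_increasing) (auto simp: n_def)
      then have le: "a ^ m * a ^ (DIM('a) + 2) \<le> a ^ (n + n)" by (simp only: power_add)
      have pos: "0 < a ^ (DIM('a) + 2)" "0 < a ^ (n + n)" using a by simp_all
      have "a ^ m \<le> a ^ (n + n) / a ^ (DIM('a) + 2)"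
        using le unfolding pos_le_divide_eq[OF pos(1)] .
      then show "a ^ m / a ^ (n + n) \<le> 1 / a ^ (DIM('a) + 2)"
        unfolding pos_divide_le_eq[OF pos(2)] by simp
    qed simp
    finally show ?thesis unfolding a_def by this (simp_all only: add_left_mono)
  qed
  have "integrable lborel (\<lambda>\<xi>. g \<xi> * ?T \<xi>)"
  proof (rule Bochner_Integration.integrable_bound)
    show "integrable lborel (\<lambda>\<xi>. ?w \<xi> * (norm (g \<xi>))\<^sup>2 + K\<^sup>2 * ?p \<xi>)"
      by (intro Bochner_Integration.integrable_add int integrable_mult_right p)
    show "AE \<xi> in lborel. norm (g \<xi> * ?T \<xi>) \<le> norm (?w \<xi> * (norm (g \<xi>))\<^sup>2 + K\<^sup>2 * ?p \<xi>)"
      by (rule AE_I2, unfold real_norm_def, rule order_trans[OF bound abs_ge_self])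
  qed measurable
  then have "integrable lborel (\<lambda>\<xi>. of_real (1 / (2 * pi) ^ DIM('a)) * (g \<xi> * ?T \<xi>))"
    by (rule integrable_mult_right)
  then show ?thesis by (simp only: inv_fourier_def mult.left_commute)
qed

section \<open>The solution as a limit of frequency truncations\<close>

lemma geometric_steps_limit:
  fixes z :: "nat \<Rightarrow> complex"
  assumes d: "0 \<le> d" and step: "\<And>i. norm (z (Suc i) - z i) \<le> d * (1/2) ^ i"
  shows geometric_steps_tendsto: "z \<longlonglongrightarrow> lim z"
    and geometric_steps_norm_le: "norm (lim z - z j) \<le> 2 * d * (1/2) ^ j"
proof -
  \<comment> \<open>The subtracted term closes the induction: a step of d/2^m is exactly the
    difference of 2d/2^m and 2d/2^(m+1).\<close>
  have claim: "norm (z (j + k) - z j) \<le> 2 * d * (1/2) ^ j - 2 * d * (1/2) ^ (j + k)" for j k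
  proof (induction k)
    case (Suc k)
    have "norm (z (j + Suc k) - z j) \<le> norm (z (Suc (j + k)) - z (j + k)) + norm (z (j + k) - z j)"
      using norm_triangle_ineq[of "z (Suc (j + k)) - z (j + k)" "z (j + k) - z j"] by simp
    also have "\<dots> \<le> d * (1/2) ^ (j + k) + (2 * d * (1/2) ^ j - 2 * d * (1/2) ^ (j + k))"
      by (intro add_mono step Suc.IH)
    also have "\<dots> = 2 * d * (1/2) ^ j - 2 * d * (1/2) ^ (j + Suc k)" by simp
    finally show ?case .
  qed simp
  have bound: "norm (z m - z j) \<le> 2 * d * (1/2) ^ j" if "j \<le> m" for j m
  proof -
    have "0 \<le> 2 * d * (1/2) ^ m" using d by simp
    then show ?thesis using claim[of j "m - j"] that by simp
  qed
  have "Cauchy z"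
  proof (rule CauchyI')
    fix e :: real assume e: "0 < e"
    have "(\<lambda>j. 2 * d * (1/2) ^ j) \<longlonglongrightarrow> 2 * d * 0"
      by (intro tendsto_intros LIMSEQ_power_zero) simp
    then have "eventually (\<lambda>j. 2 * d * (1/2) ^ j < e) sequentially"
      using e by (intro order_tendstoD) auto
    then obtain J where J: "\<And>j. J \<le> j \<Longrightarrow> 2 * d * (1/2) ^ j < e"
      by (auto simp: eventually_sequentially)
    have "dist (z m) (z n) < e" if "J \<le> m" "m < n" for m n
      using bound[of m n] J[OF that(1)] that by (simp add: dist_norm norm_minus_commute)
    then show "\<exists>M. \<forall>m\<ge>M. \<forall>n>m. dist (z m) (z n) < e" by blast
  qed
  then show lim: "z \<longlonglongrightarrow> lim z"
    using Cauchy_convergent_iff convergent_LIMSEQ_iff by blast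
  have "(\<lambda>m. norm (z m - z j)) \<longlonglongrightarrow> norm (lim z - z j)"
    by (intro tendsto_intros lim)
  then show "norm (lim z - z j) \<le> 2 * d * (1/2) ^ j"
    by (rule LIMSEQ_le_const2) (use bound in auto)
qed

text \<open>The weight \<open>4 ^ j\<close> makes the steps at a point where the series below is finite geometric,
  so that a fast Cauchy sequence in \<open>L\<^sup>2\<close> converges almost everywhere with a square integrable
  rate.\<close>

definition step_series :: "(nat \<Rightarrow> 'b \<Rightarrow> complex) \<Rightarrow> 'b \<Rightarrow> ennreal" where
  "step_series f x = (\<Sum>j. ennreal (4 ^ j * (norm (f (Suc j) x - f j x))\<^sup>2))"

text \<open>Every term is at most the whole sum, so the i-th step is at most 2^(-i) times the root
  of the series. The resulting bound is the same for all \<open>j\<close>, as dominated convergence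
  will require.\<close>

lemma step_series_bounds:
  assumes fin: "step_series f x < \<infinity>"
  shows step_series_tendsto: "(\<lambda>j. f j x) \<longlonglongrightarrow> lim (\<lambda>j. f j x)"
    and step_series_norm_le: "norm (lim (\<lambda>j. f j x) - f j x) \<le> 2 * sqrt (enn2real (step_series f x))"
proof -
  define d where "d = enn2real (step_series f x)"
  have d: "0 \<le> d" by (simp add: d_def)
  have D: "step_series f x = ennreal d" using fin by (simp add: d_def less_top)
  have step: "norm (f (Suc i) x - f i x) \<le> sqrt d * (1/2) ^ i" for i
  proof -
    define h where "h j = ennreal (4 ^ j * (norm (f (Suc j) x - f j x))\<^sup>2)" for j
    have "sum h {i} \<le> suminf h" by (intro sum_le_suminf summableI) auto
    then have "h i \<le> ennreal d" using D by (simp add: step_series_def h_def[abs_def])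
    then have "4 ^ i * (norm (f (Suc i) x - f i x))\<^sup>2 \<le> d"
      unfolding h_def using d by (subst (asm) ennreal_le_iff) auto
    then have "sqrt (4 ^ i * (norm (f (Suc i) x - f i x))\<^sup>2) \<le> sqrt d" by (rule real_sqrt_le_mono)
    moreover have "sqrt (4 ^ i) = (2::real) ^ i"
      by (simp add: real_sqrt_power)
    ultimately have "2 ^ i * norm (f (Suc i) x - f i x) \<le> sqrt d"
      by (simp add: real_sqrt_mult)
    then show ?thesis by (simp add: power_divide field_simps)
  qed
  have s0: "0 \<le> sqrt d" using d by simp
  show "(\<lambda>j. f j x) \<longlonglongrightarrow> lim (\<lambda>j. f j x)"
    by (rule geometric_steps_tendsto[OF s0, of "\<lambda>j. f j x"]) (rule step)
  have "norm (lim (\<lambda>j. f j x) - f j x) \<le> 2 * sqrt d * (1/2) ^ j"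
    by (rule geometric_steps_norm_le[OF s0, of "\<lambda>j. f j x"]) (rule step)
  also have "\<dots> \<le> 2 * sqrt d * 1"
    using s0 by (intro mult_left_mono power_le_one) auto
  finally show "norm (lim (\<lambda>j. f j x) - f j x) \<le> 2 * sqrt (enn2real (step_series f x))"
    by (simp add: d_def)
qed

text \<open>The rate 1/8 beats the weight 4 and leaves a geometric series of ratio 1/2.\<close>

lemma step_series_integral_finite:
  assumes [measurable]: "\<And>j. f j \<in> borel_measurable N"
    and step: "\<And>j. (\<integral>\<^sup>+x. ennreal ((norm (f (Suc j) x - f j x))\<^sup>2) \<partial>N) \<le> ennreal (c * (1/8) ^ j)" and c: "0 \<le> c"
  shows "(\<integral>\<^sup>+x. step_series f x \<partial>N) < \<infinity>"
proof -
  have "(\<integral>\<^sup>+x. step_series f x \<partial>N) = (\<Sum>j. \<integral>\<^sup>+x. ennreal (4 ^ j * (norm (f (Suc j) x - f j x))\<^sup>2) \<partial>N)"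
    unfolding step_series_def by (rule nn_integral_suminf) measurable
  also have "\<dots> \<le> (\<Sum>j. ennreal (c * (1/2) ^ j))"
  proof (intro suminf_le summableI)
    fix j
    have "(\<integral>\<^sup>+x. ennreal (4 ^ j * (norm (f (Suc j) x - f j x))\<^sup>2) \<partial>N) =
        ennreal (4 ^ j) * (\<integral>\<^sup>+x. ennreal ((norm (f (Suc j) x - f j x))\<^sup>2) \<partial>N)"
      by (subst nn_integral_cmult[symmetric]) (auto simp: ennreal_mult)
    also have "\<dots> \<le> ennreal (4 ^ j) * ennreal (c * (1/8) ^ j)"
      by (intro mult_left_mono step) simp
    also have "\<dots> = ennreal (4 ^ j * (c * (1/8) ^ j))"
      using c by (intro ennreal_mult[symmetric]) auto
    also have "4 ^ j * (c * (1/8) ^ j) = c * (1/2) ^ j"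
    proof -
      have "(4::real) ^ j * (1/8) ^ j = (4 * (1/8)) ^ j" by (rule power_mult_distrib[symmetric])
      then show ?thesis by simp
    qed
    finally show "(\<integral>\<^sup>+x. ennreal (4 ^ j * (norm (f (Suc j) x - f j x))\<^sup>2) \<partial>N) \<le> ennreal (c * (1/2) ^ j)" .
  qed
  also have "\<dots> = ennreal (\<Sum>j. c * (1/2) ^ j)"
    using c by (intro suminf_ennreal2 summable_mult summable_geometric) auto
  finally show ?thesis by (rule order_le_less_trans) simp
qed

section \<open>Mixed norms and balls with arbitrary centre\<close>

lemma L2_norm_le:
  assumes "(\<integral>\<^sup>+x. (f x)\<^sup>2 \<partial>N) \<le> ennreal (b\<^sup>2)" "0 \<le> b"
  shows "L2_norm N f \<le> ennreal b"
proof -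
  let ?I = "\<integral>\<^sup>+x. (f x)\<^sup>2 \<partial>N"
  have "?I \<noteq> \<infinity>" using assms(1) by (auto simp: top_unique)
  moreover have "enn2real ?I \<le> b\<^sup>2" using assms(1) by (simp add: enn2real_leI)
  then have "sqrt (enn2real ?I) \<le> b" using assms(2) by (simp add: real_le_lsqrt)
  ultimately show ?thesis by (simp add: L2_norm_def Let_def ennreal_leI)
qed

lemma L2_norm_square: "(L2_norm N f)\<^sup>2 = (\<integral>\<^sup>+x. (f x)\<^sup>2 \<partial>N)"
  by (simp add: L2_norm_def Let_def ennreal_power less_top)

lemma mixed_L2_norm_le:
  fixes u :: "real \<Rightarrow> 'a::euclidean_space \<Rightarrow> complex"
  assumes S: "S \<in> sets borel" and b: "0 \<le> b"
    and le: "(\<integral>\<^sup>+t. (\<integral>\<^sup>+x. ennreal ((norm (u t x))\<^sup>2) * indicator S x \<partial>lborel) \<partial>M) \<le> ennreal (b\<^sup>2)"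
  shows "mixed_L2_norm M S u \<le> ennreal b"
  unfolding mixed_L2_norm_def
proof (rule L2_norm_le[OF _ b])
  show "(\<integral>\<^sup>+t. (L2_norm (restrict_space lborel S) (\<lambda>x. ennreal (norm (u t x))))\<^sup>2 \<partial>M) \<le> ennreal (b\<^sup>2)"
    unfolding L2_norm_square using S le
    by (simp add: nn_integral_restrict_space ennreal_power)
qed

text \<open>Translating the ball to the origin multiplies the density by
  \<open>cis (x0 \<bullet> \<xi>)\<close>, which leaves its modulus unchanged.\<close>

lemma nn_integral_oscillatory_ball_le:
  fixes M :: "real measure" and \<alpha> \<gamma> C1 :: real and x0 :: "'a::euclidean_space"
  assumes \<gamma>: "\<gamma> > 1" and \<alpha>: "\<alpha> > 0" and fin: "finite_measure M" and sets: "sets M = sets borel" and C1: "0 \<le> C1"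
    and mass: "\<And>t r. r > 0 \<Longrightarrow> (\<integral>\<^sup>+t'. ennreal (exp (- (norm (r *\<^sub>R (t - t')))\<^sup>2 / 2)) \<partial>M) \<le>
      ennreal (C1 * r powr (- \<alpha>))"
  shows "\<exists>C\<ge>0. \<forall>F::'a \<Rightarrow> complex. integrable lborel F \<longrightarrow>
    (\<integral>\<^sup>+t. (\<integral>\<^sup>+x. ennreal ((norm (\<integral>\<xi>. cis (x \<bullet> \<xi>) * (cis (t * norm \<xi> powr \<gamma>) * F \<xi>) \<partial>lborel))\<^sup>2) *
      indicator (ball x0 1) x \<partial>lborel) \<partial>M) \<le>
    ennreal C * (\<integral>\<^sup>+\<xi>. ennreal ((1 + (norm \<xi>)\<^sup>2) powr (\<alpha> * (1 - \<gamma>) / 2) * (norm (F \<xi>))\<^sup>2) \<partial>lborel)"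
proof -
  obtain C where C: "0 \<le> C" and est: "\<And>F::'a \<Rightarrow> complex. integrable lborel F \<Longrightarrow>
    (\<integral>\<^sup>+t. (\<integral>\<^sup>+x. ennreal ((norm (\<integral>\<xi>. cis (x \<bullet> \<xi>) * (cis (t * norm \<xi> powr \<gamma>) * F \<xi>) \<partial>lborel))\<^sup>2) *
      indicator (ball 0 1) x \<partial>lborel) \<partial>M) \<le>
    ennreal C * (\<integral>\<^sup>+\<xi>. ennreal ((1 + (norm \<xi>)\<^sup>2) powr (\<alpha> * (1 - \<gamma>) / 2) * (norm (F \<xi>))\<^sup>2) \<partial>lborel)"
    using nn_integral_oscillatory_unit_ball_le[OF \<gamma> \<alpha> fin sets C1 mass] by blast
  have "(\<integral>\<^sup>+t. (\<integral>\<^sup>+x. ennreal ((norm (\<integral>\<xi>. cis (x \<bullet> \<xi>) * (cis (t * norm \<xi> powr \<gamma>) * F \<xi>) \<partial>lborel))\<^sup>2) *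
      indicator (ball x0 1) x \<partial>lborel) \<partial>M) \<le>
    ennreal C * (\<integral>\<^sup>+\<xi>. ennreal ((1 + (norm \<xi>)\<^sup>2) powr (\<alpha> * (1 - \<gamma>) / 2) * (norm (F \<xi>))\<^sup>2) \<partial>lborel)"
    if F: "integrable lborel F" for F :: "'a \<Rightarrow> complex"
  proof -
    have [measurable]: "F \<in> borel_measurable borel" using F by auto
    define F' where "F' \<xi> = cis (x0 \<bullet> \<xi>) * F \<xi>" for \<xi>
    have F': "integrable lborel F'"
      unfolding F'_def[abs_def] by (rule Bochner_Integration.integrable_bound[OF F]) (auto simp: norm_mult)
    have [measurable]: "F' \<in> borel_measurable borel" using F' by auto
    have "(\<integral>\<^sup>+x. ennreal ((norm (\<integral>\<xi>. cis (x \<bullet> \<xi>) * (cis (t * norm \<xi> powr \<gamma>) * F \<xi>) \<partial>lborel))\<^sup>2) *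
        indicator (ball x0 1) x \<partial>lborel) =
      (\<integral>\<^sup>+x. ennreal ((norm (\<integral>\<xi>. cis (x \<bullet> \<xi>) * (cis (t * norm \<xi> powr \<gamma>) * F' \<xi>) \<partial>lborel))\<^sup>2) *
        indicator (ball 0 1) x \<partial>lborel)" for t
    proof -
      let ?h = "\<lambda>x. ennreal ((norm (\<integral>\<xi>. cis (x \<bullet> \<xi>) * (cis (t * norm \<xi> powr \<gamma>) * F' \<xi>) \<partial>lborel))\<^sup>2) *
        indicator (ball 0 1) x"
      have "cis (x \<bullet> \<xi>) * (cis (t * norm \<xi> powr \<gamma>) * F \<xi>) =
          cis ((x - x0) \<bullet> \<xi>) * (cis (t * norm \<xi> powr \<gamma>) * F' \<xi>)" for x \<xi>
      proof -
        have "cis (x \<bullet> \<xi>) = cis ((x - x0) \<bullet> \<xi>) * cis (x0 \<bullet> \<xi>)"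
          by (simp add: cis_mult inner_diff_left)
        then show ?thesis by (simp only: F'_def mult_ac)
      qed
      moreover have "indicator (ball x0 1) x = (indicator (ball 0 1) (x - x0) :: ennreal)" for x
        by (auto simp: indicator_def dist_norm norm_minus_commute)
      ultimately have "(\<integral>\<^sup>+x. ennreal ((norm (\<integral>\<xi>. cis (x \<bullet> \<xi>) * (cis (t * norm \<xi> powr \<gamma>) * F \<xi>) \<partial>lborel))\<^sup>2) *
        indicator (ball x0 1) x \<partial>lborel) = (\<integral>\<^sup>+x. ?h (x - x0) \<partial>lborel)"
        by (simp only:)
      also have "\<dots> = (\<integral>\<^sup>+x. ?h x \<partial>lborel)"
        by (rule nn_integral_lborel_minus) measurable
      finally show ?thesis .
    qed
    moreover have "norm (F' \<xi>) = norm (F \<xi>)" for \<xi> by (simp add: F'_def norm_mult)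
    ultimately show ?thesis using est[OF F'] by simp
  qed
  with C show ?thesis by blast
qed

text \<open>Fubini moves the transform onto \<phi>. This identifies the function with integrable
  density \<open>F\<close> with the distribution that the propagator assigns to that
  density.\<close>

lemma integral_transform_mult:
  fixes F \<phi> :: "'a::euclidean_space \<Rightarrow> complex"
  assumes F: "integrable lborel F" and \<phi>: "integrable lborel \<phi>"
  shows "(\<integral>x. of_real (1 / (2 * pi) ^ DIM('a)) * (\<integral>\<xi>. cis (x \<bullet> \<xi>) * F \<xi> \<partial>lborel) * \<phi> x \<partial>lborel) =
    (\<integral>\<xi>. F \<xi> * inv_fourier \<phi> \<xi> \<partial>lborel)"
proof -
  let ?c = "of_real (1 / (2 * pi) ^ DIM('a)) :: complex"
  have [measurable]: "F \<in> borel_measurable borel" "\<phi> \<in> borel_measurable borel"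
    using F \<phi> by auto
  have int: "integrable (lborel \<Otimes>\<^sub>M lborel) (\<lambda>(x, \<xi>). ?c * (cis (x \<bullet> \<xi>) * F \<xi>) * \<phi> x)"
  proof (rule Bochner_Integration.integrable_bound)
    show "integrable (lborel \<Otimes>\<^sub>M lborel) (\<lambda>p. ?c * (case p of (x, \<xi>) \<Rightarrow> \<phi> x * F \<xi>))"
      by (intro integrable_mult_right lborel_pair.integrable_mult_prod F \<phi>)
    show "AE p in lborel \<Otimes>\<^sub>M lborel. norm (case p of (x, \<xi>) \<Rightarrow> ?c * (cis (x \<bullet> \<xi>) * F \<xi>) * \<phi> x) \<le>
        norm (?c * (case p of (x, \<xi>) \<Rightarrow> \<phi> x * F \<xi>))"
      by (rule AE_I2) (simp only: split_beta norm_mult norm_cis mult_1_left mult_ac order_refl)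
  qed measurable
  have "(\<integral>x. ?c * (\<integral>\<xi>. cis (x \<bullet> \<xi>) * F \<xi> \<partial>lborel) * \<phi> x \<partial>lborel) =
      (\<integral>x. (\<integral>\<xi>. ?c * (cis (x \<bullet> \<xi>) * F \<xi>) * \<phi> x \<partial>lborel) \<partial>lborel)"
    by (simp only: integral_mult_right_zero integral_mult_left_zero)
  also have "\<dots> = (\<integral>\<xi>. (\<integral>x. ?c * (cis (x \<bullet> \<xi>) * F \<xi>) * \<phi> x \<partial>lborel) \<partial>lborel)"
    by (rule lborel_pair.Fubini_integral[OF int, symmetric])
  also have "\<dots> = (\<integral>\<xi>. F \<xi> * inv_fourier \<phi> \<xi> \<partial>lborel)"
  proof (intro Bochner_Integration.integral_cong refl)
    fix \<xi>
    have "(\<integral>x. ?c * (cis (x \<bullet> \<xi>) * F \<xi>) * \<phi> x \<partial>lborel) = (\<integral>x. F \<xi> * (?c * (cis (\<xi> \<bullet> x) * \<phi> x)) \<partial>lborel)"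
      by (intro Bochner_Integration.integral_cong refl) (simp only: inner_commute[of \<xi>] mult_ac)
    then show "(\<integral>x. ?c * (cis (x \<bullet> \<xi>) * F \<xi>) * \<phi> x \<partial>lborel) = F \<xi> * inv_fourier \<phi> \<xi>"
      by (simp only: inv_fourier_def integral_mult_right_zero)
  qed
  finally show ?thesis .
qed

text \<open>On a bounded ball the weight is bounded below, by 1/a in the notation of the proof, so
  \<open>g\<close> is square integrable there, and |g| <= 1 + |g|^2 makes it integrable.\<close>

lemma integrable_truncation:
  fixes g :: "'a::euclidean_space \<Rightarrow> complex"
  assumes [measurable]: "g \<in> borel_measurable borel" and \<sigma>: "\<sigma> \<le> 0"
    and int: "integrable lborel (\<lambda>\<xi>. (1 + (norm \<xi>)\<^sup>2) powr \<sigma> * (norm (g \<xi>))\<^sup>2)"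
  shows "integrable lborel (\<lambda>\<xi>. g \<xi> * indicator (ball 0 (real n)) \<xi>)"
proof (rule Bochner_Integration.integrable_bound)
  let ?w = "\<lambda>\<xi>::'a. (1 + (norm \<xi>)\<^sup>2) powr \<sigma> * (norm (g \<xi>))\<^sup>2"
  define a where "a = (1 + (real n)\<^sup>2) powr (- \<sigma>)"
  show "integrable lborel (\<lambda>\<xi>. indicator (ball 0 (real n)) \<xi> + a * ?w \<xi>)"
    by (intro Bochner_Integration.integrable_add integrable_mult_right int integrable_real_indicator
        emeasure_lborel_ball_finite) simp
  show "AE \<xi> in lborel. norm (g \<xi> * indicator (ball 0 (real n)) \<xi>) \<le> norm (indicator (ball 0 (real n)) \<xi> + a * ?w \<xi>)"
  proof (rule AE_I2)
    fix \<xi> :: 'a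
    have "norm (g \<xi>) \<le> 1 + a * ?w \<xi>" if "norm \<xi> < real n"
    proof -
      have pos: "0 < 1 + (norm \<xi>)\<^sup>2" by (rule add_pos_nonneg) auto
      have "(norm \<xi>)\<^sup>2 \<le> (real n)\<^sup>2" using that by (intro power_mono) auto
      then have "(1 + (real n)\<^sup>2) powr \<sigma> \<le> (1 + (norm \<xi>)\<^sup>2) powr \<sigma>"
        by (intro powr_mono2'[OF \<sigma> pos]) simp
      then have "a * (1 + (real n)\<^sup>2) powr \<sigma> \<le> a * (1 + (norm \<xi>)\<^sup>2) powr \<sigma>"
        by (intro mult_left_mono) (simp_all add: a_def)
      moreover have "1 + (real n)\<^sup>2 \<noteq> 0"
        by (rule less_imp_neq[THEN not_sym], rule add_pos_nonneg) auto
      then have "a * (1 + (real n)\<^sup>2) powr \<sigma> = 1"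
        by (simp add: a_def powr_minus)
      ultimately have "1 * (norm (g \<xi>))\<^sup>2 \<le> (a * (1 + (norm \<xi>)\<^sup>2) powr \<sigma>) * (norm (g \<xi>))\<^sup>2"
        by (intro mult_right_mono) auto
      moreover have "norm (g \<xi>) \<le> 1 + (norm (g \<xi>))\<^sup>2"
      proof -
        have "0 \<le> (norm (g \<xi>) - 1)\<^sup>2" by simp
        then have "2 * norm (g \<xi>) \<le> 1 + (norm (g \<xi>))\<^sup>2" by (simp add: power2_diff)
        then show ?thesis using norm_ge_zero[of "g \<xi>"] by linarith
      qed
      ultimately show ?thesis by (simp add: mult.assoc)
    qed
    moreover have "0 \<le> a * ?w \<xi>" by (simp add: a_def)
    ultimately show "norm (g \<xi> * indicator (ball 0 (real n)) \<xi>) \<le> norm (indicator (ball 0 (real n)) \<xi> + a * ?w \<xi>)"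
      by (auto simp: indicator_def)
  qed
qed measurable

lemma tail_integral_tendsto:
  fixes h :: "'a::euclidean_space \<Rightarrow> real"
  assumes h: "integrable lborel h"
  shows "(\<lambda>n. \<integral>\<xi>. h \<xi> * indicator (- ball 0 (real n)) \<xi> \<partial>lborel) \<longlonglongrightarrow> 0"
proof -
  have [measurable]: "h \<in> borel_measurable borel" using h by auto
  have "(\<lambda>n. \<integral>\<xi>. h \<xi> * indicator (- ball 0 (real n)) \<xi> \<partial>lborel) \<longlonglongrightarrow> (\<integral>\<xi>. 0 \<partial>(lborel :: 'a measure))"
  proof (rule integral_dominated_convergence)
    show "AE \<xi> in lborel. (\<lambda>n. h \<xi> * indicator (- ball 0 (real n)) \<xi>) \<longlonglongrightarrow> 0"
    proof (rule AE_I2)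
      fix \<xi> :: 'a
      obtain m :: nat where m: "norm \<xi> < real m" using reals_Archimedean2 by blast
      have "\<forall>\<^sub>F n in sequentially. h \<xi> * indicator (- ball 0 (real n)) \<xi> = 0"
        using eventually_ge_at_top[of m] by eventually_elim (use m in \<open>auto simp: indicator_def\<close>)
      then show "(\<lambda>n. h \<xi> * indicator (- ball 0 (real n)) \<xi>) \<longlonglongrightarrow> 0" by (rule tendsto_eventually)
    qed
    show "AE \<xi> in lborel. norm (h \<xi> * indicator (- ball 0 (real n)) \<xi>) \<le> norm (h \<xi>)" for n
      by (auto simp: indicator_def)
    show "integrable lborel (\<lambda>\<xi>. norm (h \<xi>))" using h by simp
  qed auto
  then show ?thesis by simp
qed

text \<open>Each \<xi> is eventually inside the truncation because the radii dominate
  \<open>j\<close>; the untruncated product is an integrable majorant.\<close>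

lemma pairing_limit:
  fixes g \<phi> :: "'a::euclidean_space \<Rightarrow> complex" and N :: "nat \<Rightarrow> nat"
  assumes [measurable]: "g \<in> borel_measurable borel" and N: "\<And>j. j \<le> N j"
    and int: "integrable lborel (\<lambda>\<xi>. g \<xi> * inv_fourier \<phi> \<xi>)"
    and \<phi>[measurable]: "\<phi> \<in> borel_measurable borel"
  shows "(\<lambda>j. \<integral>\<xi>. cis (t * norm \<xi> powr \<gamma>) * (g \<xi> * indicator (ball 0 (real (N j))) \<xi>) * inv_fourier \<phi> \<xi> \<partial>lborel)
    \<longlonglongrightarrow> (\<integral>\<xi>. cis (t * norm \<xi> powr \<gamma>) * g \<xi> * inv_fourier \<phi> \<xi> \<partial>lborel)"
proof (rule integral_dominated_convergence)
  have [measurable]: "inv_fourier \<phi> \<in> borel_measurable borel"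
    unfolding inv_fourier_def[abs_def] by measurable
  show "(\<lambda>\<xi>. cis (t * norm \<xi> powr \<gamma>) * g \<xi> * inv_fourier \<phi> \<xi>) \<in> borel_measurable lborel"
    "\<And>j. (\<lambda>\<xi>. cis (t * norm \<xi> powr \<gamma>) * (g \<xi> * indicator (ball 0 (real (N j))) \<xi>) * inv_fourier \<phi> \<xi>) \<in> borel_measurable lborel"
    by measurable
  show "integrable lborel (\<lambda>\<xi>. norm (g \<xi> * inv_fourier \<phi> \<xi>))" using int by simp
  show "AE \<xi> in lborel. (\<lambda>j. cis (t * norm \<xi> powr \<gamma>) * (g \<xi> * indicator (ball 0 (real (N j))) \<xi>) * inv_fourier \<phi> \<xi>)
      \<longlonglongrightarrow> cis (t * norm \<xi> powr \<gamma>) * g \<xi> * inv_fourier \<phi> \<xi>"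
  proof (rule AE_I2)
    fix \<xi> :: 'a
    obtain m :: nat where m: "norm \<xi> < real m" using reals_Archimedean2 by blast
    have "\<forall>\<^sub>F j in sequentially. cis (t * norm \<xi> powr \<gamma>) * (g \<xi> * indicator (ball 0 (real (N j))) \<xi>) * inv_fourier \<phi> \<xi> =
        cis (t * norm \<xi> powr \<gamma>) * g \<xi> * inv_fourier \<phi> \<xi>"
      using eventually_ge_at_top[of m]
    proof eventually_elim
      case (elim j)
      have "norm \<xi> < real (N j)" using m elim N[of j] by linarith
      then show ?case by simp
    qed
    then show "(\<lambda>j. cis (t * norm \<xi> powr \<gamma>) * (g \<xi> * indicator (ball 0 (real (N j))) \<xi>) * inv_fourier \<phi> \<xi>)
      \<longlonglongrightarrow> cis (t * norm \<xi> powr \<gamma>) * g \<xi> * inv_fourier \<phi> \<xi>"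
      by (rule tendsto_eventually)
  qed
  show "AE \<xi> in lborel. norm (cis (t * norm \<xi> powr \<gamma>) * (g \<xi> * indicator (ball 0 (real (N j))) \<xi>) * inv_fourier \<phi> \<xi>) \<le>
      norm (g \<xi> * inv_fourier \<phi> \<xi>)" for j
    by (auto simp: norm_mult indicator_def)
qed

lemma test_function_on_properties:
  fixes \<phi> :: "'a::euclidean_space \<Rightarrow> complex"
  assumes "test_function_on S \<phi>"
  shows test_function_smooth: "smooth \<phi>" and test_function_compact: "compact (closure {x. \<phi> x \<noteq> 0})"
    and test_function_zero: "\<And>x. x \<notin> S \<Longrightarrow> \<phi> x = 0"
    and test_function_integrable: "integrable lborel \<phi>"
    and test_function_bounded: "\<exists>b\<ge>0. \<forall>x. norm (\<phi> x) \<le> b"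
proof -
  let ?K = "closure {x. \<phi> x \<noteq> 0}"
  show \<phi>: "smooth \<phi>" and K: "compact ?K"
    using assms unfolding test_function_on_def by blast+
  have sub: "?K \<subseteq> S" using assms unfolding test_function_on_def by blast
  have z: "\<phi> x = 0" if "x \<notin> ?K" for x
  proof (rule ccontr)
    assume "\<phi> x \<noteq> 0"
    then have "x \<in> ?K" by (intro subsetD[OF closure_subset] CollectI)
    with that show False by (rule notE)
  qed
  show "\<phi> x = 0" if "x \<notin> S" for x
    using that subsetD[OF sub] by (intro z) (rule contrapos_nn)
  have c: "continuous_on UNIV \<phi>" using smooth_continuous[OF \<phi>, of "[]"] by simp
  show "integrable lborel \<phi>"
    by (rule integrable_continuous_compact_support[OF c K z])
  have "bounded (\<phi> ` ?K)"
    by (intro compact_imp_bounded compact_continuous_image continuous_on_subset[OF c subset_UNIV] K)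
  then obtain b where b: "\<And>x. x \<in> ?K \<Longrightarrow> norm (\<phi> x) \<le> b"
    unfolding bounded_iff by blast
  have "norm (\<phi> x) \<le> max b 0" for x
  proof (cases "x \<in> ?K")
    case True
    from b[OF True] show ?thesis by (rule order_trans) (rule max.cobounded1)
  next
    case False
    from z[OF False] show ?thesis by simp
  qed
  then show "\<exists>b\<ge>0. \<forall>x. norm (\<phi> x) \<le> b" by (intro exI[of _ "max b 0"]) simp
qed

text \<open>Fatou's lemma.\<close>

lemma nn_integral_lim_le:
  fixes f :: "nat \<Rightarrow> 'b \<Rightarrow> complex"
  assumes [measurable]: "\<And>j. f j \<in> borel_measurable N"
    and lim: "AE x in N. (\<lambda>j. f j x) \<longlonglongrightarrow> u x"
    and le: "\<And>j. (\<integral>\<^sup>+x. ennreal ((norm (f j x))\<^sup>2) \<partial>N) \<le> B"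
  shows "(\<integral>\<^sup>+x. ennreal ((norm (u x))\<^sup>2) \<partial>N) \<le> B"
proof -
  have "AE x in N. ennreal ((norm (u x))\<^sup>2) = liminf (\<lambda>j. ennreal ((norm (f j x))\<^sup>2))"
    using lim
  proof eventually_elim
    case (elim x)
    then have "(\<lambda>j. ennreal ((norm (f j x))\<^sup>2)) \<longlonglongrightarrow> ennreal ((norm (u x))\<^sup>2)"
      by (intro tendsto_intros)
    from lim_imp_Liminf[OF _ this] show ?case by simp
  qed
  then have "(\<integral>\<^sup>+x. ennreal ((norm (u x))\<^sup>2) \<partial>N) = (\<integral>\<^sup>+x. liminf (\<lambda>j. ennreal ((norm (f j x))\<^sup>2)) \<partial>N)"
    by (rule nn_integral_cong_AE)
  also have "\<dots> \<le> liminf (\<lambda>j. \<integral>\<^sup>+x. ennreal ((norm (f j x))\<^sup>2) \<partial>N)"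
    by (rule nn_integral_liminf) measurable
  also have "\<dots> \<le> liminf (\<lambda>j::nat. B)"
    by (intro Liminf_mono always_eventually allI le)
  also have "\<dots> = B" by (simp add: Liminf_const)
  finally show ?thesis .
qed

text \<open>The truncated solutions form a fast Cauchy sequence in the L2 space of the product of
  \<open>M\<close> and Lebesgue measure on the ball, so \<open>step_series f\<close> is integrable
  there. Its finiteness gives the limit \<open>u\<close> almost everywhere; its finite integral in
  \<open>x\<close>, for almost every \<open>t\<close>, gives a majorant that allows the limit
  against every test function at once.\<close>

lemma exists_propagator_function:
  fixes M :: "real measure" and \<sigma> \<gamma> C :: real and x0 :: "'a::euclidean_space" and g :: "'a \<Rightarrow> complex"
  assumes fin: "finite_measure M" and sets: "sets M = sets borel" and \<sigma>: "\<sigma> \<le> 0" and C: "0 \<le> C"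
    and est: "\<And>F::'a \<Rightarrow> complex. integrable lborel F \<Longrightarrow>
      (\<integral>\<^sup>+t. (\<integral>\<^sup>+x. ennreal ((norm (\<integral>\<xi>. cis (x \<bullet> \<xi>) * (cis (t * norm \<xi> powr \<gamma>) * F \<xi>) \<partial>lborel))\<^sup>2) *
        indicator (ball x0 1) x \<partial>lborel) \<partial>M) \<le>
      ennreal C * (\<integral>\<^sup>+\<xi>. ennreal ((1 + (norm \<xi>)\<^sup>2) powr \<sigma> * (norm (F \<xi>))\<^sup>2) \<partial>lborel)"
    and g[measurable]: "g \<in> borel_measurable borel"
    and int: "integrable lborel (\<lambda>\<xi>. (1 + (norm \<xi>)\<^sup>2) powr \<sigma> * (norm (g \<xi>))\<^sup>2)"
  shows "\<exists>u. (\<lambda>(t, x). u t x) \<in> borel_measurable (borel \<Otimes>\<^sub>M borel) \<and>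
    (AE t in M. restricts_to_L2 (\<lambda>\<phi>. \<integral>\<xi>. cis (t * norm \<xi> powr \<gamma>) * g \<xi> * inv_fourier \<phi> \<xi> \<partial>lborel) (ball x0 1) (u t)) \<and>
    (\<integral>\<^sup>+t. (\<integral>\<^sup>+x. ennreal ((norm (u t x))\<^sup>2) * indicator (ball x0 1) x \<partial>lborel) \<partial>M) \<le>
      ennreal ((1 / (2 * pi) ^ DIM('a))\<^sup>2 * C * (\<integral>\<xi>. (1 + (norm \<xi>)\<^sup>2) powr \<sigma> * (norm (g \<xi>))\<^sup>2 \<partial>lborel))"
proof -
  interpret M: finite_measure M by fact
  interpret P: pair_sigma_finite M "lborel :: 'a measure" ..
  have [measurable_cong]: "sets M = sets borel" by fact
  let ?N = "M \<Otimes>\<^sub>M (lborel :: 'a measure)"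
  have sets_N: "sets ?N = sets (borel \<Otimes>\<^sub>M borel)"
    by (intro sets_pair_measure_cong sets sets_lborel)
  define B where "B = ball x0 1"
  have B[measurable]: "B \<in> sets borel" by (simp add: B_def)
  define \<kappa> where "\<kappa> = 1 / (2 * pi) ^ DIM('a)"
  have \<kappa>: "0 < \<kappa>" by (simp add: \<kappa>_def)
  let ?h = "\<lambda>\<xi>. (1 + (norm \<xi>)\<^sup>2) powr \<sigma> * (norm (g \<xi>))\<^sup>2"
  have h0: "0 \<le> ?h \<xi>" for \<xi> by simp
  define tail where "tail n = (\<integral>\<xi>. ?h \<xi> * indicator (- ball 0 (real n)) \<xi> \<partial>lborel)" for n
  have tail_int: "integrable lborel (\<lambda>\<xi>. ?h \<xi> * indicator (- ball 0 (real n)) \<xi>)" for n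
    by (rule Bochner_Integration.integrable_bound[OF int]) (auto simp: indicator_def)
  \<comment> \<open>Radii for which the omitted part of the Sobolev norm decays like 8^(-j), the
    rate required by \<open>step_series\<close>; n >= j makes the truncations exhaust the
    space.\<close>
  have "\<exists>n\<ge>j. tail n \<le> (1/8) ^ j" for j :: nat
  proof -
    have "\<forall>\<^sub>F n in sequentially. tail n < (1/8) ^ j"
      using tail_integral_tendsto[OF int] unfolding tail_def by (rule order_tendstoD) simp
    then obtain n0 where "\<And>n. n0 \<le> n \<Longrightarrow> tail n < (1/8) ^ j" by (auto simp: eventually_sequentially)
    then show ?thesis by (intro exI[of _ "max n0 j"]) (simp add: less_imp_le)
  qed
  then obtain N where N: "\<And>j. j \<le> N j" "\<And>j. tail (N j) \<le> (1/8) ^ j" by metis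
  define G where "G j \<xi> = g \<xi> * indicator (ball 0 (real (N j))) \<xi>" for j \<xi>
  have G: "integrable lborel (G j)" for j
    unfolding G_def[abs_def] by (rule integrable_truncation[OF g \<sigma> int])
  have [measurable]: "G j \<in> borel_measurable borel" for j using G[of j] by auto
  define V where "V F t x = of_real \<kappa> * (\<integral>\<xi>. cis (x \<bullet> \<xi>) * (cis (t * norm \<xi> powr \<gamma>) * F \<xi>) \<partial>lborel)"
    for F :: "'a \<Rightarrow> complex" and t x
  define f where "f j = (\<lambda>(t, x). indicator B x * V (G j) t x)" for j
  \<comment> \<open>\<open>lim\<close> is total, so \<open>u\<close> is defined and jointly Borel
    measurable everywhere, also at points where the truncations diverge.\<close>
  define u where "u t x = lim (\<lambda>j. f j (t, x))" for t x
  have f_borel[measurable]: "f j \<in> borel_measurable (borel \<Otimes>\<^sub>M borel)" for j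
    unfolding f_def V_def by measurable
  have f_N[measurable]: "f j \<in> borel_measurable ?N" for j
    using f_borel[of j] unfolding measurable_cong_sets[OF sets_N refl] .
  have u_borel[measurable]: "(\<lambda>(t, x). u t x) \<in> borel_measurable (borel \<Otimes>\<^sub>M borel)"
  proof -
    have "(\<lambda>p. lim (\<lambda>j. f j p)) \<in> borel_measurable (borel \<Otimes>\<^sub>M borel)"
      by (rule borel_measurable_lim_metric) (rule f_borel)
    then show ?thesis by (simp add: u_def case_prod_unfold)
  qed
  have est_N: "(\<integral>\<^sup>+(t, x). ennreal ((norm (indicator B x * V F t x))\<^sup>2) \<partial>?N) \<le>
      ennreal (\<kappa>\<^sup>2 * C) * (\<integral>\<^sup>+\<xi>. ennreal ((1 + (norm \<xi>)\<^sup>2) powr \<sigma> * (norm (F \<xi>))\<^sup>2) \<partial>lborel)"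
    if F: "integrable lborel F" for F
  proof -
    have [measurable]: "F \<in> borel_measurable borel" using F by auto
    let ?W = "\<lambda>t x. \<integral>\<xi>. cis (x \<bullet> \<xi>) * (cis (t * norm \<xi> powr \<gamma>) * F \<xi>) \<partial>lborel"
    have "(\<lambda>(t, x). ennreal ((norm (indicator B x * V F t x))\<^sup>2)) \<in> borel_measurable (borel \<Otimes>\<^sub>M borel)"
      unfolding V_def by measurable
    then have m: "(\<lambda>(t, x). ennreal ((norm (indicator B x * V F t x))\<^sup>2)) \<in> borel_measurable ?N"
      unfolding measurable_cong_sets[OF sets_N refl] .
    have "(\<integral>\<^sup>+(t, x). ennreal ((norm (indicator B x * V F t x))\<^sup>2) \<partial>?N) =
        (\<integral>\<^sup>+t. (\<integral>\<^sup>+x. ennreal ((norm (indicator B x * V F t x))\<^sup>2) \<partial>lborel) \<partial>M)"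
      using lborel.nn_integral_fst[OF m] by simp
    also have "\<dots> = (\<integral>\<^sup>+t. (\<integral>\<^sup>+x. ennreal (\<kappa>\<^sup>2) * (ennreal ((norm (?W t x))\<^sup>2) * indicator B x) \<partial>lborel) \<partial>M)"
      by (intro nn_integral_cong)
         (auto simp: V_def norm_mult power_mult_distrib ennreal_mult indicator_def)
    also have "\<dots> = ennreal (\<kappa>\<^sup>2) * (\<integral>\<^sup>+t. (\<integral>\<^sup>+x. ennreal ((norm (?W t x))\<^sup>2) * indicator B x \<partial>lborel) \<partial>M)"
      by (subst nn_integral_cmult[symmetric], measurable) (intro nn_integral_cong nn_integral_cmult, measurable)
    also have "\<dots> \<le> ennreal (\<kappa>\<^sup>2) * (ennreal C * (\<integral>\<^sup>+\<xi>. ennreal ((1 + (norm \<xi>)\<^sup>2) powr \<sigma> * (norm (F \<xi>))\<^sup>2) \<partial>lborel))"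
      unfolding B_def by (intro mult_left_mono est F) simp
    finally show ?thesis using C by (simp add: ennreal_mult mult.assoc)
  qed
  have V_diff: "V (G i) t x - V (G j) t x = V (\<lambda>\<xi>. G i \<xi> - G j \<xi>) t x" for i j t x
  proof -
    have "integrable lborel (\<lambda>\<xi>. cis (x \<bullet> \<xi>) * (cis (t * norm \<xi> powr \<gamma>) * G k \<xi>))" for k
      by (rule Bochner_Integration.integrable_bound[OF G[of k]]) (auto simp: norm_mult)
    then show ?thesis
      by (simp add: V_def right_diff_distrib)
  qed
  have step: "(\<integral>\<^sup>+p. ennreal ((norm (f (Suc j) p - f j p))\<^sup>2) \<partial>?N) \<le> ennreal (\<kappa>\<^sup>2 * C * 2 * (1/8) ^ j)" for j
  proof -
    let ?D = "\<lambda>\<xi>. G (Suc j) \<xi> - G j \<xi>"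
    have "(\<integral>\<^sup>+p. ennreal ((norm (f (Suc j) p - f j p))\<^sup>2) \<partial>?N) =
        (\<integral>\<^sup>+(t, x). ennreal ((norm (indicator B x * V ?D t x))\<^sup>2) \<partial>?N)"
      by (intro nn_integral_cong) (auto simp: f_def V_diff[symmetric] right_diff_distrib)
    also have "\<dots> \<le> ennreal (\<kappa>\<^sup>2 * C) * (\<integral>\<^sup>+\<xi>. ennreal ((1 + (norm \<xi>)\<^sup>2) powr \<sigma> * (norm (?D \<xi>))\<^sup>2) \<partial>lborel)"
      by (intro est_N Bochner_Integration.integrable_diff G)
    \<comment> \<open>The radii \<open>N j\<close> need not increase, so the difference of two
      truncations may live outside either ball; the sum of both tails covers both orders.\<close>
    also have "(\<integral>\<^sup>+\<xi>. ennreal ((1 + (norm \<xi>)\<^sup>2) powr \<sigma> * (norm (?D \<xi>))\<^sup>2) \<partial>lborel) \<le>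
      (\<integral>\<^sup>+\<xi>. ennreal (?h \<xi> * indicator (- ball 0 (real (N (Suc j)))) \<xi> + ?h \<xi> * indicator (- ball 0 (real (N j))) \<xi>) \<partial>lborel)"
      by (intro nn_integral_mono ennreal_leI) (auto simp: G_def indicator_def)
    also have "\<dots> = ennreal (tail (N (Suc j)) + tail (N j))"
      unfolding tail_def using tail_int
      by (subst nn_integral_eq_integral) (auto intro!: Bochner_Integration.integrable_add)
    also have "\<dots> \<le> ennreal (2 * (1/8) ^ j)"
    proof (intro ennreal_leI)
      have "(1/8) ^ Suc j \<le> (1/8 :: real) ^ j" by (intro power_decreasing) auto
      then show "tail (N (Suc j)) + tail (N j) \<le> 2 * (1/8) ^ j"
        using N(2)[of "Suc j"] N(2)[of j] by linarith
    qed
    finally have "(\<integral>\<^sup>+p. ennreal ((norm (f (Suc j) p - f j p))\<^sup>2) \<partial>?N) \<le> ennreal (\<kappa>\<^sup>2 * C) * ennreal (2 * (1/8) ^ j)"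
      by (simp add: mult_left_mono)
    also have "\<dots> = ennreal (\<kappa>\<^sup>2 * C * (2 * (1/8) ^ j))"
      using C by (intro ennreal_mult[symmetric]) auto
    finally show ?thesis by (simp only: mult.assoc)
  qed
  have D_m[measurable]: "step_series f \<in> borel_measurable ?N"
    unfolding step_series_def[abs_def] by measurable
  have D_fin: "(\<integral>\<^sup>+p. step_series f p \<partial>?N) < \<infinity>"
    by (rule step_series_integral_finite[OF f_N step]) (use C in simp)
  have u_N: "(\<integral>\<^sup>+p. ennreal ((norm (u (fst p) (snd p)))\<^sup>2) \<partial>?N) \<le> ennreal (\<kappa>\<^sup>2 * C * (\<integral>\<xi>. ?h \<xi> \<partial>lborel))"
  proof (rule nn_integral_lim_le[OF f_N])
    have "AE p in ?N. step_series f p \<noteq> \<infinity>"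
      using D_fin by (intro nn_integral_PInf_AE D_m) auto
    then show "AE p in ?N. (\<lambda>j. f j p) \<longlonglongrightarrow> u (fst p) (snd p)"
      by eventually_elim (auto simp: u_def less_top intro: step_series_tendsto)
    fix j
    have "(\<integral>\<^sup>+p. ennreal ((norm (f j p))\<^sup>2) \<partial>?N) = (\<integral>\<^sup>+(t, x). ennreal ((norm (indicator B x * V (G j) t x))\<^sup>2) \<partial>?N)"
      by (intro nn_integral_cong) (auto simp: f_def)
    also have "\<dots> \<le> ennreal (\<kappa>\<^sup>2 * C) * (\<integral>\<^sup>+\<xi>. ennreal ((1 + (norm \<xi>)\<^sup>2) powr \<sigma> * (norm (G j \<xi>))\<^sup>2) \<partial>lborel)"
      by (rule est_N[OF G])
    also have "\<dots> \<le> ennreal (\<kappa>\<^sup>2 * C) * (\<integral>\<^sup>+\<xi>. ennreal (?h \<xi>) \<partial>lborel)"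
      by (intro mult_left_mono nn_integral_mono ennreal_leI) (auto simp: G_def indicator_def)
    also have "(\<integral>\<^sup>+\<xi>. ennreal (?h \<xi>) \<partial>lborel) = ennreal (\<integral>\<xi>. ?h \<xi> \<partial>lborel)"
      using int by (rule nn_integral_eq_integral) simp
    finally show "(\<integral>\<^sup>+p. ennreal ((norm (f j p))\<^sup>2) \<partial>?N) \<le> ennreal (\<kappa>\<^sup>2 * C * (\<integral>\<xi>. ?h \<xi> \<partial>lborel))"
      using C by (simp add: ennreal_mult)
  qed
  have "(\<integral>\<^sup>+t. (\<integral>\<^sup>+x. ennreal ((norm (u t x))\<^sup>2) * indicator B x \<partial>lborel) \<partial>M) \<le>
      (\<integral>\<^sup>+t. (\<integral>\<^sup>+x. ennreal ((norm (u t x))\<^sup>2) \<partial>lborel) \<partial>M)"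
    by (intro nn_integral_mono) (auto simp: indicator_def)
  also have "\<dots> = (\<integral>\<^sup>+p. ennreal ((norm (u (fst p) (snd p)))\<^sup>2) \<partial>?N)"
  proof -
    have "(\<lambda>p. u (fst p) (snd p)) \<in> borel_measurable ?N"
      using u_borel unfolding measurable_cong_sets[OF sets_N refl] by (simp add: case_prod_unfold)
    then have "(\<lambda>p. ennreal ((norm (u (fst p) (snd p)))\<^sup>2)) \<in> borel_measurable ?N" by measurable
    from lborel.nn_integral_fst[OF this] show ?thesis by simp
  qed
  also note u_N
  finally have bound: "(\<integral>\<^sup>+t. (\<integral>\<^sup>+x. ennreal ((norm (u t x))\<^sup>2) * indicator B x \<partial>lborel) \<partial>M) \<le>
      ennreal (\<kappa>\<^sup>2 * C * (\<integral>\<xi>. ?h \<xi> \<partial>lborel))" .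
  have "AE t in M. restricts_to_L2 (\<lambda>\<phi>. \<integral>\<xi>. cis (t * norm \<xi> powr \<gamma>) * g \<xi> * inv_fourier \<phi> \<xi> \<partial>lborel) B (u t)"
  proof -
    have m: "(\<lambda>t. \<integral>\<^sup>+x. step_series f (t, x) \<partial>lborel) \<in> borel_measurable M" by measurable
    \<comment> \<open>Tonelli selects the good times here, before any test function is
      introduced.\<close>
    have "(\<integral>\<^sup>+t. (\<integral>\<^sup>+x. step_series f (t, x) \<partial>lborel) \<partial>M) \<noteq> \<infinity>"
      using D_fin lborel.nn_integral_fst[OF D_m] by simp
    then have "AE t in M. (\<integral>\<^sup>+x. step_series f (t, x) \<partial>lborel) \<noteq> \<infinity>"
      by (intro nn_integral_PInf_AE m) auto
    then show ?thesis
    proof eventually_elim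
      case (elim t)
      define d where "d x = enn2real (step_series f (t, x))" for x
      have Dt_m[measurable]: "(\<lambda>x. step_series f (t, x)) \<in> borel_measurable borel"
        unfolding step_series_def by measurable
      have [measurable]: "d \<in> borel_measurable borel" unfolding d_def[abs_def] by measurable
      have d0: "0 \<le> d x" for x by (simp add: d_def)
      have AE_fin: "AE x in lborel. step_series f (t, x) < \<infinity>"
        using nn_integral_PInf_AE[of "\<lambda>x. step_series f (t, x)" lborel] elim by (auto simp: less_top)
      have d_int: "integrable lborel d"
      proof (rule integrableI_bounded)
        have "(\<integral>\<^sup>+x. ennreal (norm (d x)) \<partial>lborel) \<le> (\<integral>\<^sup>+x. step_series f (t, x) \<partial>lborel)"
          by (intro nn_integral_mono) (auto simp: d_def ennreal_enn2real_if)
        then show "(\<integral>\<^sup>+x. ennreal (norm (d x)) \<partial>lborel) < \<infinity>"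
          using elim by (simp add: less_top order_le_less_trans)
      qed measurable
      \<comment> \<open>\<open>f 0\<close> comes from an integrable density and is bounded; it turns
        bounds on differences into bounds on \<open>u t\<close> and on every
        \<open>f j\<close>.\<close>
      define b where "b = \<kappa> * (\<integral>\<xi>. norm (G 0 \<xi>) \<partial>lborel)"
      have b0: "0 \<le> b" using \<kappa> by (simp add: b_def)
      have f0: "norm (f 0 (t, x)) \<le> b" for x
      proof -
        have "norm (\<integral>\<xi>. cis (x \<bullet> \<xi>) * (cis (t * norm \<xi> powr \<gamma>) * G 0 \<xi>) \<partial>lborel) \<le>
            (\<integral>\<xi>. norm (cis (x \<bullet> \<xi>) * (cis (t * norm \<xi> powr \<gamma>) * G 0 \<xi>)) \<partial>lborel)"
          by (rule integral_norm_bound)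
        then have "norm (\<integral>\<xi>. cis (x \<bullet> \<xi>) * (cis (t * norm \<xi> powr \<gamma>) * G 0 \<xi>) \<partial>lborel) \<le> (\<integral>\<xi>. norm (G 0 \<xi>) \<partial>lborel)"
          by (simp add: norm_mult)
        then have "norm (V (G 0) t x) \<le> b"
          unfolding V_def b_def norm_mult using \<kappa> by (simp add: mult_left_mono)
        then show ?thesis using b0 by (auto simp: f_def indicator_def)
      qed
      have AE_u: "AE x in lborel. (\<lambda>j. f j (t, x)) \<longlonglongrightarrow> u t x"
        using AE_fin by eventually_elim (simp add: u_def step_series_tendsto)
      have AE_diff: "AE x in lborel. \<forall>j. norm (u t x - f j (t, x)) \<le> 2 * sqrt (d x)"
        using AE_fin by eventually_elim (simp add: u_def d_def step_series_norm_le)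
      have ut[measurable]: "u t \<in> borel_measurable borel"
        using measurable_Pair2[OF u_borel, of t] by simp
      have ft[measurable]: "(\<lambda>x. f j (t, x)) \<in> borel_measurable borel" for j by measurable
      have ind_int: "integrable lborel (\<lambda>x. indicator B x * c)" for c :: real
        unfolding B_def by (intro integrable_mult_left integrable_real_indicator emeasure_lborel_ball_finite) simp
      \<comment> \<open>The differences are controlled by sqrt (d x), while \<open>d\<close> is what
        is integrable; on a bounded ball the additional 1 is harmless.\<close>
      have sqrt_le: "sqrt a \<le> 1 + a" if "0 \<le> a" for a :: real
      proof (rule real_le_lsqrt)
        show "a \<le> (1 + a)\<^sup>2" using that by (simp add: power2_sum)
      qed (use that in auto)
      have "set_integrable lborel B (\<lambda>x. (norm (u t x))\<^sup>2)"
        unfolding set_integrable_def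
      proof (rule Bochner_Integration.integrable_bound)
        show "integrable lborel (\<lambda>x. indicator B x * (2 * b\<^sup>2) + 8 * d x)"
          by (intro Bochner_Integration.integrable_add ind_int integrable_mult_right d_int)
        show "AE x in lborel. norm (indicator B x *\<^sub>R (norm (u t x))\<^sup>2) \<le> norm (indicator B x * (2 * b\<^sup>2) + 8 * d x)"
          using AE_diff
        proof eventually_elim
          case (elim x)
          have "norm (u t x) \<le> norm (f 0 (t, x)) + norm (u t x - f 0 (t, x))"
            using norm_triangle_ineq[of "f 0 (t, x)" "u t x - f 0 (t, x)"] by simp
          also have "\<dots> \<le> b + 2 * sqrt (d x)" using elim by (intro add_mono f0) auto
          finally have "(norm (u t x))\<^sup>2 \<le> (b + 2 * sqrt (d x))\<^sup>2" by (intro power_mono) auto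
          also have "\<dots> \<le> 2 * b\<^sup>2 + 2 * (2 * sqrt (d x))\<^sup>2"
            using sum_squares_bound[of b "2 * sqrt (d x)"] by (simp add: power2_sum)
          also have "2 * (2 * sqrt (d x))\<^sup>2 = 8 * d x" using d0[of x] by (simp add: power_mult_distrib)
          finally have "(norm (u t x))\<^sup>2 \<le> 2 * b\<^sup>2 + 8 * d x" .
          then show ?case using d0[of x] by (auto simp: indicator_def)
        qed
      qed measurable
      show ?case
        unfolding restricts_to_L2_def
      proof (intro conjI allI impI)
        show "u t \<in> borel_measurable borel" by (rule ut)
        show "set_integrable lborel B (\<lambda>x. (norm (u t x))\<^sup>2)" by fact
        fix \<phi> assume \<phi>: "test_function_on B \<phi>"
        show "(\<integral>\<xi>. cis (t * norm \<xi> powr \<gamma>) * g \<xi> * inv_fourier \<phi> \<xi> \<partial>lborel) = (LINT x:B|lborel. u t x * \<phi> x)"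
        \<comment> \<open>Both sides are limits of the same truncated pairings: in frequency by the
          decay of \<open>inv_fourier \<phi>\<close>, in space by the convergence of
          \<open>f j\<close> to \<open>u t\<close>.\<close>
        proof (rule LIMSEQ_unique)
          have \<phi>_int: "integrable lborel \<phi>" by (rule test_function_integrable[OF \<phi>])
          then have [measurable]: "\<phi> \<in> borel_measurable borel" by auto
          obtain K where K: "0 \<le> K" "\<And>x. norm (\<phi> x) \<le> K" using test_function_bounded[OF \<phi>] by blast
          have eq: "(\<integral>x. indicator B x *\<^sub>R (f j (t, x) * \<phi> x) \<partial>lborel) =
              (\<integral>\<xi>. cis (t * norm \<xi> powr \<gamma>) * (g \<xi> * indicator (ball 0 (real (N j))) \<xi>) * inv_fourier \<phi> \<xi> \<partial>lborel)" for j
          proof -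
            have cG: "integrable lborel (\<lambda>\<xi>. cis (t * norm \<xi> powr \<gamma>) * G j \<xi>)"
              by (rule Bochner_Integration.integrable_bound[OF G[of j]]) (auto simp: norm_mult)
            have "(\<integral>x. indicator B x *\<^sub>R (f j (t, x) * \<phi> x) \<partial>lborel) = (\<integral>x. V (G j) t x * \<phi> x \<partial>lborel)"
              using test_function_zero[OF \<phi>]
              by (intro Bochner_Integration.integral_cong refl) (auto simp: f_def indicator_def)
            also have "\<dots> = (\<integral>\<xi>. cis (t * norm \<xi> powr \<gamma>) * G j \<xi> * inv_fourier \<phi> \<xi> \<partial>lborel)"
              unfolding V_def \<kappa>_def by (rule integral_transform_mult[OF cG \<phi>_int])
            finally show ?thesis unfolding G_def .
          qed
          show "(\<lambda>j. \<integral>x. indicator B x *\<^sub>R (f j (t, x) * \<phi> x) \<partial>lborel) \<longlonglongrightarrow>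
              (\<integral>\<xi>. cis (t * norm \<xi> powr \<gamma>) * g \<xi> * inv_fourier \<phi> \<xi> \<partial>lborel)"
            unfolding eq
            by (intro pairing_limit g N integrable_mult_inv_fourier[OF _ _ g \<sigma> int]
                test_function_smooth[OF \<phi>] test_function_compact[OF \<phi>]) measurable
          show "(\<lambda>j. \<integral>x. indicator B x *\<^sub>R (f j (t, x) * \<phi> x) \<partial>lborel) \<longlonglongrightarrow> (LINT x:B|lborel. u t x * \<phi> x)"
            unfolding set_lebesgue_integral_def
          proof (rule integral_dominated_convergence)
            show "integrable lborel (\<lambda>x. (indicator B x * (b + 4) + 4 * d x) * K)"
              by (intro integrable_mult_left Bochner_Integration.integrable_add ind_int integrable_mult_right d_int)
            show "AE x in lborel. (\<lambda>j. indicator B x *\<^sub>R (f j (t, x) * \<phi> x)) \<longlonglongrightarrow> indicator B x *\<^sub>R (u t x * \<phi> x)"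
              using AE_u by eventually_elim (intro tendsto_intros)
            fix j
            show "AE x in lborel. norm (indicator B x *\<^sub>R (f j (t, x) * \<phi> x)) \<le> (indicator B x * (b + 4) + 4 * d x) * K"
              using AE_diff
            proof eventually_elim
              case (elim x)
              \<comment> \<open>Both \<open>f 0\<close> and \<open>f j\<close> are within 2 sqrt (d
                x) of the limit, so the majorant does not depend on \<open>j\<close>.\<close>
              have "norm (f j (t, x)) \<le> norm (f 0 (t, x)) + norm ((u t x - f 0 (t, x)) - (u t x - f j (t, x)))"
                using norm_triangle_ineq[of "f 0 (t, x)" "f j (t, x) - f 0 (t, x)"] by simp
              also have "\<dots> \<le> norm (f 0 (t, x)) + (norm (u t x - f 0 (t, x)) + norm (u t x - f j (t, x)))"
                by (intro add_left_mono norm_triangle_ineq4)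
              also have "\<dots> \<le> b + (2 * sqrt (d x) + 2 * sqrt (d x))"
                using elim by (intro add_mono f0) auto
              also have "\<dots> \<le> b + 4 + 4 * d x" using sqrt_le[OF d0[of x]] by simp
              finally have le: "norm (f j (t, x)) \<le> b + 4 + 4 * d x" .
              have "norm (f j (t, x)) * norm (\<phi> x) \<le> (b + 4 + 4 * d x) * K"
                using b0 d0[of x] by (intro mult_mono le K) auto
              moreover have "0 \<le> d x * K" using d0[of x] K(1) by simp
              ultimately show ?case by (auto simp: indicator_def norm_mult mult.commute[of K])
            qed
          qed measurable
        qed
      qed
    qed
  qed
  with u_borel bound show ?thesis unfolding B_def \<kappa>_def by blast
qed

text \<open>As 1 + |\<xi>|^2 is at least 1, lowering the exponent from \<open>s\<close> to \<sigma>
  only decreases the integral. The constant is the normalisation of the inverse transform times the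
  root of \<open>C\<close>, since the estimate is for squares.\<close>

lemma mixed_L2_norm_propagator_le:
  fixes M :: "real measure" and s \<sigma> \<gamma> C :: real and x0 :: "'a::euclidean_space" and f :: "'a distribution"
  assumes fin: "finite_measure M" and sets: "sets M = sets borel" and \<sigma>: "\<sigma> \<le> 0" and s: "\<sigma> \<le> s" and C: "0 \<le> C"
    and est: "\<And>F::'a \<Rightarrow> complex. integrable lborel F \<Longrightarrow>
      (\<integral>\<^sup>+t. (\<integral>\<^sup>+x. ennreal ((norm (\<integral>\<xi>. cis (x \<bullet> \<xi>) * (cis (t * norm \<xi> powr \<gamma>) * F \<xi>) \<partial>lborel))\<^sup>2) *
        indicator (ball x0 1) x \<partial>lborel) \<partial>M) \<le>
      ennreal C * (\<integral>\<^sup>+\<xi>. ennreal ((1 + (norm \<xi>)\<^sup>2) powr \<sigma> * (norm (F \<xi>))\<^sup>2) \<partial>lborel)"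
    and f: "f \<in> sobolev s"
  shows "\<exists>u :: real \<Rightarrow> 'a \<Rightarrow> complex.
      (\<lambda>(t, x). u t x) \<in> borel_measurable (borel \<Otimes>\<^sub>M borel) \<and>
      (AE t in M. restricts_to_L2 (propagator \<gamma> t f) (ball x0 1) (u t)) \<and>
      mixed_L2_norm M (ball x0 1) u \<le> ennreal ((1 / (2 * pi) ^ DIM('a) * sqrt C) * sobolev_norm s f)"
proof -
  define \<kappa> where "\<kappa> = 1 / (2 * pi) ^ DIM('a)"
  define g where "g = fourier_function f"
  have "has_fourier_function f g"
    \<comment> \<open>Membership in \<open>sobolev s\<close> includes the existence of a Fourier
      function, so the choice in \<open>fourier_function\<close> does return one.\<close>
    using f unfolding g_def fourier_function_def sobolev_def mem_Collect_eq
    by (elim conjE) (rule someI_ex[of "has_fourier_function f"])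
  then have g[measurable]: "g \<in> borel_measurable borel" by (simp add: has_fourier_function_def)
  have int_s: "integrable lborel (\<lambda>\<xi>. (1 + (norm \<xi>)\<^sup>2) powr s * (norm (g \<xi>))\<^sup>2)"
    using f by (simp add: sobolev_def g_def)
  have le: "(1 + (norm \<xi>)\<^sup>2) powr \<sigma> * (norm (g \<xi>))\<^sup>2 \<le> (1 + (norm \<xi>)\<^sup>2) powr s * (norm (g \<xi>))\<^sup>2" for \<xi>
    using s by (intro mult_right_mono powr_mono) simp_all
  have int: "integrable lborel (\<lambda>\<xi>. (1 + (norm \<xi>)\<^sup>2) powr \<sigma> * (norm (g \<xi>))\<^sup>2)"
    by (rule Bochner_Integration.integrable_bound[OF int_s]) (use le in auto)
  define S where "S = sobolev_norm s f"
  have S2: "S\<^sup>2 = (\<integral>\<xi>. (1 + (norm \<xi>)\<^sup>2) powr s * (norm (g \<xi>))\<^sup>2 \<partial>lborel)"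
    unfolding S_def sobolev_norm_def g_def[symmetric]
    by (intro real_sqrt_pow2 Bochner_Integration.integral_nonneg) simp
  have S0: "0 \<le> S" unfolding S_def sobolev_norm_def
    by (intro real_sqrt_ge_zero Bochner_Integration.integral_nonneg) simp
  have "(\<integral>\<xi>. (1 + (norm \<xi>)\<^sup>2) powr \<sigma> * (norm (g \<xi>))\<^sup>2 \<partial>lborel) \<le> S\<^sup>2"
    unfolding S2 by (intro integral_mono int int_s le)
  then have bound: "\<kappa>\<^sup>2 * C * (\<integral>\<xi>. (1 + (norm \<xi>)\<^sup>2) powr \<sigma> * (norm (g \<xi>))\<^sup>2 \<partial>lborel) \<le> (\<kappa> * sqrt C * S)\<^sup>2"
    using C by (simp add: power_mult_distrib mult_left_mono)
  obtain u where u: "(\<lambda>(t, x). u t x) \<in> borel_measurable (borel \<Otimes>\<^sub>M borel)"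
    "AE t in M. restricts_to_L2 (\<lambda>\<phi>. \<integral>\<xi>. cis (t * norm \<xi> powr \<gamma>) * g \<xi> * inv_fourier \<phi> \<xi> \<partial>lborel) (ball x0 1) (u t)"
    "(\<integral>\<^sup>+t. (\<integral>\<^sup>+x. ennreal ((norm (u t x))\<^sup>2) * indicator (ball x0 1) x \<partial>lborel) \<partial>M) \<le>
      ennreal (\<kappa>\<^sup>2 * C * (\<integral>\<xi>. (1 + (norm \<xi>)\<^sup>2) powr \<sigma> * (norm (g \<xi>))\<^sup>2 \<partial>lborel))"
    by (rule exE[OF exists_propagator_function[OF fin sets \<sigma> C _ g int, folded \<kappa>_def]], rule est, assumption, elim conjE, rule that)
  have "mixed_L2_norm M (ball x0 1) u \<le> ennreal (\<kappa> * sqrt C * S)"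
  proof (rule mixed_L2_norm_le)
    show "0 \<le> \<kappa> * sqrt C * S" using C S0 by (simp add: \<kappa>_def)
    show "(\<integral>\<^sup>+t. (\<integral>\<^sup>+x. ennreal ((norm (u t x))\<^sup>2) * indicator (ball x0 1) x \<partial>lborel) \<partial>M) \<le>
        ennreal ((\<kappa> * sqrt C * S)\<^sup>2)"
      by (rule order_trans[OF u(3) ennreal_leI[OF bound]])
  qed simp
  with u(1,2) show ?thesis unfolding S_def g_def propagator_def \<kappa>_def by (intro exI conjI)
qed

text \<open>For negative \<open>s\<close> the solution at a fixed time is a priori only a
  distribution, so the norm is that of a jointly measurable \<open>u\<close> whose slices represent
  it on the ball for \<open>M\<close>-almost every time. \<open>C\<close> is chosen before
  \<open>f\<close>.\<close>

theorem theorem1p6: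
  fixes \<gamma> \<alpha> C0 s :: real and M :: "real measure" and x0 :: "'a::euclidean_space"
  assumes "\<gamma> > 1" and "0 < \<alpha>" and "\<alpha> \<le> 1"
    and "sets M = sets borel"
    and "measure_support M \<subseteq> {0..1}"
    and "\<And>t \<rho>. \<rho> > 0 \<Longrightarrow> emeasure M {t - \<rho><..<t + \<rho>} \<le> ennreal (C0 * \<rho> powr \<alpha>)"
    and "s \<ge> \<alpha> * (1 - \<gamma>) / 2"
  shows "\<exists>C::real. \<forall>f \<in> (sobolev s :: 'a distribution set).
    \<exists>u :: real \<Rightarrow> 'a \<Rightarrow> complex.
      (\<lambda>(t, x). u t x) \<in> borel_measurable (borel \<Otimes>\<^sub>M borel) \<and>
      (AE t in M. restricts_to_L2 (propagator \<gamma> t f) (ball x0 1) (u t)) \<and>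
      mixed_L2_norm M (ball x0 1) u \<le> ennreal (C * sobolev_norm s f)"
proof -
  \<comment> \<open>The endpoint exponent, at which the estimate is proved; every admissible
    \<open>s\<close> lies above it.\<close>
  define \<sigma> where "\<sigma> = \<alpha> * (1 - \<gamma>) / 2"
  have \<sigma>: "\<sigma> \<le> 0" "\<sigma> \<le> s" using assms(1,2,7) by (simp_all add: \<sigma>_def mult_nonneg_nonpos)
  have fin: "finite_measure M"
    using assms(6)[of 2 0] by (intro finite_measure_of_support[OF assms(4,5)]) simp
  obtain C1 where C1: "0 \<le> C1" and mass: "\<And>t r. r > 0 \<Longrightarrow>
      (\<integral>\<^sup>+t'. ennreal (exp (- (norm (r *\<^sub>R (t - t')))\<^sup>2 / 2)) \<partial>M) \<le> ennreal (C1 * r powr (- \<alpha>))"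
    using gaussian_mass_le[OF assms(2-4,6)] by blast
  have "\<exists>C\<ge>0. \<forall>F::'a \<Rightarrow> complex. integrable lborel F \<longrightarrow>
      (\<integral>\<^sup>+t. (\<integral>\<^sup>+x. ennreal ((norm (\<integral>\<xi>. cis (x \<bullet> \<xi>) * (cis (t * norm \<xi> powr \<gamma>) * F \<xi>) \<partial>lborel))\<^sup>2) *
        indicator (ball x0 1) x \<partial>lborel) \<partial>M) \<le>
      ennreal C * (\<integral>\<^sup>+\<xi>. ennreal ((1 + (norm \<xi>)\<^sup>2) powr \<sigma> * (norm (F \<xi>))\<^sup>2) \<partial>lborel)"
    unfolding \<sigma>_def by (rule nn_integral_oscillatory_ball_le[OF assms(1,2) fin assms(4) C1 mass])
  then show ?thesis
  proof (elim exE conjE)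
    fix C
    assume C: "0 \<le> C" and est: "\<forall>F::'a \<Rightarrow> complex. integrable lborel F \<longrightarrow>
      (\<integral>\<^sup>+t. (\<integral>\<^sup>+x. ennreal ((norm (\<integral>\<xi>. cis (x \<bullet> \<xi>) * (cis (t * norm \<xi> powr \<gamma>) * F \<xi>) \<partial>lborel))\<^sup>2) *
        indicator (ball x0 1) x \<partial>lborel) \<partial>M) \<le>
      ennreal C * (\<integral>\<^sup>+\<xi>. ennreal ((1 + (norm \<xi>)\<^sup>2) powr \<sigma> * (norm (F \<xi>))\<^sup>2) \<partial>lborel)"
    show ?thesis
      by (rule exI, rule ballI, rule mixed_L2_norm_propagator_le[OF fin assms(4) \<sigma> C est[rule_format]])
  qed
qed

end
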